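(* Let $J>0$, $\beta>0$, $k=2$ and $\theta=e^{\beta J/2}>1$, and consider the Ising model with triple mixed spins $(\tfrac12,1,\tfrac32)$ on the Cayley tree $\Gamma^2$. Assume $s_2(\theta):=f'(1,\theta,2)-1>0$ (derivative in the first variable), and let $x_-(\theta)<1<x_+(\theta)$ denote the minimal and the maximal positive solutions of $x=f(x,\theta,2)$. Let $\mu^-$ and $\mu^+$ be the minimal and maximal Gibbs measures, obtained as weak limits of the finite-volume Gibbs measures with all boundary spins fixed to their minimal, respectively maximal, values. Then $\mu^-$ and $\mu^+$ are translation-invariant splitting Gibbs measures corresponding to the constant boundary laws given by the fixed points $x_-(\theta)$ and $x_+(\theta)$ (so with $\Psi$-component ratios $X=x_-(\theta)^2$ and $X=x_+(\theta)^2$), respectively; equivalently, $$\mu^-=\mu_{x_-(\theta)},\qquad \mu^+=\mu_{x_+(\theta)}.$$ Moreover, $\mu^-$ and $\mu^+$ are extremal Gibbs measures.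
   Context: Tree. $\Gamma^2=(V,L)$ is the semi-infinite Cayley tree of order $2$: an infinite tree with root $x^{(0)}$ in which the root has exactly $2$ edges and every other vertex has exactly $3$ edges. $d$ is graph distance, $W_n=\{x: d(x,x^{(0)})=n\}$, $V_n=\bigcup_{m=0}^n W_m$, $L_n$ is the set of edges with both endpoints in $V_n$, and $\Gamma^2_i=\{x\in V: d(x^{(0)},x)\equiv i \pmod 3\}$ for $i=0,1,2$. Model. $\Psi=\{-\tfrac12,\tfrac12\}$, $\Phi=\{-1,0,1\}$, $\Upsilon=\{-\tfrac32,-\tfrac12,\tfrac12,\tfrac32\}$. The spin set $S_x$ of a vertex $x$ is $\Psi$, $\Phi$ or $\Upsilon$ according to whether $x\in\Gamma^2_0$, $\Gamma^2_1$ or $\Gamma^2_2$. Configurations are $\xi\in\Xi=\prod_{x\in V}S_x$, and $\Xi_n=\prod_{x\in V_n}S_x$. The Hamiltonian is $H(\xi)=-J\sum_{\langle x,y\rangle\in L}\xi(x)\xi(y)$, and $H_n(\xi)=-J\sum_{\langle x,y\rangle\in L_n}\xi(x)\xi(y)$ for $\xi\in\Xi_n$. Gibbs measures. A Gibbs measure is a probability measure on $\Xi$ satisfying the DLR equations for this nearest-neighbour Hamiltonian at inverse temperature $\beta$. It is extremal if it cannot be represented as a non-trivial convex combination of other Gibbs measures. Plus/minus measures. Let $\xi^+$ (resp. $\xi^-$) be the configuration equal to $\tfrac12,1,\tfrac32$ (resp. $-\tfrac12,-1,-\tfrac32$) on $\Gamma^2_0,\Gamma^2_1,\Gamma^2_2$.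 $\mu^{\pm,n}$ is the probability measure on $\Xi_n$ proportional to $\exp\{-\beta H_n(\xi)\}$ restricted to $\{\xi\in\Xi_n:\xi=\xi^\pm\text{ on }W_n\}$, and $\mu^\pm=\lim_{n\to\infty}\mu^{\pm,n}$ (weak limits, which exist). They are the minimal and maximal Gibbs measures for the stochastic order induced by the coordinatewise order on configurations. Splitting Gibbs measures. Given a family of real vectors $h_x=(h_{s,x})_{s\in S_x}$, $x\in V$, let $\mu_n^h(\xi)=\frac1{Z_n}\exp\{-\beta H_n(\xi)+\sum_{x\in W_n}h_{\xi(x),x}\}$, $\xi\in\Xi_n$. If $\sum_{\omega\in\prod_{x\in W_n}S_x}\mu_n^h(\xi_{n-1}\vee\omega)=\mu_{n-1}^h(\xi_{n-1})$ for all $n\ge1$ and $\xi_{n-1}\in\Xi_{n-1}$ ($\vee$ denotes concatenation), the unique probability measure on $\Xi$ with marginals $\mu_n^h$ on $V_n$ is called a splitting Gibbs measure. Put $X_x=e^{h_{1/2,x}-h_{-1/2,x}}$ for $x\in\Gamma_0^2$; $Y_x=e^{h_{-1,x}-h_{0,x}}$, $Z_x=e^{h_{1,x}-h_{0,x}}$ for $x\in\Gamma_1^2$; $T_x=e^{h_{-3/2,x}-h_{-1/2,x}}$, $U_x=e^{h_{1/2,x}-h_{-1/2,x}}$, $N_x=e^{h_{3/2,x}-h_{-1/2,x}}$ for $x\in\Gamma_2^2$. A splitting Gibbs measure is translation-invariant (a TISGM) if it comes from a compatible family $h$ for which these quantities are constants $X,Y,Z,T,U,N>0$ not depending on $x$.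 Scalar map (with $k=2$). For $x>0$ let $$T(x)=\Big(\tfrac{x^2+\theta^3}{\theta^2+\theta x^2}\Big)^2,\quad U(x)=\Big(\tfrac{\theta x^2+1}{x^2+\theta}\Big)^2,\quad N(x)=\Big(\tfrac{\theta^3x^2+1}{\theta^2+\theta x^2}\Big)^2,$$ $$p(x)=\Big(\tfrac{\theta^6T(x)+\theta^4+\theta^2U(x)+N(x)}{\theta^3(T(x)+1+U(x)+N(x))}\Big)^2,\quad q(x)=\Big(\tfrac{T(x)+\theta^2+\theta^4U(x)+\theta^6N(x)}{\theta^3(T(x)+1+U(x)+N(x))}\Big)^2,$$ $$f(x,\theta,2)=\frac{p(x)+\theta+\theta^2q(x)}{\theta^2p(x)+\theta+q(x)}.$$ Constant compatible boundary laws correspond exactly to positive fixed points $x=f(x,\theta,2)$ via $X=x^2$, $T=T(x)$, $U=U(x)$, $N=N(x)$, $Y=p(x)$, $Z=q(x)$; $\mu_x$ denotes the TISGM associated with the fixed point $x$. *)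

theory Defs
  imports "HOL-Probability.Probability"
begin

section \<open>The semi-infinite Cayley tree of order 2\<close>

text \<open>Vertices are finite words over a two-letter alphabet: the root is the empty word and the two
  direct successors of \<open>x\<close> are \<open>True # x\<close> and \<open>False # x\<close>.\<close>

type_synonym vertex = "bool list"

definition root :: vertex where
  "root = []"

definition tree_edges :: "vertex set set" where
  "tree_edges = {{x, b # x} | x b. True}"

definition graph_dist :: "vertex \<Rightarrow> vertex \<Rightarrow> nat" where
  "graph_dist x y = (LEAST n. (x, y) \<in> {(u, v). {u, v} \<in> tree_edges} ^^ n)"

definition sphere_W :: "nat \<Rightarrow> vertex set" where
  "sphere_W n = {x. graph_dist x root = n}"

definition ball_V :: "nat \<Rightarrow> vertex set" where
  "ball_V n = (\<Union>m\<le>n. sphere_W m)"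

definition ball_edges :: "nat \<Rightarrow> vertex set set" where
  "ball_edges n = {e \<in> tree_edges. e \<subseteq> ball_V n}"

definition level_class :: "nat \<Rightarrow> vertex set" where
  "level_class i = {x. graph_dist root x mod 3 = i}"

lemma tree_adj_iff:
  "{u, v} \<in> tree_edges \<longleftrightarrow> (\<exists>b. v = b # u) \<or> (\<exists>b. u = b # v)"
  unfolding tree_edges_def by (auto simp: doubleton_eq_iff)

lemma graph_dist_root: "graph_dist root x = length x"
proof -
  let ?R = "{(u, v). {u, v} \<in> tree_edges}"
  have lower: "length v \<le> length u + n" if "(u, v) \<in> ?R ^^ n" for u v n
    using that
  proof (induction n arbitrary: v)
    case (Suc n)
    then obtain w where w: "(u, w) \<in> ?R ^^ n" "{w, v} \<in> tree_edges" by auto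
    show ?case using Suc.IH[OF w(1)] w(2) by (auto simp: tree_adj_iff)
  qed auto
  have path: "(root, x) \<in> ?R ^^ length x"
  proof (induction x)
    case (Cons b x)
    have "{x, b # x} \<in> tree_edges" by (auto simp: tree_adj_iff)
    then show ?case using Cons by auto
  qed (simp add: root_def)
  show ?thesis
    unfolding graph_dist_def
    by (rule Least_equality) (use path lower in \<open>auto simp: root_def dest!: lower\<close>)
qed

lemma root_degree: "card {e \<in> tree_edges. root \<in> e} = 2"
proof -
  have "{e \<in> tree_edges. root \<in> e} = {{[], [True]}, {[], [False]}}"
    by (auto simp: root_def tree_edges_def)
  then show ?thesis by (simp add: doubleton_eq_iff)
qed

lemma nonroot_degree:
  assumes "x \<noteq> root" shows "card {e \<in> tree_edges. x \<in> e} = 3"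
proof -
  obtain a y where x: "x = a # y" using assms by (cases x) (auto simp: root_def)
  have "{e \<in> tree_edges. x \<in> e} = {{y, x}, {x, True # x}, {x, False # x}}"
    by (auto simp: x tree_edges_def)
  moreover have "card {{y, x}, {x, True # x}, {x, False # x}} = 3"
    by (auto simp: x doubleton_eq_iff card_insert_if)
  ultimately show ?thesis by simp
qed


section \<open>The Ising model with triple mixed spins\<close>

definition spins :: "vertex \<Rightarrow> real set" where
  "spins x =
    (if x \<in> level_class 0 then {-1/2, 1/2}
     else if x \<in> level_class 1 then {-1, 0, 1}
     else {-3/2, -1/2, 1/2, 3/2})"

definition configs :: "(vertex \<Rightarrow> real) set" where
  "configs = (\<Pi>\<^sub>E x\<in>UNIV. spins x)"

definition ball_configs :: "nat \<Rightarrow> (vertex \<Rightarrow> real) set" where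
  "ball_configs n = (\<Pi>\<^sub>E x\<in>ball_V n. spins x)"

definition config_algebra :: "(vertex \<Rightarrow> real) measure" where
  "config_algebra = (\<Pi>\<^sub>M x\<in>UNIV. count_space (spins x))"

definition config_topology :: "(vertex \<Rightarrow> real) topology" where
  "config_topology = product_topology (\<lambda>x. discrete_topology (spins x)) UNIV"

text \<open>An edge \<open>e = {x, y}\<close> contributes \<open>\<xi> x * \<xi> y\<close>, the product of the spins over \<open>e\<close>.\<close>

definition energy :: "real \<Rightarrow> vertex set set \<Rightarrow> (vertex \<Rightarrow> real) \<Rightarrow> real" where
  "energy J E \<xi> = - J * (\<Sum>e\<in>E. \<Prod>x\<in>e. \<xi> x)"

abbreviation ball_energy :: "real \<Rightarrow> nat \<Rightarrow> (vertex \<Rightarrow> real) \<Rightarrow> real" where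
  "ball_energy J n \<equiv> energy J (ball_edges n)"


section \<open>Gibbs measures\<close>

text \<open>The Gibbs specification in a finite volume \<open>\<Lambda>\<close> with boundary condition \<open>\<eta>\<close>: only the edges
  meeting \<open>\<Lambda>\<close> enter, the remaining terms of the Hamiltonian cancel in the quotient.\<close>

definition spec_weight ::
  "real \<Rightarrow> real \<Rightarrow> vertex set \<Rightarrow> (vertex \<Rightarrow> real) \<Rightarrow> real" where
  "spec_weight \<beta> J \<Lambda> \<xi> = exp (- \<beta> * energy J {e \<in> tree_edges. e \<inter> \<Lambda> \<noteq> {}} \<xi>)"

definition gibbs_spec ::
  "real \<Rightarrow> real \<Rightarrow> vertex set \<Rightarrow> (vertex \<Rightarrow> real) \<Rightarrow> (vertex \<Rightarrow> real) set \<Rightarrow> real" where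
  "gibbs_spec \<beta> J \<Lambda> \<eta> A =
    (\<Sum>\<sigma>\<in>(\<Pi>\<^sub>E x\<in>\<Lambda>. spins x).
        spec_weight \<beta> J \<Lambda> (override_on \<eta> \<sigma> \<Lambda>) * indicator A (override_on \<eta> \<sigma> \<Lambda>)) /
    (\<Sum>\<sigma>\<in>(\<Pi>\<^sub>E x\<in>\<Lambda>. spins x). spec_weight \<beta> J \<Lambda> (override_on \<eta> \<sigma> \<Lambda>))"

definition config_prob :: "(vertex \<Rightarrow> real) measure \<Rightarrow> bool" where
  "config_prob \<mu> \<longleftrightarrow> prob_space \<mu> \<and> sets \<mu> = sets config_algebra"

definition gibbs_measure :: "real \<Rightarrow> real \<Rightarrow> (vertex \<Rightarrow> real) measure \<Rightarrow> bool" where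
  "gibbs_measure \<beta> J \<mu> \<longleftrightarrow> config_prob \<mu> \<and>
    (\<forall>\<Lambda> A. finite \<Lambda> \<longrightarrow> A \<in> sets config_algebra \<longrightarrow>
      measure \<mu> A = (\<integral>\<eta>. gibbs_spec \<beta> J \<Lambda> \<eta> A \<partial>\<mu>))"

definition extremal_gibbs :: "real \<Rightarrow> real \<Rightarrow> (vertex \<Rightarrow> real) measure \<Rightarrow> bool" where
  "extremal_gibbs \<beta> J \<mu> \<longleftrightarrow> gibbs_measure \<beta> J \<mu> \<and>
    (\<forall>\<nu>\<^sub>1 \<nu>\<^sub>2 t. gibbs_measure \<beta> J \<nu>\<^sub>1 \<and> gibbs_measure \<beta> J \<nu>\<^sub>2 \<and> 0 < t \<and> t < 1 \<and>
      (\<forall>A\<in>sets config_algebra. measure \<mu> A = t * measure \<nu>\<^sub>1 A + (1 - t) * measure \<nu>\<^sub>2 A)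
      \<longrightarrow> \<nu>\<^sub>1 = \<mu> \<and> \<nu>\<^sub>2 = \<mu>)"

text \<open>Stochastic order, tested on continuous increasing functions (on the compact space of
  configurations these are automatically bounded and suffice for the order).\<close>

definition stoch_le :: "(vertex \<Rightarrow> real) measure \<Rightarrow> (vertex \<Rightarrow> real) measure \<Rightarrow> bool" where
  "stoch_le \<mu> \<nu> \<longleftrightarrow>
    (\<forall>f. continuous_map config_topology euclideanreal f \<and>
         (\<forall>\<xi>\<in>configs. \<forall>\<eta>\<in>configs. (\<forall>x. \<xi> x \<le> \<eta> x) \<longrightarrow> f \<xi> \<le> f \<eta>)
      \<longrightarrow> (\<integral>\<xi>. f \<xi> \<partial>\<mu>) \<le> (\<integral>\<xi>. f \<xi> \<partial>\<nu>))"

definition minimal_gibbs :: "real \<Rightarrow> real \<Rightarrow> (vertex \<Rightarrow> real) measure \<Rightarrow> bool" where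
  "minimal_gibbs \<beta> J \<mu> \<longleftrightarrow>
    gibbs_measure \<beta> J \<mu> \<and> (\<forall>\<nu>. gibbs_measure \<beta> J \<nu> \<longrightarrow> stoch_le \<mu> \<nu>)"

definition maximal_gibbs :: "real \<Rightarrow> real \<Rightarrow> (vertex \<Rightarrow> real) measure \<Rightarrow> bool" where
  "maximal_gibbs \<beta> J \<mu> \<longleftrightarrow>
    gibbs_measure \<beta> J \<mu> \<and> (\<forall>\<nu>. gibbs_measure \<beta> J \<nu> \<longrightarrow> stoch_le \<nu> \<mu>)"


section \<open>The plus and minus measures\<close>

definition config_plus :: "vertex \<Rightarrow> real" where
  "config_plus x = (if x \<in> level_class 0 then 1/2 else if x \<in> level_class 1 then 1 else 3/2)"

definition config_minus :: "vertex \<Rightarrow> real" where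
  "config_minus x =
    (if x \<in> level_class 0 then -1/2 else if x \<in> level_class 1 then -1 else -3/2)"

definition bc_weight ::
  "real \<Rightarrow> real \<Rightarrow> (vertex \<Rightarrow> real) \<Rightarrow> nat \<Rightarrow> (vertex \<Rightarrow> real) \<Rightarrow> real" where
  "bc_weight \<beta> J \<zeta> n \<xi> = exp (- \<beta> * ball_energy J n \<xi>) * of_bool (\<forall>x\<in>sphere_W n. \<xi> x = \<zeta> x)"

definition bc_measure ::
  "real \<Rightarrow> real \<Rightarrow> (vertex \<Rightarrow> real) \<Rightarrow> nat \<Rightarrow> (vertex \<Rightarrow> real) measure" where
  "bc_measure \<beta> J \<zeta> n =
    point_measure (ball_configs n)
      (\<lambda>\<xi>. ennreal (bc_weight \<beta> J \<zeta> n \<xi> / (\<Sum>\<xi>'\<in>ball_configs n. bc_weight \<beta> J \<zeta> n \<xi>')))"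

text \<open>To speak of weak limits, the measure on configurations in the ball is regarded as a measure
  on all configurations by continuing each configuration with \<open>\<zeta>\<close> outside the ball (the limit does
  not depend on the continuation).\<close>

definition bc_measure_ext ::
  "real \<Rightarrow> real \<Rightarrow> (vertex \<Rightarrow> real) \<Rightarrow> nat \<Rightarrow> (vertex \<Rightarrow> real) measure" where
  "bc_measure_ext \<beta> J \<zeta> n =
    distr (bc_measure \<beta> J \<zeta> n) config_algebra (\<lambda>\<xi>. override_on \<zeta> \<xi> (ball_V n))"

definition weak_limit ::
  "(nat \<Rightarrow> (vertex \<Rightarrow> real) measure) \<Rightarrow> (vertex \<Rightarrow> real) measure \<Rightarrow> bool" where
  "weak_limit M \<mu> \<longleftrightarrow> config_prob \<mu> \<and>
    (\<forall>f. continuous_map config_topology euclideanreal f \<and> bounded (f ` configs)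
      \<longrightarrow> (\<lambda>n. \<integral>\<xi>. f \<xi> \<partial>M n) \<longlonglongrightarrow> (\<integral>\<xi>. f \<xi> \<partial>\<mu>))"

definition mu_plus :: "real \<Rightarrow> real \<Rightarrow> (vertex \<Rightarrow> real) measure" where
  "mu_plus \<beta> J = (THE \<mu>. weak_limit (bc_measure_ext \<beta> J config_plus) \<mu>)"

definition mu_minus :: "real \<Rightarrow> real \<Rightarrow> (vertex \<Rightarrow> real) measure" where
  "mu_minus \<beta> J = (THE \<mu>. weak_limit (bc_measure_ext \<beta> J config_minus) \<mu>)"


section \<open>Splitting Gibbs measures\<close>

text \<open>A family of boundary fields is \<open>h x s\<close> for a vertex \<open>x\<close> and a spin value \<open>s \<in> spins x\<close>; the
  values at other \<open>s\<close> are irrelevant.\<close>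

definition field_weight ::
  "real \<Rightarrow> real \<Rightarrow> (vertex \<Rightarrow> real \<Rightarrow> real) \<Rightarrow> nat \<Rightarrow> (vertex \<Rightarrow> real) \<Rightarrow> real" where
  "field_weight \<beta> J h n \<xi> = exp (- \<beta> * ball_energy J n \<xi> + (\<Sum>x\<in>sphere_W n. h x (\<xi> x)))"

definition mu_field ::
  "real \<Rightarrow> real \<Rightarrow> (vertex \<Rightarrow> real \<Rightarrow> real) \<Rightarrow> nat \<Rightarrow> (vertex \<Rightarrow> real) \<Rightarrow> real" where
  "mu_field \<beta> J h n \<xi> =
    field_weight \<beta> J h n \<xi> / (\<Sum>\<xi>'\<in>ball_configs n. field_weight \<beta> J h n \<xi>')"

definition compatible_fields ::
  "real \<Rightarrow> real \<Rightarrow> (vertex \<Rightarrow> real \<Rightarrow> real) \<Rightarrow> bool" where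
  "compatible_fields \<beta> J h \<longleftrightarrow>
    (\<forall>n\<ge>1. \<forall>\<xi>\<in>ball_configs (n - 1).
      (\<Sum>\<omega>\<in>(\<Pi>\<^sub>E x\<in>sphere_W n. spins x).
         mu_field \<beta> J h n (merge (ball_V (n - 1)) (sphere_W n) (\<xi>, \<omega>)))
      = mu_field \<beta> J h (n - 1) \<xi>)"

definition has_field_marginals ::
  "real \<Rightarrow> real \<Rightarrow> (vertex \<Rightarrow> real \<Rightarrow> real) \<Rightarrow> (vertex \<Rightarrow> real) measure \<Rightarrow> bool" where
  "has_field_marginals \<beta> J h \<mu> \<longleftrightarrow> config_prob \<mu> \<and>
    (\<forall>n. \<forall>\<xi>\<in>ball_configs n.
      measure \<mu> {\<zeta> \<in> configs. restrict \<zeta> (ball_V n) = \<xi>} = mu_field \<beta> J h n \<xi>)"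

definition splitting_gibbs ::
  "real \<Rightarrow> real \<Rightarrow> (vertex \<Rightarrow> real \<Rightarrow> real) \<Rightarrow> (vertex \<Rightarrow> real) measure \<Rightarrow> bool" where
  "splitting_gibbs \<beta> J h \<mu> \<longleftrightarrow> compatible_fields \<beta> J h \<and> has_field_marginals \<beta> J h \<mu>"

definition const_boundary_law ::
  "(vertex \<Rightarrow> real \<Rightarrow> real) \<Rightarrow> real \<Rightarrow> real \<Rightarrow> real \<Rightarrow> real \<Rightarrow> real \<Rightarrow> real \<Rightarrow> bool" where
  "const_boundary_law h X Y Z T U N \<longleftrightarrow>
    (\<forall>x\<in>level_class 0. exp (h x (1/2) - h x (-1/2)) = X) \<and>
    (\<forall>x\<in>level_class 1. exp (h x (-1) - h x 0) = Y \<and> exp (h x 1 - h x 0) = Z) \<and>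
    (\<forall>x\<in>level_class 2. exp (h x (-3/2) - h x (-1/2)) = T \<and>
                       exp (h x (1/2) - h x (-1/2)) = U \<and>
                       exp (h x (3/2) - h x (-1/2)) = N)"

definition tisgm_with_law ::
  "real \<Rightarrow> real \<Rightarrow> real \<Rightarrow> real \<Rightarrow> real \<Rightarrow> real \<Rightarrow> real \<Rightarrow> real \<Rightarrow>
   (vertex \<Rightarrow> real) measure \<Rightarrow> bool" where
  "tisgm_with_law \<beta> J X Y Z T U N \<mu> \<longleftrightarrow>
    (\<exists>h. const_boundary_law h X Y Z T U N \<and> splitting_gibbs \<beta> J h \<mu>)"


section \<open>The scalar fixed-point equation\<close>

definition law_T :: "real \<Rightarrow> real \<Rightarrow> real" where
  "law_T \<theta> x = ((x^2 + \<theta>^3) / (\<theta>^2 + \<theta> * x^2))^2"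

definition law_U :: "real \<Rightarrow> real \<Rightarrow> real" where
  "law_U \<theta> x = ((\<theta> * x^2 + 1) / (x^2 + \<theta>))^2"

definition law_N :: "real \<Rightarrow> real \<Rightarrow> real" where
  "law_N \<theta> x = ((\<theta>^3 * x^2 + 1) / (\<theta>^2 + \<theta> * x^2))^2"

definition law_p :: "real \<Rightarrow> real \<Rightarrow> real" where
  "law_p \<theta> x =
    ((\<theta>^6 * law_T \<theta> x + \<theta>^4 + \<theta>^2 * law_U \<theta> x + law_N \<theta> x) /
     (\<theta>^3 * (law_T \<theta> x + 1 + law_U \<theta> x + law_N \<theta> x)))^2"

definition law_q :: "real \<Rightarrow> real \<Rightarrow> real" where
  "law_q \<theta> x =
    ((law_T \<theta> x + \<theta>^2 + \<theta>^4 * law_U \<theta> x + \<theta>^6 * law_N \<theta> x) /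
     (\<theta>^3 * (law_T \<theta> x + 1 + law_U \<theta> x + law_N \<theta> x)))^2"

definition law_map :: "real \<Rightarrow> real \<Rightarrow> real" where
  "law_map x \<theta> =
    (law_p \<theta> x + \<theta> + \<theta>^2 * law_q \<theta> x) / (\<theta>^2 * law_p \<theta> x + \<theta> + law_q \<theta> x)"

definition s2 :: "real \<Rightarrow> real" where
  "s2 \<theta> = deriv (\<lambda>x. law_map x \<theta>) 1 - 1"

definition positive_fixpoints :: "real \<Rightarrow> real set" where
  "positive_fixpoints \<theta> = {x. 0 < x \<and> x = law_map x \<theta>}"

definition tisgm_of_fixpoint ::
  "real \<Rightarrow> real \<Rightarrow> real \<Rightarrow> (vertex \<Rightarrow> real) measure \<Rightarrow> bool" where
  "tisgm_of_fixpoint \<beta> J x \<mu> \<longleftrightarrow>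
    (let \<theta> = exp (\<beta> * J / 2) in
     tisgm_with_law \<beta> J (x^2) (law_p \<theta> x) (law_q \<theta> x) (law_T \<theta> x) (law_U \<theta> x) (law_N \<theta> x) \<mu>)"

definition mu_fixpoint :: "real \<Rightarrow> real \<Rightarrow> real \<Rightarrow> (vertex \<Rightarrow> real) measure" where
  "mu_fixpoint \<beta> J x = (THE \<mu>. tisgm_of_fixpoint \<beta> J x \<mu>)"

end

theory Submission imports Defs begin

text \<open>
  A boundary law \<open>\<phi>\<close> on a sphere of the tree turns the ball into a finite Gibbs measure. Summing out the last
  level gives the same kind of measure on the next smaller ball, with the boundary law \<open>pass\<close> of \<open>\<phi>\<close>
  (\<open>ball_weight_integrate_sphere\<close>). Spins frozen at their maximal values are the special case of a point mass.
  The marginal of such a finite-volume measure on a fixed ball is therefore given by the message that arrives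
  from the frozen sphere, and three steps of message passing act on the ratio of the two weights of a
  \<open>\<Psi>\<close>-vertex as the scalar map: its square root is mapped by \<open>law_map\<close>.

  Message passing preserves the likelihood-ratio order, because the kernel \<open>exp (b * s * t)\<close> is totally
  positive (\<open>pass_lr_mono\<close>). A point mass at the largest spin is the greatest law in this order. So the
  messages from maximal boundary spins decrease as the sphere recedes, and they stay above every fixed point;
  their limit is a fixed point, hence the largest one (\<open>msg_ratio_top_tendsto\<close>). The minimal boundary spins lead
  to the smallest fixed point in the same way. The extreme fixed points exist and lie on either side of \<open>1\<close>
  because \<open>law_map\<close> has bounded range and slope greater than \<open>1\<close> at the fixed point \<open>1\<close> (\<open>extreme_fixpoints\<close>).
  The laws of a fixed point are consistent, so Kolmogorov's theorem provides a measure with the limiting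
  cylinder probabilities. It satisfies the DLR equations (\<open>gibbs_of_boundary_law\<close>), and since continuous functions
  on the compact configuration space are nearly local, it is the weak limit.

  The weights satisfy the hypothesis of the four functions theorem, so the specification is monotone in the
  boundary condition (\<open>spec_expect_mono\<close>). A Gibbs measure is a mixture of specifications with boundary
  conditions between the minimal and the maximal spins, and so lies stochastically between the two limits
  (\<open>stoch_le_weak_limit\<close>). Extremality follows: a component of a convex decomposition of the largest measure
  lies below it, so all increasing expectations agree, and increasing functions determine a measure
  because a cylinder indicator becomes increasing when the total spin of the ball is added (\<open>cyl_increasing\<close>).
\<close>

section \<open>Geometry of the rooted binary tree\<close>

lemma graph_dist_to_root: "graph_dist x root = length x"
proof -
  let ?R = "{(u, v). {u, v} \<in> tree_edges}"
  have rev: "(v, u) \<in> ?R ^^ n" if "(u, v) \<in> ?R ^^ n" for u v n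
    using that
  proof (induction n arbitrary: v)
    case (Suc n)
    then obtain w where "(u, w) \<in> ?R ^^ n" "(w, v) \<in> ?R" by auto
    then have "(v, w) \<in> ?R" "(w, u) \<in> ?R ^^ n"
      using Suc.IH by (auto simp: insert_commute)
    then show ?case by (rule relpow_Suc_I2)
  qed auto
  then have "(x, root) \<in> ?R ^^ n \<longleftrightarrow> (root, x) \<in> ?R ^^ n" for n
    by blast
  then have "graph_dist x root = graph_dist root x"
    unfolding graph_dist_def by simp
  then show ?thesis by (simp add: graph_dist_root)
qed

lemma sphere_W_eq: "sphere_W n = {x. length x = n}"
  by (simp add: sphere_W_def graph_dist_to_root)

lemma ball_V_eq: "ball_V n = {x. length x \<le> n}"
  by (auto simp: ball_V_def sphere_W_eq)

lemma level_class_eq: "level_class i = {x. length x mod 3 = i}"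
  by (simp add: level_class_def graph_dist_root)

lemma finite_ball_V [simp]: "finite (ball_V n)"
  using finite_lists_length_le[of "UNIV :: bool set" n] by (simp add: ball_V_eq)

lemma finite_sphere_W [simp]: "finite (sphere_W n)"
  by (rule finite_subset[OF _ finite_ball_V[of n]]) (auto simp: sphere_W_eq ball_V_eq)

lemma ball_V_mono: "m \<le> n \<Longrightarrow> ball_V m \<subseteq> ball_V n"
  by (auto simp: ball_V_eq)

lemma ball_V_Suc: "ball_V (Suc n) = ball_V n \<union> sphere_W (Suc n)"
  by (auto simp: ball_V_eq sphere_W_eq)

lemma ball_sphere_disjoint: "ball_V n \<inter> sphere_W (Suc n) = {}"
  by (auto simp: ball_V_eq sphere_W_eq)

lemma finite_subset_ball_V: "finite A \<Longrightarrow> \<exists>n. A \<subseteq> ball_V n"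
  by (rule exI[of _ "Max (length ` A)"]) (auto simp: ball_V_eq)

text \<open>Every vertex of level \<open>n\<close> is the parent of exactly two vertices of level \<open>n + 1\<close>.\<close>

lemma prod_sphere_W_Suc:
  "(\<Prod>y\<in>sphere_W (Suc n). F (tl y)) = (\<Prod>x\<in>sphere_W n. (F x)^2 :: real)"
proof -
  have split: "sphere_W (Suc n) = (#) True ` sphere_W n \<union> (#) False ` sphere_W n"
    by (auto simp: sphere_W_eq length_Suc_conv image_iff) 
  have "(\<Prod>y\<in>sphere_W (Suc n). F (tl y))
      = (\<Prod>y\<in>(#) True ` sphere_W n. F (tl y)) * (\<Prod>y\<in>(#) False ` sphere_W n. F (tl y))"
    unfolding split by (rule prod.union_disjoint) auto
  also have "\<dots> = (\<Prod>x\<in>sphere_W n. F x) * (\<Prod>x\<in>sphere_W n. F x)"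
    by (simp add: prod.reindex inj_on_def)
  finally show ?thesis by (simp add: prod.distrib power2_eq_square)
qed

text \<open>Every edge joins a unique non-root vertex \<open>y\<close> to its parent \<open>tl y\<close>, so sums over edges are sums
  over non-root vertices; \<open>edge_tops \<Lambda>\<close> lists the edges that meet \<open>\<Lambda>\<close> in this way.\<close>

definition edge_tops :: "vertex set \<Rightarrow> vertex set" where
  "edge_tops \<Lambda> = {y. y \<noteq> [] \<and> (y \<in> \<Lambda> \<or> tl y \<in> \<Lambda>)}"

lemma tree_edges_eq: "tree_edges = (\<lambda>y. {tl y, y}) ` {y. y \<noteq> []}"
  unfolding tree_edges_def
proof (intro equalityI subsetI)
  fix e :: "vertex set"
  assume "e \<in> (\<lambda>y. {tl y, y}) ` {y. y \<noteq> []}"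
  then obtain y where y: "e = {tl y, y}" "y \<noteq> []" by blast
  then show "e \<in> {{x, b # x} |x b. True}" by (cases y) auto
next
  fix e :: "vertex set"
  assume "e \<in> {{x, b # x} |x b. True}"
  then obtain x b where "e = {x, b # x}" by blast
  then show "e \<in> (\<lambda>y. {tl y, y}) ` {y. y \<noteq> []}" by (auto intro: image_eqI[where x = "b # x"])
qed

lemma inj_on_edge: "inj_on (\<lambda>y. {tl y, y}) {y::vertex. y \<noteq> []}"
proof (rule inj_onI)
  fix y z :: vertex
  assume "y \<in> {y. y \<noteq> []}" "z \<in> {y. y \<noteq> []}" "{tl y, y} = {tl z, z}"
  then obtain a u c v where "y = a # u" "z = c # v" "{u, a # u} = {v, c # v}"
    by (cases y; cases z) auto
  then show "y = z" by (auto simp: doubleton_eq_iff)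
qed

lemma sum_edges:
  fixes \<xi> :: "vertex \<Rightarrow> real"
  assumes "Y \<subseteq> {y. y \<noteq> []}"
  shows "(\<Sum>e\<in>(\<lambda>y. {tl y, y}) ` Y. \<Prod>x\<in>e. \<xi> x) = (\<Sum>y\<in>Y. \<xi> (tl y) * \<xi> y)"
proof -
  have "(\<Sum>e\<in>(\<lambda>y. {tl y, y}) ` Y. \<Prod>x\<in>e. \<xi> x) = (\<Sum>y\<in>Y. \<Prod>x\<in>{tl y, y}. \<xi> x)"
    using inj_on_subset[OF inj_on_edge assms] by (subst sum.reindex) auto
  also have "\<dots> = (\<Sum>y\<in>Y. \<xi> (tl y) * \<xi> y)"
  proof (rule sum.cong[OF refl])
    fix y assume "y \<in> Y"
    then obtain a u where "y = a # u" using assms by (cases y) auto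
    then show "(\<Prod>x\<in>{tl y, y}. \<xi> x) = \<xi> (tl y) * \<xi> y" by simp
  qed
  finally show ?thesis .
qed

lemma ball_energy_eq: "ball_energy J n \<xi> = - J * (\<Sum>y\<in>ball_V n - {[]}. \<xi> (tl y) * \<xi> y)"
proof -
  have "ball_edges n = (\<lambda>y. {tl y, y}) ` (ball_V n - {[]})"
    unfolding ball_edges_def tree_edges_eq by (auto simp: ball_V_eq)
  then show ?thesis unfolding energy_def by (subst sum_edges[symmetric]) auto
qed

lemma spec_weight_eq:
  "spec_weight \<beta> J \<Lambda> \<xi> = exp (\<beta> * J * (\<Sum>y\<in>edge_tops \<Lambda>. \<xi> (tl y) * \<xi> y))"
proof -
  have "{e \<in> tree_edges. e \<inter> \<Lambda> \<noteq> {}} = (\<lambda>y. {tl y, y}) ` edge_tops \<Lambda>"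
    unfolding tree_edges_eq edge_tops_def by auto
  then show ?thesis unfolding spec_weight_def energy_def
    by (subst sum_edges[symmetric]) (auto simp: edge_tops_def)
qed

lemma spec_weight_pos [simp]: "spec_weight \<beta> J \<Lambda> \<xi> > 0"
  by (simp add: spec_weight_def)

lemma edge_tops_ball_V: "edge_tops (ball_V n) = ball_V (Suc n) - {[]}"
  by (auto simp: edge_tops_def ball_V_eq)

section \<open>Spins, configurations and cylinders\<close>

definition level_spins :: "nat \<Rightarrow> real set" where
  "level_spins i = (if i mod 3 = 0 then {-1/2, 1/2} else if i mod 3 = 1 then {-1, 0, 1}
     else {-3/2, -1/2, 1/2, 3/2})"

lemma spins_eq: "spins x = level_spins (length x)"
  by (auto simp: spins_def level_spins_def level_class_eq)

lemma finite_level_spins [simp]: "finite (level_spins i)"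
  by (simp add: level_spins_def)

lemma finite_spins [simp]: "finite (spins x)"
  by (simp add: spins_eq)

lemma spins_gap: "s \<in> spins x \<Longrightarrow> t \<in> spins x \<Longrightarrow> s < t \<Longrightarrow> s + 1 \<le> t"
  by (auto simp: spins_def split: if_splits)

lemma config_plus_in [simp]: "config_plus x \<in> spins x"
  and config_minus_in [simp]: "config_minus x \<in> spins x"
  by (auto simp: config_plus_def config_minus_def spins_def)

lemma spins_bounds: "s \<in> spins x \<Longrightarrow> config_minus x \<le> s \<and> s \<le> config_plus x"
  by (auto simp: config_plus_def config_minus_def spins_def split: if_splits)

lemma configs_iff: "\<xi> \<in> configs \<longleftrightarrow> (\<forall>x. \<xi> x \<in> spins x)"
  by (auto simp: configs_def PiE_def)

lemma finite_ball_configs [simp]: "finite (ball_configs n)"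
  unfolding ball_configs_def by (intro finite_PiE) auto

lemma restrict_in_ball_configs [simp]: "\<zeta> \<in> configs \<Longrightarrow> restrict \<zeta> (ball_V n) \<in> ball_configs n"
  by (auto simp: ball_configs_def configs_iff)

lemma override_in_configs:
  "\<zeta> \<in> configs \<Longrightarrow> \<sigma> \<in> (\<Pi>\<^sub>E x\<in>\<Lambda>. spins x) \<Longrightarrow> override_on \<zeta> \<sigma> \<Lambda> \<in> configs"
  by (auto simp: configs_iff override_on_def)

lemma override_ball_in_configs:
  "\<zeta> \<in> configs \<Longrightarrow> \<sigma> \<in> ball_configs n \<Longrightarrow> override_on \<zeta> \<sigma> (ball_V n) \<in> configs"
  unfolding ball_configs_def by (rule override_in_configs)

definition cyl :: "nat \<Rightarrow> (vertex \<Rightarrow> real) \<Rightarrow> (vertex \<Rightarrow> real) set" where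
  "cyl n \<xi> = {\<zeta> \<in> configs. restrict \<zeta> (ball_V n) = \<xi>}"

lemma space_config_algebra [simp]: "space config_algebra = configs"
  by (simp add: config_algebra_def space_PiM configs_def)

lemma measurable_spin [measurable]:
  "(\<lambda>\<zeta>. \<zeta> x) \<in> measurable config_algebra (count_space (spins x))"
  unfolding config_algebra_def by (rule measurable_component_singleton) simp

lemma borel_measurable_spin [measurable]: "(\<lambda>\<zeta>. \<zeta> x) \<in> borel_measurable config_algebra"
  by (rule measurable_compose[OF measurable_spin]) simp

lemma cyl_sets [measurable]: "cyl n \<xi> \<in> sets config_algebra"
proof (cases "\<xi> \<in> extensional (ball_V n)")
  case True
  then have "cyl n \<xi> = {\<zeta> \<in> space config_algebra. \<forall>x\<in>ball_V n. \<zeta> x = \<xi> x}"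
    by (auto simp: cyl_def fun_eq_iff restrict_def extensional_def)
  also have "\<dots> \<in> sets config_algebra" by measurable
  finally show ?thesis .
next
  case False
  then have "cyl n \<xi> = {}" by (auto simp: cyl_def)
  then show ?thesis by simp
qed

lemma cyl_iff: "\<zeta> \<in> configs \<Longrightarrow> \<zeta> \<in> cyl n \<xi> \<longleftrightarrow> restrict \<zeta> (ball_V n) = \<xi>"
  by (auto simp: cyl_def)

lemma sum_cyl_indicator:
  assumes "\<zeta> \<in> configs"
  shows "(\<Sum>\<sigma>\<in>ball_configs n. \<phi> \<sigma> * indicator (cyl n \<sigma>) \<zeta>) = (\<phi> (restrict \<zeta> (ball_V n)) :: real)"
proof -
  have "(\<Sum>\<sigma>\<in>ball_configs n. \<phi> \<sigma> * indicator (cyl n \<sigma>) \<zeta>)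
      = (\<Sum>\<sigma>\<in>ball_configs n. if restrict \<zeta> (ball_V n) = \<sigma> then \<phi> \<sigma> else 0)"
    using assms by (intro sum.cong) (auto simp: indicator_def cyl_iff)
  then show ?thesis using assms by simp
qed

text \<open>Functions of the spins in a ball are linear combinations of cylinder indicators, so
  \<open>ball_expect n \<phi> \<mu>\<close> is the expectation of such a function.\<close>

definition ball_expect ::
  "nat \<Rightarrow> ((vertex \<Rightarrow> real) \<Rightarrow> real) \<Rightarrow> (vertex \<Rightarrow> real) measure \<Rightarrow> real" where
  "ball_expect n \<phi> \<mu> = (\<Sum>\<sigma>\<in>ball_configs n. \<phi> \<sigma> * measure \<mu> (cyl n \<sigma>))"

lemma config_prob_space: "config_prob \<mu> \<Longrightarrow> space \<mu> = configs"
  using sets_eq_imp_space_eq[of \<mu> config_algebra] by (simp add: config_prob_def)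

lemma has_integral_local:
  assumes "config_prob \<mu>" and "\<And>\<zeta>. \<zeta> \<in> configs \<Longrightarrow> f \<zeta> = \<phi> (restrict \<zeta> (ball_V n))"
  shows "has_bochner_integral \<mu> f (ball_expect n \<phi> \<mu>)"
proof -
  interpret prob_space \<mu> using assms(1) by (simp add: config_prob_def)
  have sets: "sets \<mu> = sets config_algebra" using assms(1) by (simp add: config_prob_def)
  have "has_bochner_integral \<mu> (\<lambda>\<zeta>. \<Sum>\<sigma>\<in>ball_configs n. \<phi> \<sigma> * indicator (cyl n \<sigma>) \<zeta>) (ball_expect n \<phi> \<mu>)"
    unfolding ball_expect_def
    by (intro has_bochner_integral_sum has_bochner_integral_mult_right has_bochner_integral_real_indicator)
       (auto simp: sets cyl_sets less_top[symmetric])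
  moreover have "(\<Sum>\<sigma>\<in>ball_configs n. \<phi> \<sigma> * indicator (cyl n \<sigma>) \<zeta>) = f \<zeta>" if "\<zeta> \<in> space \<mu>" for \<zeta>
    using that assms(2) config_prob_space[OF assms(1)] by (simp only: sum_cyl_indicator)
  ultimately show ?thesis by (simp cong: has_bochner_integral_cong)
qed

lemma integrableI_local:
  fixes f :: "(vertex \<Rightarrow> real) \<Rightarrow> real"
  assumes "config_prob \<mu>" and "\<And>\<zeta>. \<zeta> \<in> configs \<Longrightarrow> f \<zeta> = \<phi> (restrict \<zeta> (ball_V n))"
  shows "integrable \<mu> f"
proof -
  have "has_bochner_integral \<mu> f (ball_expect n \<phi> \<mu>)"
    by (rule has_integral_local) (use assms in auto)
  then show ?thesis by (simp add: has_bochner_integral_iff)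
qed

lemma local_measurable:
  assumes "\<And>\<zeta>. \<zeta> \<in> configs \<Longrightarrow> f \<zeta> = (\<phi> (restrict \<zeta> (ball_V n)) :: real)"
  shows "f \<in> borel_measurable config_algebra"
proof -
  have "(\<lambda>\<zeta>. \<Sum>\<sigma>\<in>ball_configs n. \<phi> \<sigma> * indicator (cyl n \<sigma>) \<zeta>) \<in> borel_measurable config_algebra"
    by measurable
  then show ?thesis
    by (rule measurable_cong[THEN iffD1, rotated]) (simp only: space_config_algebra assms sum_cyl_indicator)
qed

section \<open>Measures on configurations are determined by cylinder probabilities\<close>

lemma config_prob_eqI_eventually:
  assumes P: "config_prob \<mu>" and Q: "config_prob \<nu>"
    and eq: "\<And>n \<xi>. n \<ge> k \<Longrightarrow> \<xi> \<in> ball_configs n \<Longrightarrow> measure \<mu> (cyl n \<xi>) = measure \<nu> (cyl n \<xi>)"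
  shows "\<mu> = \<nu>"
proof (rule measure_eqI_PiM_infinite[where I = UNIV and M = "\<lambda>x. count_space (spins x)"])
  show "sets \<mu> = sets (Pi\<^sub>M UNIV (\<lambda>x. count_space (spins x)))"
    "sets \<nu> = sets (Pi\<^sub>M UNIV (\<lambda>x. count_space (spins x)))"
    using P Q by (simp_all add: config_prob_def config_algebra_def)
  interpret \<mu>: prob_space \<mu> using P by (simp add: config_prob_def)
  interpret \<nu>: prob_space \<nu> using Q by (simp add: config_prob_def)
  show "finite_measure \<mu>" by unfold_locales
  fix A :: "vertex \<Rightarrow> real set" and J :: "vertex set"
  assume J: "finite J" and A: "\<And>i. i \<in> J \<Longrightarrow> A i \<in> sets (count_space (spins i))"
  obtain n\<^sub>0 where n\<^sub>0: "J \<subseteq> ball_V n\<^sub>0" using finite_subset_ball_V[OF J] by blast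
  define n where "n = max k n\<^sub>0"
  have n: "J \<subseteq> ball_V n" and kn: "n \<ge> k"
    using n\<^sub>0 ball_V_mono[of n\<^sub>0 n] by (auto simp: n_def)
  let ?E = "prod_emb UNIV (\<lambda>x. count_space (spins x)) J (Pi\<^sub>E J A)"
  let ?\<phi> = "\<lambda>\<sigma>. of_bool (\<forall>x\<in>J. \<sigma> x \<in> A x) :: real"
  have E: "?E = {\<zeta> \<in> configs. \<forall>x\<in>J. \<zeta> x \<in> A x}"
    by (auto simp: prod_emb_def space_PiM configs_def PiE_iff)
  have loc: "indicator ?E \<zeta> = ?\<phi> (restrict \<zeta> (ball_V n))" if "\<zeta> \<in> configs" for \<zeta>
    using that n unfolding E by (auto simp: indicator_def)
  have m: "measure M ?E = ball_expect n ?\<phi> M" if "config_prob M" for M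
  proof -
    have "?E \<in> sets M"
      using that sets_PiM_I[of J UNIV A "\<lambda>x. count_space (spins x)"] J A
      by (simp only: config_prob_def config_algebra_def) blast
    moreover have "integral\<^sup>L M (indicator ?E) = ball_expect n ?\<phi> M"
      using that loc by (intro has_bochner_integral_integral_eq has_integral_local)
    moreover have "?E \<inter> space M = ?E"
      using config_prob_space[OF that] by (auto simp: E)
    ultimately show ?thesis by simp
  qed
  have "measure \<mu> ?E = measure \<nu> ?E"
    unfolding m[OF P] m[OF Q] ball_expect_def using eq[OF kn] by simp
  then show "emeasure \<mu> ?E = emeasure \<nu> ?E"
    by (simp add: \<mu>.emeasure_eq_measure \<nu>.emeasure_eq_measure)
qed

lemma config_prob_eqI:
  assumes "config_prob \<mu>" "config_prob \<nu>"
    and "\<And>n \<xi>. \<xi> \<in> ball_configs n \<Longrightarrow> measure \<mu> (cyl n \<xi>) = measure \<nu> (cyl n \<xi>)"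
  shows "\<mu> = \<nu>"
  using assms by (intro config_prob_eqI_eventually[where k = 0])

section \<open>Continuous functions of configurations\<close>

lemma topspace_config [simp]: "topspace config_topology = configs"
  by (simp add: config_topology_def configs_def)

lemma openin_cyl: "openin config_topology (cyl n \<xi>)"
proof (cases "cyl n \<xi> = {}")
  case False
  let ?U = "\<lambda>x. if x \<in> ball_V n then {\<xi> x} else spins x"
  have \<xi>: "\<xi> x \<in> spins x" if "x \<in> ball_V n" for x
    using False that by (auto simp: cyl_def configs_iff)
  have "cyl n \<xi> = PiE UNIV ?U"
  proof
    show "cyl n \<xi> \<subseteq> PiE UNIV ?U" by (auto simp: cyl_def configs_iff)
    have "restrict \<zeta> (ball_V n) = \<xi>" if "\<zeta> \<in> PiE UNIV ?U" for \<zeta>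
    proof
      fix x
      have "\<xi> \<in> extensional (ball_V n)" using False by (auto simp: cyl_def)
      moreover have "\<zeta> x \<in> ?U x" by (rule PiE_mem[OF that UNIV_I])
      ultimately show "restrict \<zeta> (ball_V n) x = \<xi> x"
        by (auto simp: restrict_def extensional_def)
    qed
    moreover have "\<zeta> \<in> configs" if "\<zeta> \<in> PiE UNIV ?U" for \<zeta>
      unfolding configs_iff
    proof
      fix x have "\<zeta> x \<in> ?U x" by (rule PiE_mem[OF that UNIV_I])
      then show "\<zeta> x \<in> spins x" using \<xi>[of x] by (auto split: if_splits)
    qed
    ultimately show "PiE UNIV ?U \<subseteq> cyl n \<xi>"
      by (auto simp: cyl_def)
  qed
  also have "openin config_topology \<dots>"
    unfolding config_topology_def
  proof (rule product_topology_basis)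
    show "openin (discrete_topology (spins x)) (?U x)" for x using \<xi> by auto
    show "finite {x. ?U x \<noteq> topspace (discrete_topology (spins x))}"
      by (rule finite_subset[OF _ finite_ball_V[of n]]) auto
  qed
  finally show ?thesis .
qed auto

lemma local_continuous:
  assumes "\<And>\<zeta>. \<zeta> \<in> configs \<Longrightarrow> f \<zeta> = (\<phi> (restrict \<zeta> (ball_V n)) :: real)"
  shows "continuous_map config_topology euclideanreal f"
  unfolding continuous_map_def
proof (intro conjI allI impI)
  fix U :: "real set"
  have "{\<zeta> \<in> topspace config_topology. f \<zeta> \<in> U}
      = \<Union>((\<lambda>\<zeta>. cyl n (restrict \<zeta> (ball_V n))) ` {\<zeta> \<in> configs. f \<zeta> \<in> U})"
    using assms by (auto simp: cyl_def)
  also have "openin config_topology \<dots>" by (intro openin_Union) (auto intro: openin_cyl)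
  finally show "openin config_topology {\<zeta> \<in> topspace config_topology. f \<zeta> \<in> U}" .
qed auto

lemma compact_config_topology: "compact_space config_topology"
  unfolding config_topology_def
  by (simp add: compact_space_product_topology compact_space_discrete_topology)

lemma cyl_neighbourhood:
  assumes "openin config_topology U" "\<xi> \<in> U"
  shows "\<exists>n. cyl n (restrict \<xi> (ball_V n)) \<subseteq> U"
proof -
  obtain B where B: "finite {x. B x \<noteq> spins x}" "\<xi> \<in> PiE UNIV B" "PiE UNIV B \<subseteq> U"
    using assms unfolding config_topology_def openin_product_topology_alt by fastforce
  obtain n where n: "{x. B x \<noteq> spins x} \<subseteq> ball_V n" using finite_subset_ball_V[OF B(1)] by blast
  have "cyl n (restrict \<xi> (ball_V n)) \<subseteq> PiE UNIV B"
  proof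
    fix \<zeta> assume \<zeta>: "\<zeta> \<in> cyl n (restrict \<xi> (ball_V n))"
    have "\<zeta> x \<in> B x" for x
    proof (cases "x \<in> ball_V n")
      case True
      then have "\<zeta> x = \<xi> x" using \<zeta> by (auto simp: cyl_def fun_eq_iff restrict_def split: if_splits)
      then show ?thesis using B(2) by auto
    next
      case False
      then have "B x = spins x" using n by auto
      then show ?thesis using \<zeta> by (auto simp: cyl_def configs_iff)
    qed
    then show "\<zeta> \<in> PiE UNIV B" by auto
  qed
  then show ?thesis using B(3) by blast
qed

lemma restrict_ball_antimono:
  assumes "m \<le> n" "restrict \<xi> (ball_V n) = restrict \<eta> (ball_V n)"
  shows "restrict \<xi> (ball_V m) = restrict \<eta> (ball_V m)"
  using assms ball_V_mono[OF assms(1)] by (metis inf.absorb_iff2 inf_commute restrict_restrict)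

text \<open>By compactness of the configuration space a continuous function is uniformly close to functions
  of the spins in a ball; this reduces everything below to finitely many spins.\<close>

lemma uniformly_local:
  assumes f: "continuous_map config_topology euclideanreal f" and e: "e > 0"
  shows "\<exists>n. \<forall>\<xi>\<in>configs. \<forall>\<eta>\<in>configs.
    restrict \<xi> (ball_V n) = restrict \<eta> (ball_V n) \<longrightarrow> \<bar>f \<xi> - f \<eta>\<bar> < e"
proof -
  let ?U = "\<lambda>\<xi>. {\<zeta> \<in> configs. f \<zeta> \<in> ball (f \<xi>) (e/2)}"
  have "openin config_topology (?U \<xi>)" for \<xi>
    using f unfolding continuous_map_def by (auto simp del: mem_ball)
  then have "\<forall>\<xi>\<in>configs. \<exists>n. cyl n (restrict \<xi> (ball_V n)) \<subseteq> ?U \<xi>"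
    using cyl_neighbourhood e by force
  then obtain N where N: "\<And>\<xi>. \<xi> \<in> configs \<Longrightarrow> cyl (N \<xi>) (restrict \<xi> (ball_V (N \<xi>))) \<subseteq> ?U \<xi>"
    by metis
  let ?C = "\<lambda>\<xi>. cyl (N \<xi>) (restrict \<xi> (ball_V (N \<xi>)))"
  have "compactin config_topology configs"
    using compact_config_topology by (simp add: compact_space_def)
  moreover have "\<forall>V\<in>?C ` configs. openin config_topology V" using openin_cyl by blast
  moreover have "configs \<subseteq> \<Union>(?C ` configs)" by (force simp: cyl_def)
  ultimately obtain \<F> where \<F>: "finite \<F>" "\<F> \<subseteq> ?C ` configs" "configs \<subseteq> \<Union>\<F>"
    unfolding compactin_def by meson
  then obtain X where "X \<subseteq> configs" "finite X" "\<F> = ?C ` X"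
    using finite_subset_image[of \<F> ?C configs] by blast
  then have X: "finite X" "X \<subseteq> configs" "configs \<subseteq> \<Union>(?C ` X)"
    using \<F>(3) by simp_all
  define n where "n = Max (N ` X)"
  show ?thesis
  proof (intro exI[of _ n] ballI impI)
    fix \<xi> \<eta> assume h: "\<xi> \<in> configs" "\<eta> \<in> configs" "restrict \<xi> (ball_V n) = restrict \<eta> (ball_V n)"
    then obtain \<zeta> where \<zeta>: "\<zeta> \<in> X" "\<xi> \<in> ?C \<zeta>" using X(3) by auto
    have "N \<zeta> \<le> n" using X(1) \<zeta>(1) by (simp add: n_def)
    then have "\<eta> \<in> ?C \<zeta>"
      using \<zeta>(2) h(2) restrict_ball_antimono[OF _ h(3)] by (auto simp: cyl_def)
    then have "\<xi> \<in> ?U \<zeta>" "\<eta> \<in> ?U \<zeta>" using N \<zeta> X(2) by blast+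
    then have d: "dist (f \<zeta>) (f \<xi>) < e/2" "dist (f \<zeta>) (f \<eta>) < e/2" by auto
    then have "dist (f \<xi>) (f \<eta>) < e" by (rule dist_triangle_half_r)
    then show "\<bar>f \<xi> - f \<eta>\<bar> < e" by (simp add: dist_real_def)
  qed
qed

text \<open>The radius \<open>m\<close> is chosen before the measure \<open>\<mu>\<close>: this uniformity is what weak convergence and
  comparison of two measures need.\<close>

lemma continuous_integral_approx:
  assumes f: "continuous_map config_topology euclideanreal f" and e: "e > 0" and \<zeta>: "\<zeta> \<in> configs"
  shows "\<exists>m. \<forall>n\<ge>m. \<forall>\<mu>. config_prob \<mu> \<longrightarrow>
    \<bar>(\<integral>\<xi>. f \<xi> \<partial>\<mu>) - ball_expect n (\<lambda>\<sigma>. f (override_on \<zeta> \<sigma> (ball_V n))) \<mu>\<bar> \<le> e"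
proof -
  let ?f = "\<lambda>n \<xi>. f (override_on \<zeta> \<xi> (ball_V n))"
  have over: "override_on \<zeta> \<xi> (ball_V n) \<in> configs" if "\<xi> \<in> configs" for \<xi> n
    using that \<zeta> by (auto simp: configs_iff override_on_def)
  have near: "\<exists>m. \<forall>n\<ge>m. \<forall>\<xi>\<in>configs. \<bar>f \<xi> - ?f n \<xi>\<bar> < d" if d: "d > 0" for d
  proof -
    obtain m where m: "\<And>\<xi> \<eta>. \<xi> \<in> configs \<Longrightarrow> \<eta> \<in> configs \<Longrightarrow>
        restrict \<xi> (ball_V m) = restrict \<eta> (ball_V m) \<Longrightarrow> \<bar>f \<xi> - f \<eta>\<bar> < d"
      using uniformly_local[OF f d] by blast
    have "\<bar>f \<xi> - ?f n \<xi>\<bar> < d" if "n \<ge> m" "\<xi> \<in> configs" for n \<xi>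
      using that ball_V_mono[OF that(1)]
      by (intro m over) (auto simp: restrict_def override_on_def fun_eq_iff)
    then show ?thesis by blast
  qed
  have loc: "?f n \<xi> = ?f n (restrict \<xi> (ball_V n))" for n \<xi>
    by (rule arg_cong[where f = f]) (auto simp: override_on_def)
  have meas: "f \<in> borel_measurable config_algebra"
  proof (rule borel_measurable_LIMSEQ_metric)
    show "?f n \<in> borel_measurable config_algebra" for n
      by (rule local_measurable[where \<phi> = "?f n" and n = n]) (rule loc)
    show "(\<lambda>n. ?f n \<xi>) \<longlonglongrightarrow> f \<xi>" if "\<xi> \<in> space config_algebra" for \<xi>
      using near that by (auto simp: LIMSEQ_iff abs_minus_commute) blast
  qed
  obtain m where m: "\<And>n \<xi>. n \<ge> m \<Longrightarrow> \<xi> \<in> configs \<Longrightarrow> \<bar>f \<xi> - ?f n \<xi>\<bar> < e"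
    using near[OF e] by blast
  have "\<bar>(\<integral>\<xi>. f \<xi> \<partial>\<mu>) - ball_expect n (?f n) \<mu>\<bar> \<le> e" if n: "n \<ge> m" and \<mu>: "config_prob \<mu>" for n \<mu>
  proof -
    interpret prob_space \<mu> using \<mu> by (simp add: config_prob_def)
    have sp: "space \<mu> = configs" by (rule config_prob_space[OF \<mu>])
    have fm: "f \<in> borel_measurable \<mu>"
      using meas \<mu> by (simp add: config_prob_def cong: measurable_cong_sets)
    have loc_int: "has_bochner_integral \<mu> (?f n) (ball_expect n (?f n) \<mu>)"
      by (rule has_integral_local[OF \<mu>]) (rule loc)
    then have i: "integrable \<mu> (?f n)" and eq: "(\<integral>\<xi>. ?f n \<xi> \<partial>\<mu>) = ball_expect n (?f n) \<mu>"
      by (auto simp: has_bochner_integral_iff)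
    have d_bound: "AE \<xi> in \<mu>. norm (f \<xi> - ?f n \<xi>) \<le> e"
      using m[OF n] by (auto simp: sp less_imp_le)
    have d_int: "integrable \<mu> (\<lambda>\<xi>. f \<xi> - ?f n \<xi>)"
      using d_bound fm i by (intro integrable_const_bound) auto
    have "integrable \<mu> (\<lambda>\<xi>. (f \<xi> - ?f n \<xi>) + ?f n \<xi>)" using d_int i by (rule Bochner_Integration.integrable_add)
    then have "integrable \<mu> f" by simp
    then have "(\<integral>\<xi>. f \<xi> \<partial>\<mu>) - ball_expect n (?f n) \<mu> = (\<integral>\<xi>. f \<xi> - ?f n \<xi> \<partial>\<mu>)"
      using i eq by simp
    also have "\<bar>\<dots>\<bar> \<le> (\<integral>\<xi>. \<bar>f \<xi> - ?f n \<xi>\<bar> \<partial>\<mu>)" by (rule integral_abs_bound)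
    also have "\<dots> \<le> (\<integral>\<xi>. e \<partial>\<mu>)"
      using d_int d_bound by (intro integral_mono_AE) auto
    also have "\<dots> = e" by (simp add: prob_space)
    finally show ?thesis .
  qed
  then show ?thesis by blast
qed

section \<open>Weak limits and the stochastic order in terms of balls\<close>

text \<open>Cylinders over balls whose radius is a multiple of \<open>3\<close> suffice, because every ball lies in such a
  ball. At these radii the boundary spins have two values, so one number describes a boundary law.\<close>

lemma weak_limitI:
  assumes M: "\<And>n. config_prob (M n)" and \<mu>: "config_prob \<mu>"
    and lim: "\<And>m \<xi>. 3 dvd m \<Longrightarrow> \<xi> \<in> ball_configs m \<Longrightarrow>
      (\<lambda>n. measure (M n) (cyl m \<xi>)) \<longlonglongrightarrow> measure \<mu> (cyl m \<xi>)"
  shows "weak_limit M \<mu>"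
  unfolding weak_limit_def
proof (intro conjI allI impI \<mu>)
  fix f assume "continuous_map config_topology euclideanreal f \<and> bounded (f ` configs)"
  then have f: "continuous_map config_topology euclideanreal f" ..
  have \<zeta>: "config_plus \<in> configs" by (simp add: configs_iff)
  let ?\<phi> = "\<lambda>m \<sigma>. f (override_on config_plus \<sigma> (ball_V m))"
  show "(\<lambda>n. \<integral>\<xi>. f \<xi> \<partial>M n) \<longlonglongrightarrow> (\<integral>\<xi>. f \<xi> \<partial>\<mu>)"
  proof (rule LIMSEQ_I)
    fix r :: real assume r: "r > 0"
    then have r3: "r / 3 > 0" by simp
    obtain m0 where m0: "\<And>m \<nu>. m \<ge> m0 \<Longrightarrow> config_prob \<nu> \<Longrightarrow>
        \<bar>(\<integral>\<xi>. f \<xi> \<partial>\<nu>) - ball_expect m (?\<phi> m) \<nu>\<bar> \<le> r / 3"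
      using continuous_integral_approx[OF f r3 \<zeta>] by blast
    define m where "m = 3 * m0"
    then have m: "m \<ge> m0" by simp
    have "(\<lambda>n. ball_expect m (?\<phi> m) (M n)) \<longlonglongrightarrow> ball_expect m (?\<phi> m) \<mu>"
      unfolding ball_expect_def by (intro tendsto_sum tendsto_mult_left lim) (simp_all add: m_def)
    then obtain n0 where n0: "\<And>n. n \<ge> n0 \<Longrightarrow>
        \<bar>ball_expect m (?\<phi> m) (M n) - ball_expect m (?\<phi> m) \<mu>\<bar> < r / 3"
      using r3 unfolding LIMSEQ_iff by fastforce
    have "norm ((\<integral>\<xi>. f \<xi> \<partial>M n) - (\<integral>\<xi>. f \<xi> \<partial>\<mu>)) < r" if "n \<ge> n0" for n
      using n0[OF that] m0[OF m M, of n] m0[OF m \<mu>] unfolding real_norm_def by linarith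
    then show "\<exists>n0. \<forall>n\<ge>n0. norm ((\<integral>\<xi>. f \<xi> \<partial>M n) - (\<integral>\<xi>. f \<xi> \<partial>\<mu>)) < r" by blast
  qed
qed

lemma ball_expect_eq:
  "config_prob \<mu> \<Longrightarrow> (\<integral>\<xi>. \<phi> (restrict \<xi> (ball_V n)) \<partial>\<mu>) = ball_expect n \<phi> \<mu>"
  by (rule has_bochner_integral_integral_eq[OF has_integral_local]) auto

lemma cyl_measure_eq_ball_expect:
  assumes "\<sigma> \<in> ball_configs n"
  shows "measure \<mu> (cyl n \<sigma>) = ball_expect n (\<lambda>\<tau>. of_bool (\<tau> = \<sigma>)) \<mu>"
  using assms by (simp add: ball_expect_def of_bool_def if_distrib[where f = "\<lambda>z. z * _"] cong: if_cong)

text \<open>A function of finitely many spins is continuous, so weak convergence tests it.\<close>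

lemma weak_limit_cyl:
  assumes M: "\<And>n. config_prob (M n)" and lim: "weak_limit M \<mu>" and \<sigma>: "\<sigma> \<in> ball_configs m"
  shows "(\<lambda>n. measure (M n) (cyl m \<sigma>)) \<longlonglongrightarrow> measure \<mu> (cyl m \<sigma>)"
proof -
  let ?f = "\<lambda>\<zeta>. of_bool (restrict \<zeta> (ball_V m) = \<sigma>) :: real"
  have \<mu>: "config_prob \<mu>" using lim by (simp add: weak_limit_def)
  have "continuous_map config_topology euclideanreal ?f"
    by (rule local_continuous[where \<phi> = "\<lambda>\<tau>. of_bool (\<tau> = \<sigma>)" and n = m]) simp
  moreover have "bounded (?f ` configs)" by (rule boundedI[of _ 1]) auto
  ultimately have "(\<lambda>k. \<integral>\<zeta>. ?f \<zeta> \<partial>M k) \<longlonglongrightarrow> (\<integral>\<zeta>. ?f \<zeta> \<partial>\<mu>)"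
    using lim by (auto simp: weak_limit_def)
  then show ?thesis
    using ball_expect_eq[OF \<mu>, where \<phi> = "\<lambda>\<tau>. of_bool (\<tau> = \<sigma>)" and n = m] ball_expect_eq[OF M, where \<phi> = "\<lambda>\<tau>. of_bool (\<tau> = \<sigma>)" and n = m]
    by (simp add: cyl_measure_eq_ball_expect[OF \<sigma>])
qed

lemma weak_limit_unique:
  assumes M: "\<And>n. config_prob (M n)" and \<mu>: "weak_limit M \<mu>" and \<nu>: "weak_limit M \<nu>"
  shows "\<mu> = \<nu>"
proof (rule config_prob_eqI)
  show "config_prob \<mu>" "config_prob \<nu>" using \<mu> \<nu> by (simp_all add: weak_limit_def)
  show "measure \<mu> (cyl n \<xi>) = measure \<nu> (cyl n \<xi>)" if "\<xi> \<in> ball_configs n" for n \<xi>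
    using weak_limit_cyl[OF M \<mu> that] weak_limit_cyl[OF M \<nu> that] by (rule LIMSEQ_unique)
qed

definition ball_increasing :: "nat \<Rightarrow> ((vertex \<Rightarrow> real) \<Rightarrow> real) \<Rightarrow> bool" where
  "ball_increasing n \<phi> \<longleftrightarrow>
    (\<forall>\<sigma>\<in>ball_configs n. \<forall>\<tau>\<in>ball_configs n. (\<forall>x\<in>ball_V n. \<sigma> x \<le> \<tau> x) \<longrightarrow> \<phi> \<sigma> \<le> \<phi> \<tau>)"

lemma stoch_leI:
  assumes \<mu>: "config_prob \<mu>" and \<nu>: "config_prob \<nu>"
    and le: "\<And>n \<phi>. ball_increasing n \<phi> \<Longrightarrow> ball_expect n \<phi> \<mu> \<le> ball_expect n \<phi> \<nu>"
  shows "stoch_le \<mu> \<nu>"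
  unfolding stoch_le_def
proof (intro allI impI)
  fix f assume "continuous_map config_topology euclideanreal f \<and>
    (\<forall>\<xi>\<in>configs. \<forall>\<eta>\<in>configs. (\<forall>x. \<xi> x \<le> \<eta> x) \<longrightarrow> f \<xi> \<le> f \<eta>)"
  then have f: "continuous_map config_topology euclideanreal f"
    and mono: "\<And>\<xi> \<eta>. \<xi> \<in> configs \<Longrightarrow> \<eta> \<in> configs \<Longrightarrow> (\<forall>x. \<xi> x \<le> \<eta> x) \<Longrightarrow> f \<xi> \<le> f \<eta>"
    by auto
  have \<zeta>: "config_plus \<in> configs" by (simp add: configs_iff)
  let ?\<phi> = "\<lambda>m \<sigma>. f (override_on config_plus \<sigma> (ball_V m))"
  show "(\<integral>\<xi>. f \<xi> \<partial>\<mu>) \<le> (\<integral>\<xi>. f \<xi> \<partial>\<nu>)"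
  proof (rule field_le_epsilon)
    fix e :: real assume e: "e > 0"
    then have e2: "e / 2 > 0" by simp
    obtain m where m: "\<And>\<nu>. config_prob \<nu> \<Longrightarrow> \<bar>(\<integral>\<xi>. f \<xi> \<partial>\<nu>) - ball_expect m (?\<phi> m) \<nu>\<bar> \<le> e / 2"
      using continuous_integral_approx[OF f e2 \<zeta>] by blast
    have "ball_increasing m (?\<phi> m)"
      unfolding ball_increasing_def
      by (auto intro!: mono override_ball_in_configs[OF \<zeta>]) (auto simp: override_on_def)
    then have "ball_expect m (?\<phi> m) \<mu> \<le> ball_expect m (?\<phi> m) \<nu>" by (rule le)
    then show "(\<integral>\<xi>. f \<xi> \<partial>\<mu>) \<le> (\<integral>\<xi>. f \<xi> \<partial>\<nu>) + e"
      using m[OF \<mu>] m[OF \<nu>] by linarith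
  qed
qed

lemma stoch_leD:
  assumes "stoch_le \<mu> \<nu>" and \<mu>: "config_prob \<mu>" and \<nu>: "config_prob \<nu>" and \<phi>: "ball_increasing n \<phi>"
  shows "ball_expect n \<phi> \<mu> \<le> ball_expect n \<phi> \<nu>"
proof -
  let ?f = "\<lambda>\<zeta>. \<phi> (restrict \<zeta> (ball_V n))"
  have "continuous_map config_topology euclideanreal ?f"
    by (rule local_continuous) simp
  moreover have "?f \<xi> \<le> ?f \<eta>" if "\<xi> \<in> configs" "\<eta> \<in> configs" "\<forall>x. \<xi> x \<le> \<eta> x" for \<xi> \<eta>
    using that \<phi> unfolding ball_increasing_def by auto
  ultimately have "(\<integral>\<zeta>. ?f \<zeta> \<partial>\<mu>) \<le> (\<integral>\<zeta>. ?f \<zeta> \<partial>\<nu>)"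
    using assms(1) unfolding stoch_le_def by blast
  then show ?thesis by (simp add: ball_expect_eq \<mu> \<nu>)
qed

text \<open>Spins move in unit steps, so adding the total spin of a ball to the indicator of a cylinder makes
  it increasing. Hence the cylinder indicators are differences of increasing functions.\<close>

lemma cyl_increasing:
  assumes "\<sigma> \<in> ball_configs n"
  shows "ball_increasing n (\<lambda>\<tau>. of_bool (\<tau> = \<sigma>) + (\<Sum>x\<in>ball_V n. \<tau> x))"
  unfolding ball_increasing_def
proof (intro ballI impI)
  fix \<xi> \<eta> assume h: "\<xi> \<in> ball_configs n" "\<eta> \<in> ball_configs n" "\<forall>x\<in>ball_V n. \<xi> x \<le> \<eta> x"
  show "of_bool (\<xi> = \<sigma>) + (\<Sum>x\<in>ball_V n. \<xi> x) \<le> of_bool (\<eta> = \<sigma>) + (\<Sum>x\<in>ball_V n. \<eta> x)"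
  proof (cases "\<xi> = \<eta>")
    case False
    then obtain y where y: "y \<in> ball_V n" "\<xi> y \<noteq> \<eta> y"
      using h(1,2) unfolding ball_configs_def by (meson PiE_ext)
    have "\<xi> y \<in> spins y" "\<eta> y \<in> spins y" using h(1,2) y(1) by (auto simp: ball_configs_def)
    then have 1: "\<xi> y + 1 \<le> \<eta> y" using h(3) y spins_gap by force
    have "(\<Sum>x\<in>ball_V n - {y}. \<xi> x) \<le> (\<Sum>x\<in>ball_V n - {y}. \<eta> x)"
      using h(3) by (intro sum_mono) auto
    then have "(\<Sum>x\<in>ball_V n. \<xi> x) + 1 \<le> (\<Sum>x\<in>ball_V n. \<eta> x)"
      using 1 y(1) by (simp add: sum.remove)
    then show ?thesis by (auto simp: of_bool_def)
  qed simp
qed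

lemma total_increasing: "ball_increasing n (\<lambda>\<tau>. \<Sum>x\<in>ball_V n. \<tau> x)"
  unfolding ball_increasing_def by (auto intro: sum_mono)

lemma config_prob_eqI_increasing:
  assumes "config_prob \<mu>" "config_prob \<nu>"
    and eq: "\<And>n \<phi>. ball_increasing n \<phi> \<Longrightarrow> ball_expect n \<phi> \<mu> = ball_expect n \<phi> \<nu>"
  shows "\<mu> = \<nu>"
proof (rule config_prob_eqI[OF assms(1,2)])
  fix n \<xi> assume \<xi>: "\<xi> \<in> ball_configs n"
  have "ball_expect n (\<lambda>\<tau>. of_bool (\<tau> = \<xi>) + (\<Sum>x\<in>ball_V n. \<tau> x)) M
      = measure M (cyl n \<xi>) + ball_expect n (\<lambda>\<tau>. \<Sum>x\<in>ball_V n. \<tau> x) M" for M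
    unfolding cyl_measure_eq_ball_expect[OF \<xi>] ball_expect_def
    by (simp add: distrib_right sum.distrib)
  then show "measure \<mu> (cyl n \<xi>) = measure \<nu> (cyl n \<xi>)"
    using eq[OF cyl_increasing[OF \<xi>]] eq[OF total_increasing[of n]] by simp
qed

text \<open>In a nontrivial convex combination no component can have a smaller expectation than the mixture
  unless the other has a larger one; a stochastically extreme measure excludes this.\<close>

lemma extremal_gibbs_of_stoch_extreme:
  assumes \<mu>: "gibbs_measure \<beta> J \<mu>"
    and bound: "(\<forall>\<nu>. gibbs_measure \<beta> J \<nu> \<longrightarrow> stoch_le \<nu> \<mu>) \<or> (\<forall>\<nu>. gibbs_measure \<beta> J \<nu> \<longrightarrow> stoch_le \<mu> \<nu>)"
  shows "extremal_gibbs \<beta> J \<mu>"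
  unfolding extremal_gibbs_def
proof (intro conjI[OF \<mu>] allI impI)
  fix \<nu>\<^sub>1 \<nu>\<^sub>2 :: "(vertex \<Rightarrow> real) measure" and t :: real
  assume "gibbs_measure \<beta> J \<nu>\<^sub>1 \<and> gibbs_measure \<beta> J \<nu>\<^sub>2 \<and> 0 < t \<and> t < 1 \<and>
      (\<forall>A\<in>sets config_algebra. measure \<mu> A = t * measure \<nu>\<^sub>1 A + (1 - t) * measure \<nu>\<^sub>2 A)"
  then have g: "gibbs_measure \<beta> J \<nu>\<^sub>1" "gibbs_measure \<beta> J \<nu>\<^sub>2" and t: "0 < t" "t < 1"
    and mix: "\<And>A. A \<in> sets config_algebra \<Longrightarrow> measure \<mu> A = t * measure \<nu>\<^sub>1 A + (1 - t) * measure \<nu>\<^sub>2 A"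
    by auto
  have c: "config_prob \<mu>" "config_prob \<nu>\<^sub>1" "config_prob \<nu>\<^sub>2"
    using \<mu> g by (simp_all add: gibbs_measure_def)
  have "ball_expect n \<phi> \<nu>\<^sub>1 = ball_expect n \<phi> \<mu> \<and> ball_expect n \<phi> \<nu>\<^sub>2 = ball_expect n \<phi> \<mu>"
    if \<phi>: "ball_increasing n \<phi>" for n \<phi>
  proof -
    let ?a = "ball_expect n \<phi> \<nu>\<^sub>1" and ?b = "ball_expect n \<phi> \<nu>\<^sub>2" and ?m = "ball_expect n \<phi> \<mu>"
    have m: "?m = t * ?a + (1 - t) * ?b"
      unfolding ball_expect_def sum_distrib_left sum.distrib[symmetric]
      by (intro sum.cong refl) (simp add: mix cyl_sets algebra_simps)
    have or: "(?a \<le> ?m \<and> ?b \<le> ?m) \<or> (?m \<le> ?a \<and> ?m \<le> ?b)"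
      using bound g stoch_leD[OF _ _ _ \<phi>] c by blast
    have "t * (?m - ?a) + (1 - t) * (?m - ?b) = 0" using m by (simp add: algebra_simps)
    then have "t * (?m - ?a) = 0 \<and> (1 - t) * (?m - ?b) = 0"
      using or
    proof (elim disjE)
      assume s: "t * (?m - ?a) + (1 - t) * (?m - ?b) = 0" "?a \<le> ?m \<and> ?b \<le> ?m"
      then have "0 \<le> t * (?m - ?a)" "0 \<le> (1 - t) * (?m - ?b)" using t by simp_all
      then show ?thesis using s(1) by linarith
    next
      assume s: "t * (?m - ?a) + (1 - t) * (?m - ?b) = 0" "?m \<le> ?a \<and> ?m \<le> ?b"
      then have "t * (?m - ?a) \<le> 0" "(1 - t) * (?m - ?b) \<le> 0"
        using t by (simp_all add: mult_nonneg_nonpos)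
      then show ?thesis using s(1) by linarith
    qed
    then show ?thesis using t by auto
  qed
  then show "\<nu>\<^sub>1 = \<mu> \<and> \<nu>\<^sub>2 = \<mu>" using config_prob_eqI_increasing c by blast
qed

section \<open>The four functions theorem and monotonicity of the specification\<close>

text \<open>The Ahlswede--Daykin inequality on a chain. Symmetrising both double sums reduces it to two points
  \<open>s < t\<close>: each of \<open>x = a s * b t\<close> and \<open>y = a t * b s\<close> is at most \<open>C = c t * d s\<close>, and
  \<open>x * y \<le> C * D\<close> with \<open>D = c s * d t\<close>, so \<open>(C - x) * (C - y) \<ge> 0\<close> gives \<open>x + y \<le> C + D\<close>.\<close>

lemma four_functions_chain:
  fixes a b c d :: "'a::linorder \<Rightarrow> real"
  assumes fin: "finite A"
    and nonneg: "\<And>s. s \<in> A \<Longrightarrow> 0 \<le> a s \<and> 0 \<le> b s \<and> 0 \<le> c s \<and> 0 \<le> d s"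
    and le: "\<And>s t. s \<in> A \<Longrightarrow> t \<in> A \<Longrightarrow> a s * b t \<le> c (max s t) * d (min s t)"
  shows "sum a A * sum b A \<le> sum c A * sum d A"
proof -
  have ordered: "a s * b t + a t * b s \<le> c s * d t + c t * d s"
    if st: "s \<in> A" "t \<in> A" "s < t" for s t
  proof -
    let ?C = "c t * d s" and ?D = "c s * d t"
    have x: "a s * b t \<le> ?C" and y: "a t * b s \<le> ?C"
      using le[of s t] le[of t s] st by auto
    have "(a s * b s) * (a t * b t) \<le> (c s * d s) * (c t * d t)"
      using le[of s s] le[of t t] st nonneg by (intro mult_mono[of "a s * b s"]) auto
    then have xy: "(a s * b t) * (a t * b s) \<le> ?C * ?D" by (simp add: mult_ac)
    show ?thesis
    proof (cases "?C = 0")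
      case True
      then show ?thesis using x y nonneg st by (smt (verit) mult_nonneg_nonneg)
    next
      case False
      then have C: "?C > 0" using nonneg st by (simp add: order_less_le)
      have "(?C - a s * b t) * (?C - a t * b s) \<ge> 0" using x y by simp
      then have "?C * (a s * b t + a t * b s) \<le> ?C * (?D + ?C)"
        using xy by (simp add: algebra_simps)
      then show ?thesis using C by (simp only: mult_le_cancel_left_pos)
    qed
  qed
  have "a s * b t + a t * b s \<le> c s * d t + c t * d s" if "s \<in> A" "t \<in> A" for s t
    using ordered[of s t] ordered[of t s] le[of s t] that
    by (cases s t rule: linorder_cases) auto
  then have "(\<Sum>s\<in>A. \<Sum>t\<in>A. a s * b t + a t * b s) \<le> (\<Sum>s\<in>A. \<Sum>t\<in>A. c s * d t + c t * d s)"
    by (intro sum_mono)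
  moreover have "(\<Sum>s\<in>A. \<Sum>t\<in>A. f s * g t + f t * g s) = 2 * (sum f A * sum g A)"
    for f g :: "'a \<Rightarrow> real"
    using sum.swap[of "\<lambda>s t. f t * g s" A A] by (simp add: sum.distrib sum_product)
  ultimately show ?thesis by simp
qed

lemma sum_PiE_insert:
  assumes "finite I" "i \<notin> I"
  shows "(\<Sum>\<sigma>\<in>PiE (insert i I) S. f \<sigma>) = (\<Sum>\<sigma>\<in>PiE I S. \<Sum>s\<in>S i. f (\<sigma>(i := s)) :: real)"
proof -
  have inj: "inj_on (\<lambda>(s, \<sigma>). \<sigma>(i := s)) (S i \<times> PiE I S)"
    using assms(2) by (rule inj_combinator)
  have "(\<Sum>\<sigma>\<in>PiE (insert i I) S. f \<sigma>) = (\<Sum>(s, \<sigma>)\<in>S i \<times> PiE I S. f (\<sigma>(i := s)))"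
    unfolding PiE_insert_eq by (subst sum.reindex[OF inj]) (auto simp: case_prod_unfold)
  also have "\<dots> = (\<Sum>s\<in>S i. \<Sum>\<sigma>\<in>PiE I S. f (\<sigma>(i := s)))"
    by (simp add: sum.cartesian_product)
  also have "\<dots> = (\<Sum>\<sigma>\<in>PiE I S. \<Sum>s\<in>S i. f (\<sigma>(i := s)))"
    by (rule sum.swap)
  finally show ?thesis .
qed

text \<open>Summing out one coordinate of all four functions preserves the hypothesis, by the inequality on a
  chain; hence the theorem for a product of chains by induction on the index set.\<close>

lemma four_functions:
  fixes f\<^sub>1 f\<^sub>2 f\<^sub>3 f\<^sub>4 :: "('i \<Rightarrow> 'a::linorder) \<Rightarrow> real"
  assumes "finite I" and "\<And>i. i \<in> I \<Longrightarrow> finite (S i)"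
    and "\<And>\<sigma>. \<sigma> \<in> PiE I S \<Longrightarrow> 0 \<le> f\<^sub>1 \<sigma> \<and> 0 \<le> f\<^sub>2 \<sigma> \<and> 0 \<le> f\<^sub>3 \<sigma> \<and> 0 \<le> f\<^sub>4 \<sigma>"
    and "\<And>\<sigma> \<tau>. \<sigma> \<in> PiE I S \<Longrightarrow> \<tau> \<in> PiE I S \<Longrightarrow>
      f\<^sub>1 \<sigma> * f\<^sub>2 \<tau> \<le> f\<^sub>3 (\<lambda>i. max (\<sigma> i) (\<tau> i)) * f\<^sub>4 (\<lambda>i. min (\<sigma> i) (\<tau> i))"
  shows "sum f\<^sub>1 (PiE I S) * sum f\<^sub>2 (PiE I S) \<le> sum f\<^sub>3 (PiE I S) * sum f\<^sub>4 (PiE I S)"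
  using assms
proof (induction I arbitrary: f\<^sub>1 f\<^sub>2 f\<^sub>3 f\<^sub>4 rule: finite_induct)
  case empty
  then show ?case by simp
next
  case (insert i I)
  have upd: "\<sigma>(i := s) \<in> PiE (insert i I) S" if "\<sigma> \<in> PiE I S" "s \<in> S i" for \<sigma> s
    using that by (auto simp: PiE_def extensional_def)
  have comb: "(\<lambda>j. h ((\<sigma>(i := s)) j) ((\<tau>(i := t)) j)) = (\<lambda>j. h (\<sigma> j) (\<tau> j))(i := h s t)"
    for \<sigma> \<tau> :: "'i \<Rightarrow> 'a" and s t and h :: "'a \<Rightarrow> 'a \<Rightarrow> 'a"
    by auto
  have sup_inf: "(\<lambda>j. max (\<sigma> j) (\<tau> j)) \<in> PiE I S" "(\<lambda>j. min (\<sigma> j) (\<tau> j)) \<in> PiE I S"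
    if "\<sigma> \<in> PiE I S" "\<tau> \<in> PiE I S" for \<sigma> \<tau>
    using that by (auto simp: PiE_iff extensional_def max_def min_def)
  let ?m = "\<lambda>f \<sigma>. \<Sum>s\<in>S i. f (\<sigma>(i := s))"
  have "sum (?m f\<^sub>1) (PiE I S) * sum (?m f\<^sub>2) (PiE I S) \<le> sum (?m f\<^sub>3) (PiE I S) * sum (?m f\<^sub>4) (PiE I S)"
  proof (rule insert.IH)
    show "finite (S j)" if "j \<in> I" for j using insert.prems(1) that by auto
    show "0 \<le> ?m f\<^sub>1 \<sigma> \<and> 0 \<le> ?m f\<^sub>2 \<sigma> \<and> 0 \<le> ?m f\<^sub>3 \<sigma> \<and> 0 \<le> ?m f\<^sub>4 \<sigma>" if "\<sigma> \<in> PiE I S" for \<sigma>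
      using insert.prems(2) upd[OF that] by (auto intro!: sum_nonneg)
    show "?m f\<^sub>1 \<sigma> * ?m f\<^sub>2 \<tau> \<le> ?m f\<^sub>3 (\<lambda>j. max (\<sigma> j) (\<tau> j)) * ?m f\<^sub>4 (\<lambda>j. min (\<sigma> j) (\<tau> j))"
      if \<sigma>\<tau>: "\<sigma> \<in> PiE I S" "\<tau> \<in> PiE I S" for \<sigma> \<tau>
    proof (rule four_functions_chain)
      show "finite (S i)" using insert.prems(1) by simp
      show "0 \<le> f\<^sub>1 (\<sigma>(i := s)) \<and> 0 \<le> f\<^sub>2 (\<tau>(i := s)) \<and>
          0 \<le> f\<^sub>3 ((\<lambda>j. max (\<sigma> j) (\<tau> j))(i := s)) \<and> 0 \<le> f\<^sub>4 ((\<lambda>j. min (\<sigma> j) (\<tau> j))(i := s))"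
        if "s \<in> S i" for s
        using insert.prems(2) upd that \<sigma>\<tau> sup_inf[OF \<sigma>\<tau>] by blast
      show "f\<^sub>1 (\<sigma>(i := s)) * f\<^sub>2 (\<tau>(i := t))
          \<le> f\<^sub>3 ((\<lambda>j. max (\<sigma> j) (\<tau> j))(i := max s t)) * f\<^sub>4 ((\<lambda>j. min (\<sigma> j) (\<tau> j))(i := min s t))"
        if "s \<in> S i" "t \<in> S i" for s t
        using insert.prems(3)[OF upd upd, of \<sigma> s \<tau> t] that \<sigma>\<tau> unfolding comb by blast
    qed
  qed
  then show ?case
    unfolding sum_PiE_insert[OF insert.hyps] .
qed

text \<open>The lattice condition for ferromagnetic interactions: multiplication of reals is supermodular.\<close>

lemma spec_weight_supermodular:
  assumes "\<beta> > 0" "J > 0"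
  shows "spec_weight \<beta> J \<Lambda> \<xi> * spec_weight \<beta> J \<Lambda> \<eta>
    \<le> spec_weight \<beta> J \<Lambda> (\<lambda>x. max (\<xi> x) (\<eta> x)) * spec_weight \<beta> J \<Lambda> (\<lambda>x. min (\<xi> x) (\<eta> x))"
proof -
  have pair: "a * b + c * d \<le> max a c * max b d + min a c * min b d" for a b c d :: real
  proof -
    have "a \<le> c \<Longrightarrow> d \<le> b \<Longrightarrow> 0 \<le> (c - a) * (b - d)" "c \<le> a \<Longrightarrow> b \<le> d \<Longrightarrow> 0 \<le> (a - c) * (d - b)"
      by simp_all
    then show ?thesis by (auto simp: max_def min_def algebra_simps)
  qed
  have "(\<Sum>y\<in>edge_tops \<Lambda>. \<xi> (tl y) * \<xi> y + \<eta> (tl y) * \<eta> y)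
      \<le> (\<Sum>y\<in>edge_tops \<Lambda>. max (\<xi> (tl y)) (\<eta> (tl y)) * max (\<xi> y) (\<eta> y)
          + min (\<xi> (tl y)) (\<eta> (tl y)) * min (\<xi> y) (\<eta> y))"
    by (intro sum_mono pair)
  then have "\<beta> * J * (\<Sum>y\<in>edge_tops \<Lambda>. \<xi> (tl y) * \<xi> y) + \<beta> * J * (\<Sum>y\<in>edge_tops \<Lambda>. \<eta> (tl y) * \<eta> y)
     \<le> \<beta> * J * (\<Sum>y\<in>edge_tops \<Lambda>. max (\<xi> (tl y)) (\<eta> (tl y)) * max (\<xi> y) (\<eta> y))
      + \<beta> * J * (\<Sum>y\<in>edge_tops \<Lambda>. min (\<xi> (tl y)) (\<eta> (tl y)) * min (\<xi> y) (\<eta> y))"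
    using assms by (simp add: sum.distrib distrib_left[symmetric])
  then show ?thesis unfolding spec_weight_eq exp_add[symmetric] by simp
qed

definition spec_expect ::
  "real \<Rightarrow> real \<Rightarrow> vertex set \<Rightarrow> (vertex \<Rightarrow> real) \<Rightarrow> ((vertex \<Rightarrow> real) \<Rightarrow> real) \<Rightarrow> real" where
  "spec_expect \<beta> J \<Lambda> \<eta> F =
    (\<Sum>\<sigma>\<in>(\<Pi>\<^sub>E x\<in>\<Lambda>. spins x).
        spec_weight \<beta> J \<Lambda> (override_on \<eta> \<sigma> \<Lambda>) * F (override_on \<eta> \<sigma> \<Lambda>)) /
    (\<Sum>\<sigma>\<in>(\<Pi>\<^sub>E x\<in>\<Lambda>. spins x). spec_weight \<beta> J \<Lambda> (override_on \<eta> \<sigma> \<Lambda>))"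

lemma gibbs_spec_eq: "gibbs_spec \<beta> J \<Lambda> \<eta> A = spec_expect \<beta> J \<Lambda> \<eta> (indicator A)"
  by (simp add: gibbs_spec_def spec_expect_def)

lemma PiE_spins_nonempty: "(\<Pi>\<^sub>E x\<in>\<Lambda>. spins x) \<noteq> {}"
  by (simp add: PiE_eq_empty_iff spins_def)

lemma finite_PiE_spins: "finite \<Lambda> \<Longrightarrow> finite (\<Pi>\<^sub>E x\<in>\<Lambda>. spins x)"
  by (intro finite_PiE) auto

lemma spec_partition_pos:
  "finite \<Lambda> \<Longrightarrow> (\<Sum>\<sigma>\<in>(\<Pi>\<^sub>E x\<in>\<Lambda>. spins x). spec_weight \<beta> J \<Lambda> (override_on \<eta> \<sigma> \<Lambda>)) > 0"
  by (intro sum_pos finite_PiE_spins PiE_spins_nonempty) auto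

lemma spec_expect_const: "finite \<Lambda> \<Longrightarrow> spec_expect \<beta> J \<Lambda> \<eta> (\<lambda>_. c) = c"
  using spec_partition_pos[of \<Lambda> \<beta> J \<eta>] by (simp add: spec_expect_def sum_distrib_right[symmetric])

lemma spec_expect_sum:
  "spec_expect \<beta> J \<Lambda> \<eta> (\<lambda>\<zeta>. \<Sum>i\<in>I. c i * F i \<zeta>) = (\<Sum>i\<in>I. c i * spec_expect \<beta> J \<Lambda> \<eta> (F i))"
proof -
  have "(\<Sum>\<sigma>\<in>(\<Pi>\<^sub>E x\<in>\<Lambda>. spins x). spec_weight \<beta> J \<Lambda> (override_on \<eta> \<sigma> \<Lambda>) *
          (\<Sum>i\<in>I. c i * F i (override_on \<eta> \<sigma> \<Lambda>)))
      = (\<Sum>i\<in>I. c i * (\<Sum>\<sigma>\<in>(\<Pi>\<^sub>E x\<in>\<Lambda>. spins x). spec_weight \<beta> J \<Lambda> (override_on \<eta> \<sigma> \<Lambda>) *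
          F i (override_on \<eta> \<sigma> \<Lambda>)))"
    unfolding sum_distrib_left by (subst sum.swap) (simp add: mult_ac)
  then show ?thesis
    unfolding spec_expect_def by (simp only: sum_divide_distrib[where A = I] times_divide_eq_right)
qed

lemma spec_expect_cong:
  assumes "\<eta> \<in> configs" "\<And>\<zeta>. \<zeta> \<in> configs \<Longrightarrow> F \<zeta> = G \<zeta>"
  shows "spec_expect \<beta> J \<Lambda> \<eta> F = spec_expect \<beta> J \<Lambda> \<eta> G"
  unfolding spec_expect_def using assms override_in_configs[OF assms(1)] by simp

text \<open>Holley's inequality: the four functions theorem applied to \<open>w * F\<close>, \<open>w'\<close>, \<open>w' * F\<close> and \<open>w\<close>, where
  \<open>w\<close> and \<open>w'\<close> are the weights with boundary conditions \<open>\<eta>\<close> and \<open>\<eta>'\<close>.\<close>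

lemma spec_expect_mono_nonneg:
  assumes J: "\<beta> > 0" "J > 0" and fin: "finite \<Lambda>"
    and conf: "\<eta> \<in> configs" "\<eta>' \<in> configs" and le: "\<And>x. \<eta> x \<le> \<eta>' x"
    and nonneg: "\<And>\<zeta>. \<zeta> \<in> configs \<Longrightarrow> 0 \<le> F \<zeta>"
    and mono: "\<And>\<zeta> \<zeta>'. \<zeta> \<in> configs \<Longrightarrow> \<zeta>' \<in> configs \<Longrightarrow> (\<And>x. \<zeta> x \<le> \<zeta>' x) \<Longrightarrow> F \<zeta> \<le> F \<zeta>'"
  shows "spec_expect \<beta> J \<Lambda> \<eta> F \<le> spec_expect \<beta> J \<Lambda> \<eta>' F"
proof -
  let ?P = "\<Pi>\<^sub>E x\<in>\<Lambda>. spins x" and ?W = "spec_weight \<beta> J \<Lambda>"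
  let ?w = "\<lambda>\<sigma>. ?W (override_on \<eta> \<sigma> \<Lambda>)" and ?w' = "\<lambda>\<sigma>. ?W (override_on \<eta>' \<sigma> \<Lambda>)"
  let ?F = "\<lambda>\<sigma>. F (override_on \<eta> \<sigma> \<Lambda>)" and ?F' = "\<lambda>\<sigma>. F (override_on \<eta>' \<sigma> \<Lambda>)"
  have "(\<Sum>\<sigma>\<in>?P. ?w \<sigma> * ?F \<sigma>) * (\<Sum>\<sigma>\<in>?P. ?w' \<sigma>) \<le> (\<Sum>\<sigma>\<in>?P. ?w' \<sigma> * ?F' \<sigma>) * (\<Sum>\<sigma>\<in>?P. ?w \<sigma>)"
  proof (rule four_functions[OF fin])
    show "0 \<le> ?w \<sigma> * ?F \<sigma> \<and> 0 \<le> ?w' \<sigma> \<and> 0 \<le> ?w' \<sigma> * ?F' \<sigma> \<and> 0 \<le> ?w \<sigma>" if "\<sigma> \<in> ?P" for \<sigma>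
      using nonneg override_in_configs[OF conf(1) that] override_in_configs[OF conf(2) that]
      by (simp add: less_imp_le)
    show "?w \<sigma> * ?F \<sigma> * ?w' \<tau> \<le> ?w' (\<lambda>x. max (\<sigma> x) (\<tau> x)) * ?F' (\<lambda>x. max (\<sigma> x) (\<tau> x))
        * ?w (\<lambda>x. min (\<sigma> x) (\<tau> x))" if \<sigma>\<tau>: "\<sigma> \<in> ?P" "\<tau> \<in> ?P" for \<sigma> \<tau>
    proof -
      have P: "(\<lambda>x. max (\<sigma> x) (\<tau> x)) \<in> ?P"
        using \<sigma>\<tau> by (auto simp: PiE_iff extensional_def max_def)
      \<comment> \<open>outside \<open>\<Lambda>\<close> the join of the two configurations is \<open>\<eta>'\<close> and their meet is \<open>\<eta>\<close>\<close>
      have sup: "(\<lambda>x. max (override_on \<eta> \<sigma> \<Lambda> x) (override_on \<eta>' \<tau> \<Lambda> x))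
          = override_on \<eta>' (\<lambda>x. max (\<sigma> x) (\<tau> x)) \<Lambda>"
        and inf: "(\<lambda>x. min (override_on \<eta> \<sigma> \<Lambda> x) (override_on \<eta>' \<tau> \<Lambda> x))
          = override_on \<eta> (\<lambda>x. min (\<sigma> x) (\<tau> x)) \<Lambda>"
        using le by (auto simp: override_on_def fun_eq_iff max_def min_def)
      have 1: "?w \<sigma> * ?w' \<tau> \<le> ?w' (\<lambda>x. max (\<sigma> x) (\<tau> x)) * ?w (\<lambda>x. min (\<sigma> x) (\<tau> x))"
        using spec_weight_supermodular[OF J, of \<Lambda> "override_on \<eta> \<sigma> \<Lambda>" "override_on \<eta>' \<tau> \<Lambda>"]
        unfolding sup inf .
      have 2: "?F \<sigma> \<le> ?F' (\<lambda>x. max (\<sigma> x) (\<tau> x))"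
        using le by (intro mono override_in_configs conf \<sigma>\<tau> P) (auto simp: override_on_def le_max_iff_disj)
      have "(?w \<sigma> * ?w' \<tau>) * ?F \<sigma>
          \<le> (?w' (\<lambda>x. max (\<sigma> x) (\<tau> x)) * ?w (\<lambda>x. min (\<sigma> x) (\<tau> x))) * ?F' (\<lambda>x. max (\<sigma> x) (\<tau> x))"
        using nonneg override_in_configs[OF conf(1) \<sigma>\<tau>(1)]
        by (intro mult_mono 1 2) (simp_all add: less_imp_le)
      then show ?thesis by (simp add: mult_ac)
    qed
  qed simp
  then show ?thesis
    unfolding spec_expect_def
    using spec_partition_pos[OF fin, of \<beta> J \<eta>] spec_partition_pos[OF fin, of \<beta> J \<eta>']
    by (simp add: divide_simps mult_ac)
qed

lemma spec_expect_mono: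
  assumes J: "\<beta> > 0" "J > 0" and fin: "finite \<Lambda>"
    and conf: "\<eta> \<in> configs" "\<eta>' \<in> configs" and le: "\<And>x. \<eta> x \<le> \<eta>' x"
    and bounded: "\<And>\<zeta>. \<zeta> \<in> configs \<Longrightarrow> c \<le> F \<zeta>"
    and mono: "\<And>\<zeta> \<zeta>'. \<zeta> \<in> configs \<Longrightarrow> \<zeta>' \<in> configs \<Longrightarrow> (\<And>x. \<zeta> x \<le> \<zeta>' x) \<Longrightarrow> F \<zeta> \<le> F \<zeta>'"
  shows "spec_expect \<beta> J \<Lambda> \<eta> F \<le> spec_expect \<beta> J \<Lambda> \<eta>' F"
proof -
  have shift: "spec_expect \<beta> J \<Lambda> \<eta> (\<lambda>\<zeta>. F \<zeta> - c) = spec_expect \<beta> J \<Lambda> \<eta> F - c" for \<eta>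
    using spec_partition_pos[OF fin, of \<beta> J \<eta>]
    by (simp add: spec_expect_def right_diff_distrib sum_subtractf diff_divide_distrib
        sum_distrib_right[symmetric])
  have "spec_expect \<beta> J \<Lambda> \<eta> (\<lambda>\<zeta>. F \<zeta> - c) \<le> spec_expect \<beta> J \<Lambda> \<eta>' (\<lambda>\<zeta>. F \<zeta> - c)"
    using bounded mono by (intro spec_expect_mono_nonneg J fin conf le) auto
  then show ?thesis by (simp add: shift)
qed

section \<open>Message passing towards the root\<close>

text \<open>The weight of a configuration in the ball of radius \<open>n\<close> when the sphere carries the boundary law \<open>\<phi>\<close>.
  An indicator \<open>\<phi>\<close> fixes the boundary spins, a positive \<open>\<phi>\<close> is the exponential of a boundary field.\<close>

definition ball_weight :: "real \<Rightarrow> nat \<Rightarrow> (real \<Rightarrow> real) \<Rightarrow> (vertex \<Rightarrow> real) \<Rightarrow> real" where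
  "ball_weight b n \<phi> \<xi> =
    exp (b * (\<Sum>y\<in>ball_V n - {[]}. \<xi> (tl y) * \<xi> y)) * (\<Prod>x\<in>sphere_W n. \<phi> (\<xi> x))"

definition ball_prob :: "real \<Rightarrow> nat \<Rightarrow> (real \<Rightarrow> real) \<Rightarrow> (vertex \<Rightarrow> real) \<Rightarrow> real" where
  "ball_prob b n \<phi> \<xi> = ball_weight b n \<phi> \<xi> / (\<Sum>\<tau>\<in>ball_configs n. ball_weight b n \<phi> \<tau>)"

text \<open>The boundary law of a vertex whose two children have boundary law \<open>\<phi>\<close> and spins in \<open>S\<close>; the square
  accounts for the two children.\<close>

definition pass :: "real \<Rightarrow> real set \<Rightarrow> (real \<Rightarrow> real) \<Rightarrow> real \<Rightarrow> real" where
  "pass b S \<phi> s = (\<Sum>t\<in>S. exp (b * s * t) * \<phi> t)^2"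

lemma tl_ball_V: "y \<in> ball_V n \<Longrightarrow> tl y \<in> ball_V n"
  by (auto simp: ball_V_eq)

lemma tl_sphere_W: "y \<in> sphere_W (Suc n) \<Longrightarrow> tl y \<in> ball_V n"
  by (auto simp: ball_V_eq sphere_W_eq)

lemma sphere_subset_ball: "sphere_W n \<subseteq> ball_V n"
  by (auto simp: ball_V_eq sphere_W_eq)

lemma ball_configs_spin: "\<sigma> \<in> ball_configs n \<Longrightarrow> x \<in> ball_V n \<Longrightarrow> \<sigma> x \<in> spins x"
  by (auto simp: ball_configs_def)

lemma ball_configs_sphere_spin:
  "\<sigma> \<in> ball_configs n \<Longrightarrow> x \<in> sphere_W n \<Longrightarrow> \<sigma> x \<in> level_spins n"
  using ball_configs_spin[of \<sigma> n x] sphere_subset_ball by (auto simp: spins_eq sphere_W_eq)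

lemma ball_configs_nonempty: "ball_configs n \<noteq> {}"
  unfolding ball_configs_def by (rule PiE_spins_nonempty)

lemma restrict_ball_configs: "\<sigma> \<in> ball_configs n \<Longrightarrow> restrict \<sigma> (ball_V n) = \<sigma>"
  unfolding ball_configs_def by (rule PiE_restrict)

lemma restrict_ball_configs_mono:
  "\<sigma> \<in> ball_configs n \<Longrightarrow> m \<le> n \<Longrightarrow> restrict \<sigma> (ball_V m) \<in> ball_configs m"
  using ball_V_mono[of m n] by (auto simp: ball_configs_def)

lemma sum_extensions:
  assumes \<sigma>: "\<sigma> \<in> ball_configs n"
  shows "(\<Sum>\<xi> | \<xi> \<in> ball_configs (Suc n) \<and> restrict \<xi> (ball_V n) = \<sigma>. F \<xi>)
    = (\<Sum>\<omega>\<in>(\<Pi>\<^sub>E x\<in>sphere_W (Suc n). spins x). F (merge (ball_V n) (sphere_W (Suc n)) (\<sigma>, \<omega>)) :: real)"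
proof (rule sum.reindex_bij_witness[where i = "\<lambda>\<omega>. merge (ball_V n) (sphere_W (Suc n)) (\<sigma>, \<omega>)"
      and j = "\<lambda>\<xi>. restrict \<xi> (sphere_W (Suc n))"])
  fix \<xi> assume \<xi>: "\<xi> \<in> {\<xi>. \<xi> \<in> ball_configs (Suc n) \<and> restrict \<xi> (ball_V n) = \<sigma>}"
  show eq: "merge (ball_V n) (sphere_W (Suc n)) (\<sigma>, restrict \<xi> (sphere_W (Suc n))) = \<xi>"
  proof
    fix x
    show "merge (ball_V n) (sphere_W (Suc n)) (\<sigma>, restrict \<xi> (sphere_W (Suc n))) x = \<xi> x"
      using \<xi> by (auto simp: merge_def ball_configs_def ball_V_Suc PiE_def extensional_def)
  qed
  show "restrict \<xi> (sphere_W (Suc n)) \<in> (\<Pi>\<^sub>E x\<in>sphere_W (Suc n). spins x)"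
    using \<xi> by (auto simp: ball_configs_def ball_V_Suc)
  show "F (merge (ball_V n) (sphere_W (Suc n)) (\<sigma>, restrict \<xi> (sphere_W (Suc n)))) = F \<xi>"
    by (rule arg_cong[OF eq])
next
  fix \<omega> assume \<omega>: "\<omega> \<in> (\<Pi>\<^sub>E x\<in>sphere_W (Suc n). spins x)"
  let ?m = "merge (ball_V n) (sphere_W (Suc n)) (\<sigma>, \<omega>)"
  show "restrict ?m (sphere_W (Suc n)) = \<omega>"
    using \<omega> ball_sphere_disjoint[of n] by (subst restrict_merge) (auto simp: PiE_restrict)
  have "restrict ?m (ball_V n) = \<sigma>"
    using ball_sphere_disjoint[of n] restrict_ball_configs[OF \<sigma>] by (subst restrict_merge) auto
  moreover have "?m \<in> ball_configs (Suc n)"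
    using \<sigma> \<omega> by (auto simp: ball_configs_def ball_V_Suc merge_def PiE_def Pi_def extensional_def)
  ultimately show "?m \<in> {\<xi>. \<xi> \<in> ball_configs (Suc n) \<and> restrict \<xi> (ball_V n) = \<sigma>}" by simp
qed

text \<open>Given the spins up to level \<open>n\<close>, those of level \<open>n + 1\<close> are independent and each interacts with
  its parent only; the two children of a vertex contribute equal factors.\<close>

lemma ball_weight_integrate_sphere:
  assumes \<sigma>: "\<sigma> \<in> ball_configs n"
  shows "(\<Sum>\<xi> | \<xi> \<in> ball_configs (Suc n) \<and> restrict \<xi> (ball_V n) = \<sigma>. ball_weight b (Suc n) \<phi> \<xi>)
    = ball_weight b n (pass b (level_spins (Suc n)) \<phi>) \<sigma>"
proof -
  let ?W = "sphere_W (Suc n)"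
  let ?E = "exp (b * (\<Sum>y\<in>ball_V n - {[]}. \<sigma> (tl y) * \<sigma> y))"
  have w: "ball_weight b (Suc n) \<phi> (merge (ball_V n) ?W (\<sigma>, \<omega>))
      = ?E * (\<Prod>y\<in>?W. exp (b * \<sigma> (tl y) * \<omega> y) * \<phi> (\<omega> y))" for \<omega>
  proof -
    let ?m = "merge (ball_V n) ?W (\<sigma>, \<omega>)"
    have in_ball: "?m x = \<sigma> x" if "x \<in> ball_V n" for x using that by (simp add: merge_def)
    have in_W: "?m x = \<omega> x" if "x \<in> ?W" for x
      using that ball_sphere_disjoint[of n] by (auto simp: merge_def)
    have split: "ball_V (Suc n) - {[]} = (ball_V n - {[]}) \<union> ?W"
      by (auto simp: ball_V_eq sphere_W_eq)
    have "(\<Sum>y\<in>ball_V (Suc n) - {[]}. ?m (tl y) * ?m y)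
        = (\<Sum>y\<in>ball_V n - {[]}. ?m (tl y) * ?m y) + (\<Sum>y\<in>?W. ?m (tl y) * ?m y)"
      unfolding split by (rule sum.union_disjoint) (use ball_sphere_disjoint[of n] in auto)
    also have "\<dots> = (\<Sum>y\<in>ball_V n - {[]}. \<sigma> (tl y) * \<sigma> y) + (\<Sum>y\<in>?W. \<sigma> (tl y) * \<omega> y)"
      by (simp add: in_ball in_W tl_ball_V tl_sphere_W)
    finally show ?thesis
      by (simp add: ball_weight_def distrib_left exp_add sum_distrib_left exp_sum prod.distrib in_W
          mult.assoc)
  qed
  have "(\<Sum>\<omega>\<in>(\<Pi>\<^sub>E x\<in>?W. spins x). \<Prod>y\<in>?W. exp (b * \<sigma> (tl y) * \<omega> y) * \<phi> (\<omega> y))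
      = (\<Prod>y\<in>?W. \<Sum>t\<in>spins y. exp (b * \<sigma> (tl y) * t) * \<phi> t)"
    by (rule prod_sum_PiE[symmetric]) auto
  also have "\<dots> = (\<Prod>y\<in>?W. \<Sum>t\<in>level_spins (Suc n). exp (b * \<sigma> (tl y) * t) * \<phi> t)"
    by (intro prod.cong) (auto simp: spins_eq sphere_W_eq)
  also have "\<dots> = (\<Prod>x\<in>sphere_W n. pass b (level_spins (Suc n)) \<phi> (\<sigma> x))"
    unfolding pass_def by (rule prod_sphere_W_Suc)
  finally show ?thesis
    unfolding sum_extensions[OF \<sigma>] w sum_distrib_left[symmetric] by (simp add: ball_weight_def)
qed

lemma sum_ball_configs_group:
  assumes "m \<le> n"
  shows "(\<Sum>\<tau>\<in>ball_configs m. \<Sum>\<xi> | \<xi> \<in> ball_configs n \<and> restrict \<xi> (ball_V m) = \<tau>. F \<xi>)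
    = (\<Sum>\<xi>\<in>ball_configs n. F \<xi> :: real)"
  using restrict_ball_configs_mono[OF _ assms] by (intro sum.group) auto

text \<open>\<open>msg b z l i\<close> is the boundary law that \<open>l\<close> steps of message passing produce at level \<open>i\<close> when the
  spins \<open>z (i + l)\<close> are imposed at level \<open>i + l\<close>.\<close>

primrec msg :: "real \<Rightarrow> (nat \<Rightarrow> real) \<Rightarrow> nat \<Rightarrow> nat \<Rightarrow> real \<Rightarrow> real" where
  "msg b z 0 = (\<lambda>i s. of_bool (s = z i))"
| "msg b z (Suc l) = (\<lambda>i. pass b (level_spins (Suc i)) (msg b z l (Suc i)))"

lemma sum_ball_weight_msg:
  assumes "\<sigma> \<in> ball_configs m"
  shows "(\<Sum>\<xi> | \<xi> \<in> ball_configs (m + l) \<and> restrict \<xi> (ball_V m) = \<sigma>. ball_weight b (m + l) (msg b z 0 (m + l)) \<xi>)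
    = ball_weight b m (msg b z l m) \<sigma>"
  using assms
proof (induction l arbitrary: m \<sigma>)
  case 0
  then have eq: "{\<xi>. \<xi> \<in> ball_configs (m + 0) \<and> restrict \<xi> (ball_V m) = \<sigma>} = {\<sigma>}"
    by (auto simp: restrict_ball_configs)
  show ?case unfolding eq by simp
next
  case (Suc l)
  let ?S = "{\<xi>. \<xi> \<in> ball_configs (m + Suc l) \<and> restrict \<xi> (ball_V m) = \<sigma>}"
  let ?T = "{\<tau>. \<tau> \<in> ball_configs (Suc m) \<and> restrict \<tau> (ball_V m) = \<sigma>}"
  let ?w = "\<lambda>\<xi>. ball_weight b (m + Suc l) (msg b z 0 (m + Suc l)) \<xi>"
  have sub: "restrict (restrict \<xi> (ball_V (Suc m))) (ball_V m) = restrict \<xi> (ball_V m)" for \<xi> :: "vertex \<Rightarrow> real"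
    using ball_V_mono[of m "Suc m"] by (simp add: Int_absorb1)
  have "sum ?w ?S = (\<Sum>\<tau>\<in>?T. \<Sum>\<xi> | \<xi> \<in> ?S \<and> restrict \<xi> (ball_V (Suc m)) = \<tau>. ?w \<xi>)"
    using sub restrict_ball_configs_mono[of _ "m + Suc l" "Suc m"] by (intro sum.group[symmetric]) auto
  also have "\<dots> = (\<Sum>\<tau>\<in>?T. ball_weight b (Suc m) (msg b z l (Suc m)) \<tau>)"
  proof (rule sum.cong[OF refl])
    fix \<tau> assume \<tau>: "\<tau> \<in> ?T"
    then have "{\<xi>. \<xi> \<in> ?S \<and> restrict \<xi> (ball_V (Suc m)) = \<tau>}
        = {\<xi>. \<xi> \<in> ball_configs (Suc m + l) \<and> restrict \<xi> (ball_V (Suc m)) = \<tau>}"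
      using sub by auto
    then show "(\<Sum>\<xi> | \<xi> \<in> ?S \<and> restrict \<xi> (ball_V (Suc m)) = \<tau>. ?w \<xi>)
        = ball_weight b (Suc m) (msg b z l (Suc m)) \<tau>"
      using Suc.IH[of \<tau> "Suc m"] \<tau> by (simp only: mem_Collect_eq add_Suc add_Suc_right)
  qed
  also have "\<dots> = ball_weight b m (msg b z (Suc l) m) \<sigma>"
    using ball_weight_integrate_sphere[OF Suc.prems] by simp
  finally show ?case .
qed

lemma ball_prob_scale:
  assumes "c \<noteq> 0" "\<And>s. s \<in> level_spins n \<Longrightarrow> \<phi> s = c * \<psi> s" and \<sigma>: "\<sigma> \<in> ball_configs n"
  shows "ball_prob b n \<phi> \<sigma> = ball_prob b n \<psi> \<sigma>"
proof -
  have "ball_weight b n \<phi> \<tau> = c ^ card (sphere_W n) * ball_weight b n \<psi> \<tau>" if "\<tau> \<in> ball_configs n" for \<tau>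
    using assms(2) ball_configs_sphere_spin[OF that]
    by (simp add: ball_weight_def prod.distrib mult_ac)
  then show ?thesis
    using assms(1) \<sigma> by (simp add: ball_prob_def sum_distrib_left[symmetric])
qed

lemma ball_weight_pos:
  assumes "\<And>s. s \<in> level_spins n \<Longrightarrow> \<phi> s > 0" "\<sigma> \<in> ball_configs n"
  shows "ball_weight b n \<phi> \<sigma> > 0"
  using assms ball_configs_sphere_spin by (auto simp: ball_weight_def intro!: prod_pos mult_pos_pos)

lemma ball_weight_total_pos:
  assumes "\<And>s. s \<in> level_spins n \<Longrightarrow> \<phi> s > 0"
  shows "(\<Sum>\<tau>\<in>ball_configs n. ball_weight b n \<phi> \<tau>) > 0"
  using assms by (intro sum_pos ball_weight_pos ball_configs_nonempty) auto

section \<open>Finite-volume measures with boundary condition\<close>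

lemma bc_weight_nonneg: "bc_weight \<beta> J \<zeta> n \<xi> \<ge> 0"
  by (simp add: bc_weight_def)

lemma bc_partition_pos:
  assumes "\<zeta> \<in> configs"
  shows "(\<Sum>\<xi>\<in>ball_configs n. bc_weight \<beta> J \<zeta> n \<xi>) > 0"
proof (rule sum_pos2[where i = "restrict \<zeta> (ball_V n)"])
  show "0 < bc_weight \<beta> J \<zeta> n (restrict \<zeta> (ball_V n))"
    using sphere_subset_ball[of n] by (auto simp: bc_weight_def)
qed (use assms bc_weight_nonneg in auto)

lemma bc_measure_ext_prob:
  assumes \<zeta>: "\<zeta> \<in> configs"
  shows "config_prob (bc_measure_ext \<beta> J \<zeta> n)"
    and "B \<in> sets config_algebra \<Longrightarrow> measure (bc_measure_ext \<beta> J \<zeta> n) B =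
      (\<Sum>\<xi>\<in>ball_configs n. bc_weight \<beta> J \<zeta> n \<xi> * indicator B (override_on \<zeta> \<xi> (ball_V n)))
       / (\<Sum>\<xi>\<in>ball_configs n. bc_weight \<beta> J \<zeta> n \<xi>)"
proof -
  let ?Z = "\<Sum>\<xi>\<in>ball_configs n. bc_weight \<beta> J \<zeta> n \<xi>"
  let ?g = "\<lambda>\<xi>. override_on \<zeta> \<xi> (ball_V n)"
  have Z: "?Z > 0" by (rule bc_partition_pos[OF \<zeta>])
  have meas: "?g \<in> measurable (bc_measure \<beta> J \<zeta> n) config_algebra"
    unfolding bc_measure_def using override_ball_in_configs[OF \<zeta>]
    by (auto simp: measurable_point_measure_eq1)
  have em: "emeasure (bc_measure_ext \<beta> J \<zeta> n) B =
      ennreal ((\<Sum>\<xi>\<in>ball_configs n. bc_weight \<beta> J \<zeta> n \<xi> * indicator B (?g \<xi>)) / ?Z)"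
    if B: "B \<in> sets config_algebra" for B
  proof -
    have "emeasure (bc_measure_ext \<beta> J \<zeta> n) B
        = emeasure (bc_measure \<beta> J \<zeta> n) {\<xi> \<in> ball_configs n. ?g \<xi> \<in> B}"
      unfolding bc_measure_ext_def using meas B
      by (subst emeasure_distr) (auto simp: bc_measure_def space_point_measure intro!: arg_cong[where f = "emeasure _"])
    also have "\<dots> = (\<Sum>\<xi> | \<xi> \<in> ball_configs n \<and> ?g \<xi> \<in> B. ennreal (bc_weight \<beta> J \<zeta> n \<xi> / ?Z))"
      unfolding bc_measure_def by (subst emeasure_point_measure_finite) auto
    also have "\<dots> = ennreal (\<Sum>\<xi> | \<xi> \<in> ball_configs n \<and> ?g \<xi> \<in> B. bc_weight \<beta> J \<zeta> n \<xi> / ?Z)"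
      using Z bc_weight_nonneg by (intro sum_ennreal) (simp add: less_imp_le)
    also have "(\<Sum>\<xi> | \<xi> \<in> ball_configs n \<and> ?g \<xi> \<in> B. bc_weight \<beta> J \<zeta> n \<xi> / ?Z)
        = (\<Sum>\<xi>\<in>ball_configs n. bc_weight \<beta> J \<zeta> n \<xi> * indicator B (?g \<xi>)) / ?Z"
      unfolding sum_divide_distrib
      by (intro sum.mono_neutral_cong_left) (auto simp: indicator_def)
    finally show ?thesis .
  qed
  have nonneg: "(\<Sum>\<xi>\<in>ball_configs n. bc_weight \<beta> J \<zeta> n \<xi> * indicator B (?g \<xi>)) / ?Z \<ge> 0" for B
    using Z bc_weight_nonneg by (intro divide_nonneg_nonneg sum_nonneg) (auto simp: less_imp_le)
  then show "measure (bc_measure_ext \<beta> J \<zeta> n) B =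
      (\<Sum>\<xi>\<in>ball_configs n. bc_weight \<beta> J \<zeta> n \<xi> * indicator B (?g \<xi>)) / ?Z"
    if "B \<in> sets config_algebra" using em[OF that] by (simp add: measure_def)
  have sets: "sets (bc_measure_ext \<beta> J \<zeta> n) = sets config_algebra" by (simp add: bc_measure_ext_def)
  have "emeasure (bc_measure_ext \<beta> J \<zeta> n) (space (bc_measure_ext \<beta> J \<zeta> n)) = 1"
    using em[of configs] Z override_ball_in_configs[OF \<zeta>, of _ n] sets_eq_imp_space_eq[OF sets]
      sets.top[of config_algebra]
    by simp
  then show "config_prob (bc_measure_ext \<beta> J \<zeta> n)"
    using sets by (simp add: config_prob_def prob_spaceI)
qed

text \<open>The marginal on a smaller ball is again of boundary-law form, the law being the message from the
  frozen sphere.\<close>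

lemma bc_measure_ext_cyl:
  assumes z: "\<And>x. \<zeta> x = z (length x)" and \<zeta>: "\<zeta> \<in> configs" and \<sigma>: "\<sigma> \<in> ball_configs m"
  shows "measure (bc_measure_ext \<beta> J \<zeta> (m + l)) (cyl m \<sigma>) = ball_prob (\<beta> * J) m (msg (\<beta> * J) z l m) \<sigma>"
proof -
  let ?b = "\<beta> * J" and ?n = "m + l"
  have all: "of_bool (\<forall>x\<in>A. P x) = (\<Prod>x\<in>A. of_bool (P x) :: real)" if "finite A" for A :: "vertex set" and P
    using that by induction auto
  have w: "bc_weight \<beta> J \<zeta> ?n \<xi> = ball_weight ?b ?n (msg ?b z 0 ?n) \<xi>" for \<xi>
    unfolding bc_weight_def ball_weight_def ball_energy_eq all[OF finite_sphere_W]
    by (auto simp: z sphere_W_eq intro!: prod.cong)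
  have sum_w: "(\<Sum>\<xi> | \<xi> \<in> ball_configs ?n \<and> restrict \<xi> (ball_V m) = \<tau>. bc_weight \<beta> J \<zeta> ?n \<xi>)
      = ball_weight ?b m (msg ?b z l m) \<tau>" if "\<tau> \<in> ball_configs m" for \<tau>
    unfolding w by (rule sum_ball_weight_msg[OF that])
  have "(\<Sum>\<xi>\<in>ball_configs ?n. bc_weight \<beta> J \<zeta> ?n \<xi> * indicator (cyl m \<sigma>) (override_on \<zeta> \<xi> (ball_V ?n)))
      = (\<Sum>\<xi> | \<xi> \<in> ball_configs ?n \<and> restrict \<xi> (ball_V m) = \<sigma>. bc_weight \<beta> J \<zeta> ?n \<xi>)"
  proof (rule sum.mono_neutral_cong_right)
    have "override_on \<zeta> \<xi> (ball_V ?n) \<in> cyl m \<sigma> \<longleftrightarrow> restrict \<xi> (ball_V m) = \<sigma>"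
      if "\<xi> \<in> ball_configs ?n" for \<xi>
    proof -
      have "restrict (override_on \<zeta> \<xi> (ball_V ?n)) (ball_V m) = restrict \<xi> (ball_V m)"
        using ball_V_mono[of m ?n] by (auto simp: override_on_def fun_eq_iff)
      then show ?thesis using override_ball_in_configs[OF \<zeta> that] by (simp add: cyl_iff)
    qed
    then show "\<forall>\<xi>\<in>ball_configs ?n - {\<xi> \<in> ball_configs ?n. restrict \<xi> (ball_V m) = \<sigma>}.
        bc_weight \<beta> J \<zeta> ?n \<xi> * indicator (cyl m \<sigma>) (override_on \<zeta> \<xi> (ball_V ?n)) = 0"
      "\<And>\<xi>. \<xi> \<in> {\<xi> \<in> ball_configs ?n. restrict \<xi> (ball_V m) = \<sigma>} \<Longrightarrow>
        bc_weight \<beta> J \<zeta> ?n \<xi> * indicator (cyl m \<sigma>) (override_on \<zeta> \<xi> (ball_V ?n)) = bc_weight \<beta> J \<zeta> ?n \<xi>"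
      by auto
  qed auto
  then show ?thesis
    unfolding bc_measure_ext_prob(2)[OF \<zeta> cyl_sets] ball_prob_def
      sum_ball_configs_group[of m ?n, symmetric, OF le_add1]
    using \<sigma> by (simp add: sum_w)
qed

lemma bc_measure_ext_eq_spec:
  assumes \<zeta>: "\<zeta> \<in> configs" and B: "B \<in> sets config_algebra"
  shows "measure (bc_measure_ext \<beta> J \<zeta> (Suc n)) B = gibbs_spec \<beta> J (ball_V n) \<zeta> B"
proof -
  let ?S = "{\<xi> \<in> ball_configs (Suc n). \<forall>x\<in>sphere_W (Suc n). \<xi> x = \<zeta> x}"
  let ?P = "\<Pi>\<^sub>E x\<in>ball_V n. spins x" and ?W = "spec_weight \<beta> J (ball_V n)"
  have reindex: "(\<Sum>\<xi>\<in>ball_configs (Suc n). bc_weight \<beta> J \<zeta> (Suc n) \<xi> * G (override_on \<zeta> \<xi> (ball_V (Suc n))))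
      = (\<Sum>\<sigma>\<in>?P. ?W (override_on \<zeta> \<sigma> (ball_V n)) * G (override_on \<zeta> \<sigma> (ball_V n)))"
    for G :: "(vertex \<Rightarrow> real) \<Rightarrow> real"
  proof -
    have "(\<Sum>\<xi>\<in>ball_configs (Suc n). bc_weight \<beta> J \<zeta> (Suc n) \<xi> * G (override_on \<zeta> \<xi> (ball_V (Suc n))))
      = (\<Sum>\<xi>\<in>?S. bc_weight \<beta> J \<zeta> (Suc n) \<xi> * G (override_on \<zeta> \<xi> (ball_V (Suc n))))"
      by (rule sum.mono_neutral_right) (auto simp: bc_weight_def)
    also have "\<dots> = (\<Sum>\<sigma>\<in>?P. ?W (override_on \<zeta> \<sigma> (ball_V n)) * G (override_on \<zeta> \<sigma> (ball_V n)))"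
    proof (rule sum.reindex_bij_witness[where j = "\<lambda>\<xi>. restrict \<xi> (ball_V n)"
          and i = "\<lambda>\<sigma>. restrict (override_on \<zeta> \<sigma> (ball_V n)) (ball_V (Suc n))"])
      fix \<xi> assume \<xi>: "\<xi> \<in> ?S"
      have o: "override_on \<zeta> (restrict \<xi> (ball_V n)) (ball_V n) = override_on \<zeta> \<xi> (ball_V (Suc n))"
        using \<xi> by (auto simp: override_on_def ball_V_Suc fun_eq_iff)
      have "restrict (override_on \<zeta> \<xi> (ball_V (Suc n))) (ball_V (Suc n)) = restrict \<xi> (ball_V (Suc n))"
        by (auto simp: override_on_def fun_eq_iff)
      then show "restrict (override_on \<zeta> (restrict \<xi> (ball_V n)) (ball_V n)) (ball_V (Suc n)) = \<xi>"
        using \<xi> unfolding o by (simp add: restrict_ball_configs)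
      show "restrict \<xi> (ball_V n) \<in> ?P"
        using \<xi> restrict_ball_configs_mono[of \<xi> "Suc n" n] by (auto simp: ball_configs_def[of n])
      have "?W (override_on \<zeta> \<xi> (ball_V (Suc n))) = bc_weight \<beta> J \<zeta> (Suc n) \<xi>"
        using \<xi> tl_ball_V[of _ "Suc n"]
        by (auto simp: spec_weight_eq bc_weight_def ball_energy_eq edge_tops_ball_V override_on_def
            intro!: sum.cong)
      then show "?W (override_on \<zeta> (restrict \<xi> (ball_V n)) (ball_V n)) * G (override_on \<zeta> (restrict \<xi> (ball_V n)) (ball_V n))
          = bc_weight \<beta> J \<zeta> (Suc n) \<xi> * G (override_on \<zeta> \<xi> (ball_V (Suc n)))"
        unfolding o by simp
    next
      fix \<sigma> assume \<sigma>: "\<sigma> \<in> ?P"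
      show "restrict (restrict (override_on \<zeta> \<sigma> (ball_V n)) (ball_V (Suc n))) (ball_V n) = \<sigma>"
      proof
        fix x show "restrict (restrict (override_on \<zeta> \<sigma> (ball_V n)) (ball_V (Suc n))) (ball_V n) x = \<sigma> x"
          using \<sigma> ball_V_mono[of n "Suc n"] by (auto simp: override_on_def restrict_def PiE_def extensional_def)
      qed
      have "restrict (override_on \<zeta> \<sigma> (ball_V n)) (ball_V (Suc n)) \<in> ball_configs (Suc n)"
        by (intro restrict_in_ball_configs override_in_configs[OF \<zeta> \<sigma>])
      moreover have "x \<in> ball_V (Suc n) \<and> x \<notin> ball_V n" if "x \<in> sphere_W (Suc n)" for x
        using that by (auto simp: ball_V_eq sphere_W_eq)
      ultimately show "restrict (override_on \<zeta> \<sigma> (ball_V n)) (ball_V (Suc n)) \<in> ?S"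
        by (simp add: override_on_def)
    qed
    finally show ?thesis .
  qed
  show ?thesis
    unfolding bc_measure_ext_prob(2)[OF \<zeta> B] gibbs_spec_def reindex
    using reindex[of "\<lambda>_. 1"] by simp
qed

section \<open>Stochastic domination of Gibbs measures\<close>

text \<open>Edges that meet the ball of radius \<open>n\<close> reach at most one further level, so the values of \<open>\<eta>\<close> beyond it
  are immaterial; \<open>config_plus\<close> is an arbitrary continuation.\<close>

lemma gibbs_spec_cyl_local:
  assumes \<Lambda>: "\<Lambda> \<subseteq> ball_V n" and m: "m \<le> Suc n" and \<eta>: "\<eta> \<in> configs"
  shows "gibbs_spec \<beta> J \<Lambda> \<eta> (cyl m \<sigma>) = gibbs_spec \<beta> J \<Lambda>
    (override_on config_plus (restrict \<eta> (ball_V (Suc n))) (ball_V (Suc n))) (cyl m \<sigma>)"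
proof -
  let ?\<eta> = "override_on config_plus (restrict \<eta> (ball_V (Suc n))) (ball_V (Suc n))"
  have \<eta>': "?\<eta> \<in> configs"
    by (rule override_ball_in_configs) (use \<eta> in \<open>auto simp: configs_iff\<close>)
  have edges: "y \<in> ball_V (Suc n)" "tl y \<in> ball_V (Suc n)" if "y \<in> edge_tops \<Lambda>" for y
    using that \<Lambda> by (auto simp: edge_tops_def ball_V_eq)
  have same: "override_on ?\<eta> \<tau> \<Lambda> y = override_on \<eta> \<tau> \<Lambda> y" if "y \<in> ball_V (Suc n)" for y \<tau>
    using that by (simp add: override_on_def)
  then have W: "spec_weight \<beta> J \<Lambda> (override_on ?\<eta> \<tau> \<Lambda>) = spec_weight \<beta> J \<Lambda> (override_on \<eta> \<tau> \<Lambda>)" for \<tau>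
    unfolding spec_weight_eq
    by (intro arg_cong[where f = exp] arg_cong[where f = "(*) _"] sum.cong) (simp_all add: edges)
  have "restrict (override_on ?\<eta> \<tau> \<Lambda>) (ball_V m) = restrict (override_on \<eta> \<tau> \<Lambda>) (ball_V m)" for \<tau>
    using ball_V_mono[OF m] by (auto simp: override_on_def fun_eq_iff)
  then have "indicator (cyl m \<sigma>) (override_on ?\<eta> \<tau> \<Lambda>)
      = (indicator (cyl m \<sigma>) (override_on \<eta> \<tau> \<Lambda>) :: real)"
    if "\<tau> \<in> (\<Pi>\<^sub>E x\<in>\<Lambda>. spins x)" for \<tau>
    using override_in_configs[OF \<eta> that] override_in_configs[OF \<eta>' that]
    by (simp add: indicator_def cyl_iff)
  then show ?thesis unfolding gibbs_spec_def W by simp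
qed

text \<open>Conditioning on the spins outside a ball, a Gibbs measure is a mixture of specifications with
  boundary conditions between \<open>config_minus\<close> and \<open>config_plus\<close>.\<close>

lemma gibbs_ball_expect_le:
  assumes J: "\<beta> > 0" "J > 0" and \<nu>: "gibbs_measure \<beta> J \<nu>"
    and \<phi>: "ball_increasing m \<phi>" and mn: "m \<le> n"
  shows "ball_expect m \<phi> \<nu> \<le> ball_expect m \<phi> (bc_measure_ext \<beta> J config_plus (Suc n))"
    and "ball_expect m \<phi> (bc_measure_ext \<beta> J config_minus (Suc n)) \<le> ball_expect m \<phi> \<nu>"
proof -
  let ?E = "\<lambda>\<eta>. spec_expect \<beta> J (ball_V n) \<eta> (\<lambda>\<zeta>. \<phi> (restrict \<zeta> (ball_V m)))"
  have \<nu>p: "config_prob \<nu>" using \<nu> by (simp add: gibbs_measure_def)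
  then interpret prob_space \<nu> by (simp add: config_prob_def)
  have sp: "space \<nu> = configs" by (rule config_prob_space[OF \<nu>p])
  have spec: "(\<Sum>\<sigma>\<in>ball_configs m. \<phi> \<sigma> * gibbs_spec \<beta> J (ball_V n) \<eta> (cyl m \<sigma>)) = ?E \<eta>"
    if "\<eta> \<in> configs" for \<eta>
    unfolding gibbs_spec_eq spec_expect_sum[symmetric]
    by (rule spec_expect_cong[OF that]) (rule sum_cyl_indicator)
  have bc: "ball_expect m \<phi> (bc_measure_ext \<beta> J \<zeta> (Suc n)) = ?E \<zeta>" if "\<zeta> \<in> configs" for \<zeta>
    unfolding ball_expect_def bc_measure_ext_eq_spec[OF that cyl_sets] by (rule spec[OF that])
  obtain c where c: "\<And>\<zeta>. \<zeta> \<in> configs \<Longrightarrow> c \<le> \<phi> (restrict \<zeta> (ball_V m))"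
  proof
    show "Min (\<phi> ` ball_configs m) \<le> \<phi> (restrict \<zeta> (ball_V m))" if "\<zeta> \<in> configs" for \<zeta>
      using that by (intro Min_le) auto
  qed
  have mono: "?E \<eta> \<le> ?E \<eta>'" if "\<eta> \<in> configs" "\<eta>' \<in> configs" "\<And>x. \<eta> x \<le> \<eta>' x" for \<eta> \<eta>'
    using c \<phi> by (intro spec_expect_mono[where c = c] J that) (auto simp: ball_increasing_def)
  have int: "integrable \<nu> (\<lambda>\<eta>. gibbs_spec \<beta> J (ball_V n) \<eta> (cyl m \<sigma>))" for \<sigma>
    by (rule integrableI_local[OF \<nu>p, where n = "Suc n" and
        \<phi> = "\<lambda>\<tau>. gibbs_spec \<beta> J (ball_V n) (override_on config_plus \<tau> (ball_V (Suc n))) (cyl m \<sigma>)"])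
       (use mn in \<open>auto intro!: gibbs_spec_cyl_local\<close>)
  have "ball_expect m \<phi> \<nu> = (\<Sum>\<sigma>\<in>ball_configs m. \<phi> \<sigma> * (\<integral>\<eta>. gibbs_spec \<beta> J (ball_V n) \<eta> (cyl m \<sigma>) \<partial>\<nu>))"
    unfolding ball_expect_def
  proof (rule sum.cong[OF refl])
    fix \<sigma>
    have "measure \<nu> (cyl m \<sigma>) = (\<integral>\<eta>. gibbs_spec \<beta> J (ball_V n) \<eta> (cyl m \<sigma>) \<partial>\<nu>)"
      using \<nu> finite_ball_V cyl_sets unfolding gibbs_measure_def by blast
    then show "\<phi> \<sigma> * measure \<nu> (cyl m \<sigma>) = \<phi> \<sigma> * (\<integral>\<eta>. gibbs_spec \<beta> J (ball_V n) \<eta> (cyl m \<sigma>) \<partial>\<nu>)"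
      by simp
  qed
  also have "\<dots> = (\<integral>\<eta>. (\<Sum>\<sigma>\<in>ball_configs m. \<phi> \<sigma> * gibbs_spec \<beta> J (ball_V n) \<eta> (cyl m \<sigma>)) \<partial>\<nu>)"
    using int by simp
  also have "\<dots> = (\<integral>\<eta>. ?E \<eta> \<partial>\<nu>)"
    by (rule Bochner_Integration.integral_cong) (simp_all add: spec sp)
  finally have E: "ball_expect m \<phi> \<nu> = (\<integral>\<eta>. ?E \<eta> \<partial>\<nu>)" .
  have "integrable \<nu> ?E \<longleftrightarrow>
      integrable \<nu> (\<lambda>\<eta>. \<Sum>\<sigma>\<in>ball_configs m. \<phi> \<sigma> * gibbs_spec \<beta> J (ball_V n) \<eta> (cyl m \<sigma>))"
    by (rule Bochner_Integration.integrable_cong) (simp_all add: spec sp)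
  then have intE: "integrable \<nu> ?E" using int by simp
  have pm: "config_plus \<in> configs" "config_minus \<in> configs" by (simp_all add: configs_iff)
  have "(\<integral>\<eta>. ?E \<eta> \<partial>\<nu>) \<le> (\<integral>\<eta>. ?E config_plus \<partial>\<nu>)"
    using spins_bounds by (intro integral_mono intE mono pm) (auto simp: sp configs_iff)
  then show "ball_expect m \<phi> \<nu> \<le> ball_expect m \<phi> (bc_measure_ext \<beta> J config_plus (Suc n))"
    by (simp add: E bc pm prob_space)
  have "(\<integral>\<eta>. ?E config_minus \<partial>\<nu>) \<le> (\<integral>\<eta>. ?E \<eta> \<partial>\<nu>)"
    using spins_bounds by (intro integral_mono intE mono pm) (auto simp: sp configs_iff)
  then show "ball_expect m \<phi> (bc_measure_ext \<beta> J config_minus (Suc n)) \<le> ball_expect m \<phi> \<nu>"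
    by (simp add: E bc pm prob_space)
qed

lemma stoch_le_weak_limit:
  assumes J: "\<beta> > 0" "J > 0" and \<nu>: "gibbs_measure \<beta> J \<nu>"
  shows "weak_limit (bc_measure_ext \<beta> J config_plus) \<mu> \<Longrightarrow> stoch_le \<nu> \<mu>"
    and "weak_limit (bc_measure_ext \<beta> J config_minus) \<mu> \<Longrightarrow> stoch_le \<mu> \<nu>"
proof -
  have pm: "config_plus \<in> configs" "config_minus \<in> configs" by (simp_all add: configs_iff)
  have lim: "(\<lambda>n. ball_expect m \<phi> (bc_measure_ext \<beta> J \<zeta> (Suc n))) \<longlonglongrightarrow> ball_expect m \<phi> \<mu>"
    if "weak_limit (bc_measure_ext \<beta> J \<zeta>) \<mu>" "\<zeta> \<in> configs" for \<zeta> m \<phi>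
    unfolding ball_expect_def using bc_measure_ext_prob(1)[OF that(2)] that(1)
    by (intro tendsto_sum tendsto_mult_left LIMSEQ_Suc weak_limit_cyl)
  have \<nu>p: "config_prob \<nu>" using \<nu> by (simp add: gibbs_measure_def)
  show "stoch_le \<nu> \<mu>" if w: "weak_limit (bc_measure_ext \<beta> J config_plus) \<mu>"
    using w gibbs_ball_expect_le(1)[OF J \<nu>]
    by (intro stoch_leI \<nu>p LIMSEQ_le_const[OF lim[OF w pm(1)]]) (auto simp: weak_limit_def)
  show "stoch_le \<mu> \<nu>" if w: "weak_limit (bc_measure_ext \<beta> J config_minus) \<mu>"
    using w gibbs_ball_expect_le(2)[OF J \<nu>]
    by (intro stoch_leI \<nu>p LIMSEQ_le_const2[OF lim[OF w pm(2)]]) (auto simp: weak_limit_def)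
qed

section \<open>The likelihood-ratio order on boundary laws\<close>

text \<open>The ratio \<open>\<psi> / \<phi>\<close> is increasing on \<open>S\<close>; the products also make sense of this for point masses.\<close>

definition lr_le :: "real set \<Rightarrow> (real \<Rightarrow> real) \<Rightarrow> (real \<Rightarrow> real) \<Rightarrow> bool" where
  "lr_le S \<phi> \<psi> \<longleftrightarrow> (\<forall>s\<in>S. \<forall>t\<in>S. s < t \<longrightarrow> \<phi> t * \<psi> s \<le> \<phi> s * \<psi> t)"

text \<open>The kernel \<open>exp (b * s * t)\<close> is totally positive, so one step of message passing preserves the
  order; this is the four functions theorem for a single spin.\<close>

lemma pass_lr_mono:
  assumes b: "b \<ge> 0" and fin: "finite S" and le: "lr_le S \<phi> \<psi>"
    and nonneg: "\<And>s. s \<in> S \<Longrightarrow> 0 \<le> \<phi> s \<and> 0 \<le> \<psi> s"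
  shows "lr_le S' (pass b S \<phi>) (pass b S \<psi>)"
  unfolding lr_le_def
proof (intro ballI impI)
  fix u v :: real assume uv: "u < v"
  let ?K = "\<lambda>s \<phi>. \<Sum>t\<in>S. exp (b * s * t) * \<phi> t"
  have "?K v \<phi> * ?K u \<psi> \<le> ?K v \<psi> * ?K u \<phi>"
  proof (rule four_functions_chain[OF fin])
    fix s assume "s \<in> S"
    then show "0 \<le> exp (b * v * s) * \<phi> s \<and> 0 \<le> exp (b * u * s) * \<psi> s \<and>
        0 \<le> exp (b * v * s) * \<psi> s \<and> 0 \<le> exp (b * u * s) * \<phi> s"
      using nonneg by simp
  next
    fix s t assume st: "s \<in> S" "t \<in> S"
    show "exp (b * v * s) * \<phi> s * (exp (b * u * t) * \<psi> t)
        \<le> exp (b * v * max s t) * \<psi> (max s t) * (exp (b * u * min s t) * \<phi> (min s t))"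
    proof (cases "s \<le> t")
      case True
      have "0 \<le> b * ((v - u) * (t - s))" using b uv True by simp
      then have "b * v * s + b * u * t \<le> b * v * t + b * u * s" by (simp add: algebra_simps)
      then have "exp (b * v * s) * exp (b * u * t) \<le> exp (b * v * t) * exp (b * u * s)"
        by (simp add: exp_add[symmetric])
      then have "exp (b * v * s) * exp (b * u * t) * (\<phi> s * \<psi> t)
          \<le> exp (b * v * t) * exp (b * u * s) * (\<phi> s * \<psi> t)"
        using nonneg st by (intro mult_right_mono) auto
      then show ?thesis using True by (simp add: max_def min_def mult_ac)
    next
      case False
      then have "\<phi> s * \<psi> t \<le> \<phi> t * \<psi> s" using le st by (auto simp: lr_le_def)
      then have "exp (b * v * s) * exp (b * u * t) * (\<phi> s * \<psi> t)
          \<le> exp (b * v * s) * exp (b * u * t) * (\<phi> t * \<psi> s)"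
        by (intro mult_left_mono) auto
      then show ?thesis using False by (simp add: max_def min_def mult_ac)
    qed
  qed
  then have "(?K v \<phi> * ?K u \<psi>)^2 \<le> (?K v \<psi> * ?K u \<phi>)^2"
    using nonneg by (intro power_mono) (auto intro!: mult_nonneg_nonneg sum_nonneg)
  then show "pass b S \<phi> v * pass b S \<psi> u \<le> pass b S \<phi> u * pass b S \<psi> v"
    unfolding pass_def power_mult_distrib by (simp add: mult_ac)
qed

text \<open>Point masses at the largest and the smallest spin are the extreme boundary laws.\<close>

lemma lr_le_top:
  assumes "\<And>s. s \<in> S \<Longrightarrow> s \<le> m" "\<And>s. s \<in> S \<Longrightarrow> \<phi> s \<ge> 0"
  shows "lr_le S \<phi> (\<lambda>s. of_bool (s = m))"
  using assms unfolding lr_le_def by force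

lemma lr_le_bot:
  assumes "\<And>s. s \<in> S \<Longrightarrow> m \<le> s" "\<And>s. s \<in> S \<Longrightarrow> \<phi> s \<ge> 0"
  shows "lr_le S (\<lambda>s. of_bool (s = m)) \<phi>"
  using assms unfolding lr_le_def by force

lemma pass_nonneg: "pass b S \<phi> s \<ge> 0"
  by (simp add: pass_def)

lemma pass_scale:
  assumes "\<And>t. t \<in> S \<Longrightarrow> \<phi> t = c * \<psi> t"
  shows "pass b S \<phi> s = c^2 * pass b S \<psi> s"
proof -
  have "(\<Sum>t\<in>S. exp (b * s * t) * \<phi> t) = c * (\<Sum>t\<in>S. exp (b * s * t) * \<psi> t)"
    unfolding sum_distrib_left by (rule sum.cong) (simp_all add: assms mult_ac)
  then show ?thesis by (simp add: pass_def power_mult_distrib)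
qed

lemma pass_pos:
  assumes "finite S" "\<And>t. t \<in> S \<Longrightarrow> \<phi> t \<ge> 0" "t \<in> S" "\<phi> t > 0"
  shows "pass b S \<phi> s > 0"
  unfolding pass_def using assms by (intro zero_less_power sum_pos2[where i = t]) auto

lemma level_spins_nonempty: "level_spins i \<noteq> {}"
  by (simp add: level_spins_def)

lemma level_spins_add3: "level_spins (i + 3) = level_spins i"
  by (simp add: level_spins_def)

definition level_top :: "nat \<Rightarrow> real" where
  "level_top i = (if i mod 3 = 0 then 1/2 else if i mod 3 = 1 then 1 else 3/2)"

lemma config_plus_level: "config_plus x = level_top (length x)"
  and config_minus_level: "config_minus x = - level_top (length x)"
  by (simp_all add: config_plus_def config_minus_def level_top_def level_class_eq)

lemma level_top_in: "level_top i \<in> level_spins i" "- level_top i \<in> level_spins i"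
  and level_top_bounds: "s \<in> level_spins i \<Longrightarrow> - level_top i \<le> s \<and> s \<le> level_top i"
  by (auto simp: level_top_def level_spins_def split: if_splits)

lemma msg_nonneg: "msg b z l i s \<ge> 0"
  by (cases l) (auto simp: pass_nonneg)

lemma msg_pos:
  assumes z: "\<And>i. z i \<in> level_spins i"
  shows "msg b z (Suc l) i s > 0"
proof (induction l arbitrary: i s)
  case 0
  show ?case using z[of "Suc i"] by (auto intro!: pass_pos[where t = "z (Suc i)"])
next
  case (Suc l)
  obtain t where "t \<in> level_spins (Suc i)" using level_spins_nonempty by blast
  then show ?case using Suc.IH[of "Suc i"]
    by (subst msg.simps) (auto intro!: pass_pos[where t = t] msg_nonneg simp del: msg.simps)
qed

lemma msg_periodic:
  assumes "\<And>i. z (i + 3) = z i"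
  shows "msg b z l (i + 3) = msg b z l i"
proof (induction l arbitrary: i)
  case 0
  then show ?case using assms by auto
next
  case (Suc l)
  show ?case using Suc.IH[of "Suc i"] level_spins_add3[of "Suc i"] by simp
qed

lemma level_top_periodic: "level_top (i + 3) = level_top i"
  by (simp add: level_top_def)

text \<open>Moving the frozen sphere one level further away lowers the message from the maximal boundary spins:
  it replaces a point mass at the largest spin by another law, and message passing is monotone.\<close>

lemma msg_top_antimono:
  assumes "b \<ge> 0"
  shows "lr_le (level_spins i) (msg b level_top (Suc l) i) (msg b level_top l i)"
proof (induction l arbitrary: i)
  case 0
  show ?case unfolding msg.simps(1) 
    by (rule lr_le_top) (use level_top_bounds pass_nonneg in auto)
next
  case (Suc l)
  have "lr_le (level_spins i) (pass b (level_spins (Suc i)) (msg b level_top (Suc l) (Suc i)))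
      (pass b (level_spins (Suc i)) (msg b level_top l (Suc i)))"
    by (rule pass_lr_mono[OF assms finite_level_spins Suc.IH]) (simp only: msg_nonneg simp_thms)
  then show ?case by simp
qed

lemma msg_bot_mono:
  assumes "b \<ge> 0"
  shows "lr_le (level_spins i) (msg b (\<lambda>i. - level_top i) l i) (msg b (\<lambda>i. - level_top i) (Suc l) i)"
proof (induction l arbitrary: i)
  case 0
  show ?case unfolding msg.simps(1)
    by (rule lr_le_bot) (use level_top_bounds pass_nonneg in auto)
next
  case (Suc l)
  have "lr_le (level_spins i)
      (pass b (level_spins (Suc i)) (msg b (\<lambda>i. - level_top i) l (Suc i)))
      (pass b (level_spins (Suc i)) (msg b (\<lambda>i. - level_top i) (Suc l) (Suc i)))"
    by (rule pass_lr_mono[OF assms finite_level_spins Suc.IH]) (simp only: msg_nonneg simp_thms)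
  then show ?case by simp
qed

section \<open>The scalar recursion\<close>

text \<open>The constant boundary law of the parameter \<open>x\<close>, normalised to \<open>1\<close> at the spins \<open>-1/2\<close>, \<open>0\<close>, \<open>-1/2\<close> of
  the three classes of levels.\<close>

definition law_fn :: "real \<Rightarrow> real \<Rightarrow> nat \<Rightarrow> real \<Rightarrow> real" where
  "law_fn \<theta> x i s =
    (if i mod 3 = 0 then (if s = 1/2 then x^2 else 1)
     else if i mod 3 = 1 then
       (if s = -1 then law_p \<theta> x else if s = 1 then law_q \<theta> x else 1)
     else (if s = -3/2 then law_T \<theta> x else if s = 1/2 then law_U \<theta> x
           else if s = 3/2 then law_N \<theta> x else 1))"

lemma law_pos:
  assumes "\<theta> > 0" "x > 0"
  shows "law_T \<theta> x > 0" "law_U \<theta> x > 0" "law_N \<theta> x > 0" "law_p \<theta> x > 0" "law_q \<theta> x > 0"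
    "law_map x \<theta> > 0"
proof -
  show T: "law_T \<theta> x > 0" and U: "law_U \<theta> x > 0" and N: "law_N \<theta> x > 0"
    unfolding law_T_def law_U_def law_N_def
    by (intro zero_less_power divide_pos_pos add_pos_pos mult_pos_pos zero_less_one assms)+
  show p: "law_p \<theta> x > 0" and q: "law_q \<theta> x > 0"
    unfolding law_p_def law_q_def
    by (intro zero_less_power divide_pos_pos add_pos_pos mult_pos_pos zero_less_one assms T U N)+
  show "law_map x \<theta> > 0"
    using assms p q unfolding law_map_def by (auto intro!: divide_pos_pos add_pos_pos mult_pos_pos)
qed

lemma law_fn_pos: "\<theta> > 0 \<Longrightarrow> x > 0 \<Longrightarrow> law_fn \<theta> x i s > 0"
  by (auto simp: law_fn_def law_pos)

text \<open>Levels congruent to \<open>2\<close>, \<open>1\<close> and \<open>0\<close> modulo \<open>3\<close> correspond to the three stages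
  \<open>T, U, N\<close>, then \<open>p, q\<close>, then \<open>law_map\<close> of the scalar map.\<close>

lemma pass_law_fn_2:
  assumes \<theta>: "\<theta> = exp (b / 2)" and x: "x > 0" and i: "i mod 3 = 2"
  shows "\<exists>c>0. \<forall>s\<in>level_spins i. pass b (level_spins (Suc i)) (law_fn \<theta> x (Suc i)) s = c * law_fn \<theta> x i s"
proof -
  define r where "r = exp (b / 4)"
  have r: "r > 0" by (simp add: r_def)
  have \<theta>r: "\<theta> = r^2" by (simp add: \<theta> r_def exp_of_nat_mult[symmetric])
  have e: "exp (b * 3 / 4) = r^3" "exp (b / 4) = r" "exp (- (b / 4)) = 1 / r" "exp (- (b * 3 / 4)) = 1 / r^3"
    unfolding r_def by (simp_all add: exp_of_nat_mult[symmetric] exp_minus inverse_eq_divide mult.commute)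
  have S: "level_spins (Suc i) = {-1/2, 1/2}" "level_spins i = {-3/2, -1/2, 1/2, 3/2}"
    using i by (simp_all add: level_spins_def mod_Suc)
  have L: "law_fn \<theta> x (Suc i) (-1/2) = 1" "law_fn \<theta> x (Suc i) (1/2) = x^2"
    using i by (simp_all add: law_fn_def mod_Suc)
  have P: "pass b (level_spins (Suc i)) (law_fn \<theta> x (Suc i)) s
      = (exp (b * s * (-1/2)) + exp (b * s * (1/2)) * x^2)^2" for s
    unfolding pass_def S using L by simp
  let ?c = "(r + x^2 / r)^2"
  have c: "?c > 0" by (intro zero_less_power add_pos_pos divide_pos_pos r x)
  have v1: "r^3 + x^2 / r^3 = (r + x^2 / r) * ((x^2 + \<theta>^3) / (\<theta>^2 + \<theta> * x^2))"
   and v2: "1 / r + x^2 * r = (r + x^2 / r) * ((\<theta> * x^2 + 1) / (x^2 + \<theta>))"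
   and v3: "1 / r^3 + x^2 * r^3 = (r + x^2 / r) * ((\<theta>^3 * x^2 + 1) / (\<theta>^2 + \<theta> * x^2))"
  proof -
    have n: "r^4 + r^2 * x^2 \<noteq> 0" "x^2 + r^2 \<noteq> 0" "r \<noteq> 0"
      using r x by (auto simp: add_pos_pos[THEN less_imp_neq, symmetric] intro!: less_imp_neq[symmetric] add_pos_pos)
    then show "r^3 + x^2 / r^3 = (r + x^2 / r) * ((x^2 + \<theta>^3) / (\<theta>^2 + \<theta> * x^2))"
      "1 / r + x^2 * r = (r + x^2 / r) * ((\<theta> * x^2 + 1) / (x^2 + \<theta>))"
      "1 / r^3 + x^2 * r^3 = (r + x^2 / r) * ((\<theta>^3 * x^2 + 1) / (\<theta>^2 + \<theta> * x^2))"
      unfolding \<theta>r by (simp_all add: divide_simps power_mult[symmetric]) (simp_all add: algebra_simps eval_nat_numeral)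
  qed
  have "\<forall>s\<in>level_spins i. pass b (level_spins (Suc i)) (law_fn \<theta> x (Suc i)) s = ?c * law_fn \<theta> x i s"
    unfolding P S(2) using i v1 v2 v3
    by (simp add: law_fn_def law_T_def law_U_def law_N_def e power_mult_distrib[symmetric] mult.commute)
  then show ?thesis using c by blast
qed

lemma pass_law_fn_1:
  assumes \<theta>: "\<theta> = exp (b / 2)" and x: "x > 0" and i: "i mod 3 = 1"
  shows "\<exists>c>0. \<forall>s\<in>level_spins i. pass b (level_spins (Suc i)) (law_fn \<theta> x (Suc i)) s = c * law_fn \<theta> x i s"
proof -
  have t: "\<theta> > 0" by (simp add: \<theta>)
  have e: "exp (b * 3 / 2) = \<theta>^3" "exp (b / 2) = \<theta>" "exp (- (b / 2)) = 1 / \<theta>" "exp (- (b * 3 / 2)) = 1 / \<theta>^3"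
    unfolding \<theta> by (simp_all add: exp_of_nat_mult[symmetric] exp_minus inverse_eq_divide mult.commute)
  let ?T = "law_T \<theta> x" and ?U = "law_U \<theta> x" and ?N = "law_N \<theta> x"
  have pos: "?T > 0" "?U > 0" "?N > 0" using law_pos[OF t x] by auto
  have S: "level_spins i = {-1, 0, 1}" "level_spins (Suc i) = {-3/2, -1/2, 1/2, 3/2}"
    using i by (simp_all add: level_spins_def mod_Suc)
  have L: "law_fn \<theta> x (Suc i) (-3/2) = ?T" "law_fn \<theta> x (Suc i) (-1/2) = 1"
    "law_fn \<theta> x (Suc i) (1/2) = ?U" "law_fn \<theta> x (Suc i) (3/2) = ?N"
    using i by (simp_all add: law_fn_def mod_Suc)
  have P: "pass b (level_spins (Suc i)) (law_fn \<theta> x (Suc i)) s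
      = (exp (b * s * (-3/2)) * ?T + exp (b * s * (-1/2)) + exp (b * s * (1/2)) * ?U + exp (b * s * (3/2)) * ?N)^2" for s
    unfolding pass_def S using L by (simp add: add.assoc)
  let ?d = "?T + 1 + ?U + ?N"
  have d: "?d > 0" using pos by simp
  have v1: "\<theta>^3 * ?T + \<theta> + 1 / \<theta> * ?U + 1 / \<theta>^3 * ?N = ?d * ((\<theta>^6 * ?T + \<theta>^4 + \<theta>^2 * ?U + ?N) / (\<theta>^3 * ?d))"
   and v2: "1 / \<theta>^3 * ?T + 1 / \<theta> + \<theta> * ?U + \<theta>^3 * ?N = ?d * ((?T + \<theta>^2 + \<theta>^4 * ?U + \<theta>^6 * ?N) / (\<theta>^3 * ?d))"
    using t d by (simp_all add: divide_simps) (simp_all add: algebra_simps eval_nat_numeral)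
  have "\<forall>s\<in>level_spins i. pass b (level_spins (Suc i)) (law_fn \<theta> x (Suc i)) s = ?d^2 * law_fn \<theta> x i s"
    unfolding P S(1) using i v1 v2
    by (simp add: law_fn_def law_p_def law_q_def e power_mult_distrib[symmetric])
  then show ?thesis using d by (intro exI[of _ "?d^2"]) simp
qed

lemma pass_law_fn_0:
  assumes \<theta>: "\<theta> = exp (b / 2)" and x: "x > 0" and i: "i mod 3 = 0"
  shows "\<exists>c>0. \<forall>s\<in>level_spins i.
    pass b (level_spins (Suc i)) (law_fn \<theta> x (Suc i)) s = c * law_fn \<theta> (law_map x \<theta>) i s"
proof -
  have t: "\<theta> > 0" by (simp add: \<theta>)
  have e: "exp (b / 2) = \<theta>" "exp (- (b / 2)) = 1 / \<theta>"
    unfolding \<theta> by (simp_all add: exp_minus inverse_eq_divide)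
  let ?p = "law_p \<theta> x" and ?q = "law_q \<theta> x"
  have pos: "?p > 0" "?q > 0" using law_pos[OF t x] by auto
  have S: "level_spins i = {-1/2, 1/2}" "level_spins (Suc i) = {-1, 0, 1}"
    using i by (simp_all add: level_spins_def mod_Suc)
  have L: "law_fn \<theta> x (Suc i) (-1) = ?p" "law_fn \<theta> x (Suc i) 0 = 1" "law_fn \<theta> x (Suc i) 1 = ?q"
    using i by (simp_all add: law_fn_def mod_Suc)
  have P: "pass b (level_spins (Suc i)) (law_fn \<theta> x (Suc i)) s
      = (exp (- (b * s)) * ?p + 1 + exp (b * s) * ?q)^2" for s
    unfolding pass_def S using L by (simp add: add.assoc)
  let ?d = "\<theta> * ?p + 1 + 1 / \<theta> * ?q"
  have d: "?d > 0" using pos t by (intro add_pos_pos) auto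
  have d': "\<theta>^2 * ?p + \<theta> + ?q > 0" using pos t by (intro add_pos_pos) auto
  have v: "1 / \<theta> * ?p + 1 + \<theta> * ?q = ?d * law_map x \<theta>"
    using t d' unfolding law_map_def by (simp add: divide_simps) (simp add: algebra_simps eval_nat_numeral)
  have "\<forall>s\<in>level_spins i.
      pass b (level_spins (Suc i)) (law_fn \<theta> x (Suc i)) s = ?d^2 * law_fn \<theta> (law_map x \<theta>) i s"
    unfolding P S(1) using i v by (simp add: law_fn_def e power_mult_distrib[symmetric])
  then show ?thesis using d by (intro exI[of _ "?d^2"]) simp
qed

text \<open>For a fixed point the law reproduces itself up to a factor at every level; this is the
  compatibility of the corresponding boundary fields.\<close>

lemma pass_law_fn_fixpoint:
  assumes \<theta>: "\<theta> = exp (b / 2)" and x: "x \<in> positive_fixpoints \<theta>"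
  shows "\<exists>c>0. \<forall>s\<in>level_spins i. pass b (level_spins (Suc i)) (law_fn \<theta> x (Suc i)) s = c * law_fn \<theta> x i s"
proof -
  have "x > 0" "law_map x \<theta> = x" using x by (auto simp: positive_fixpoints_def)
  moreover have "i mod 3 = 0 \<or> i mod 3 = 1 \<or> i mod 3 = 2" by auto
  ultimately show ?thesis
    using pass_law_fn_0[OF \<theta>, of x i] pass_law_fn_1[OF \<theta>, of x i] pass_law_fn_2[OF \<theta>, of x i] by auto
qed

section \<open>Fixed points of the scalar map\<close>

lemma law_map_in_bounds:
  assumes t: "\<theta> > 1" and x: "x > 0"
  shows "1 / \<theta>^2 \<le> law_map x \<theta>" "law_map x \<theta> \<le> \<theta>^2"
proof -
  let ?p = "law_p \<theta> x" and ?q = "law_q \<theta> x"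
  have p: "?p > 0" and q: "?q > 0" using law_pos[of \<theta> x] t x by auto
  have d: "\<theta>^2 * ?p + \<theta> + ?q > 0" using p q t by (intro add_pos_pos) auto
  have t2: "\<theta>^2 \<ge> 1" using t by simp
  have 1: "?p \<le> \<theta>^2 * (\<theta>^2 * ?p)" "?q \<le> \<theta>^2 * (\<theta>^2 * ?q)" "\<theta> \<le> \<theta>^2 * \<theta>"
    using p q t mult_mono[OF t2 t2] mult_right_mono[of 1 "\<theta>^2 * \<theta>^2" ?p] mult_right_mono[of 1 "\<theta>^2 * \<theta>^2" ?q]
      mult_right_mono[OF t2, of \<theta>] by (simp_all add: mult.assoc)
  have "?p + \<theta> + \<theta>^2 * ?q \<le> \<theta>^2 * (\<theta>^2 * ?p + \<theta> + ?q)"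
    using 1 by (simp add: distrib_left)
  then show "law_map x \<theta> \<le> \<theta>^2"
    unfolding law_map_def using d by (simp add: pos_divide_le_eq)
  have "\<theta>^2 * ?p + \<theta> + ?q \<le> \<theta>^2 * (?p + \<theta> + \<theta>^2 * ?q)"
    using 1 by (simp add: distrib_left)
  then have "1 / \<theta>^2 * (\<theta>^2 * ?p + \<theta> + ?q) \<le> ?p + \<theta> + \<theta>^2 * ?q"
    using t by (simp add: pos_divide_le_eq mult.commute)
  then show "1 / \<theta>^2 \<le> law_map x \<theta>"
    unfolding law_map_def using d by (simp add: pos_le_divide_eq)
qed

lemma law_map_differentiable:
  assumes t: "\<theta> > 0" and x: "x > 0"
  shows "(\<lambda>x. law_map x \<theta>) differentiable at x"
proof -
  have pos: "law_T \<theta> x > 0" "law_U \<theta> x > 0" "law_N \<theta> x > 0" "law_p \<theta> x > 0" "law_q \<theta> x > 0"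
    using law_pos[OF t x] by auto
  have n: "\<theta>^2 + \<theta> * x^2 \<noteq> 0" "x^2 + \<theta> \<noteq> 0"
    "\<theta>^3 * (law_T \<theta> x + 1 + law_U \<theta> x + law_N \<theta> x) \<noteq> 0"
    "\<theta>^2 * law_p \<theta> x + \<theta> + law_q \<theta> x \<noteq> 0"
    using t x pos by (auto intro!: less_imp_neq[symmetric] add_pos_pos mult_pos_pos)
  have [derivative_intros]: "law_T \<theta> differentiable at x" "law_U \<theta> differentiable at x" "law_N \<theta> differentiable at x"
    unfolding law_T_def[abs_def] law_U_def[abs_def] law_N_def[abs_def]
    by (intro derivative_intros n)+
  have [derivative_intros]: "law_p \<theta> differentiable at x" "law_q \<theta> differentiable at x"
    unfolding law_p_def[abs_def] law_q_def[abs_def] by (intro derivative_intros n)+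
  show ?thesis unfolding law_map_def[abs_def] by (intro derivative_intros n)
qed

lemma law_map_isCont: "\<theta> > 0 \<Longrightarrow> x > 0 \<Longrightarrow> isCont (\<lambda>x. law_map x \<theta>) x"
  by (intro differentiable_imp_continuous_within law_map_differentiable)

lemma law_map_one:
  assumes "\<theta> > 0"
  shows "law_map 1 \<theta> = 1"
proof -
  have U: "law_U \<theta> 1 = 1" and N: "law_N \<theta> 1 = law_T \<theta> 1"
    using assms by (simp_all add: law_U_def law_N_def law_T_def add.commute)
  have "law_q \<theta> 1 = law_p \<theta> 1" unfolding law_p_def law_q_def U N by (simp add: add_ac)
  moreover have "law_p \<theta> 1 > 0" using law_pos[OF assms] by simp
  moreover have "\<theta>^2 * law_p \<theta> 1 + \<theta> + law_p \<theta> 1 > 0"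
    using assms \<open>law_p \<theta> 1 > 0\<close> by (intro add_pos_pos) auto
  ultimately show ?thesis by (simp add: law_map_def add_ac)
qed

text \<open>Since \<open>law_map\<close> takes values in a compact interval, steepness at the fixed point \<open>1\<close> forces
  further fixed points on either side, and the set of fixed points is compact.\<close>

lemma extreme_fixpoints:
  assumes t: "\<theta> > 1" and s2: "s2 \<theta> > 0"
  obtains x y where "x \<in> positive_fixpoints \<theta>" "y \<in> positive_fixpoints \<theta>" "x < 1" "1 < y"
    "\<And>z. z \<in> positive_fixpoints \<theta> \<Longrightarrow> x \<le> z \<and> z \<le> y"
proof -
  let ?f = "\<lambda>x. law_map x \<theta>" and ?g = "\<lambda>x. law_map x \<theta> - x"
  have t0: "\<theta> > 0" using t by simp
  have "DERIV ?f 1 :> deriv ?f 1"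
    using law_map_differentiable[OF t0, of 1] by (simp add: DERIV_deriv_iff_real_differentiable)
  then have D: "DERIV ?g 1 :> s2 \<theta>"
    unfolding s2_def by (intro derivative_eq_intros) auto
  have g1: "?g 1 = 0" using law_map_one[OF t0] by simp
  have cont: "isCont ?g x" if "x > 0" for x
    using law_map_isCont[OF t0 that] by (intro continuous_intros) auto
  obtain d where d: "d > 0" "\<And>h. 0 < h \<Longrightarrow> h < d \<Longrightarrow> 0 < ?g (1 + h)"
    using DERIV_pos_inc_right[OF D s2] g1 by auto
  obtain e where e: "e > 0" "\<And>h. 0 < h \<Longrightarrow> h < e \<Longrightarrow> ?g (1 - h) < 0"
    using DERIV_pos_inc_left[OF D s2] g1 by auto
  have "\<theta>^2 > 1" using t by simp
  \<comment> \<open>\<open>u\<close> lies close enough to \<open>1\<close> for \<open>law_map\<close> to be above the diagonal, and to the left of \<open>\<theta>^2 + 1\<close>, where it is below\<close>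
  define u where "u = 1 + min (d / 2) ((\<theta>^2 - 1) / 2)"
  have u: "1 < u" "u < \<theta>^2 + 1" "?g u \<ge> 0"
    using d(1) d(2)[of "u - 1"] \<open>\<theta>^2 > 1\<close> by (auto simp: u_def min_def field_simps split: if_splits)
  have "\<exists>y\<ge>u. y \<le> \<theta>^2 + 1 \<and> ?g y = 0"
    using u law_map_in_bounds(2)[OF t, of "\<theta>^2 + 1"] cont t
    by (intro IVT2) (auto simp: add_nonneg_pos)
  then obtain y where "u \<le> y" "?g y = 0" by blast
  then have y: "y \<in> positive_fixpoints \<theta>" "y > 1"
    using u by (simp_all add: positive_fixpoints_def)
  define w where "w = 1 / \<theta>^2"
  \<comment> \<open>\<open>w\<close> bounds \<open>law_map\<close> from below, so \<open>law_map\<close> is above the diagonal at \<open>l\<close>\<close>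
  define l where "l = w / 2"
  have "0 < w" "w < 1" using \<open>\<theta>^2 > 1\<close> t0 by (simp_all add: w_def divide_less_eq)
  then have l: "0 < l" "l < 1" "l \<le> w" by (simp_all add: l_def)
  define v where "v = 1 - min (e / 2) ((1 - l) / 2)"
  have v: "v < 1" "l < v" "?g v \<le> 0"
    using e(1) e(2)[of "1 - v"] l by (auto simp: v_def min_def field_simps split: if_splits)
  have "\<exists>x\<ge>l. x \<le> v \<and> ?g x = 0"
    using v l law_map_in_bounds(1)[OF t, of l] cont by (intro IVT2) (auto simp: w_def)
  then obtain x where "l \<le> x" "x \<le> v" "?g x = 0" by blast
  then have x: "x \<in> positive_fixpoints \<theta>" "x < 1"
    using v l by (simp_all add: positive_fixpoints_def)
  let ?I = "{1 / \<theta>^2 .. \<theta>^2}"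
  have sub: "positive_fixpoints \<theta> = {x \<in> ?I. ?g x = 0}"
    using law_map_in_bounds[OF t] t0
    by (fastforce simp: positive_fixpoints_def intro: less_le_trans[of 0 "1 / \<theta>^2"])
  have "continuous_on ?I ?g"
    using t0 by (intro continuous_at_imp_continuous_on ballI cont) (auto intro: less_le_trans[of 0 "1 / \<theta>^2"])
  then have "closed {x \<in> ?I. ?g x = 0}"
    by (intro continuous_closed_preimage_constant) auto
  moreover have "bounded {x \<in> ?I. ?g x = 0}"
    by (rule bounded_subset[OF bounded_closed_interval[of "1 / \<theta>^2" "\<theta>^2"]]) auto
  ultimately have "compact (positive_fixpoints \<theta>)"
    unfolding sub compact_eq_bounded_closed by blast
  moreover have "positive_fixpoints \<theta> \<noteq> {}" using x by auto
  ultimately obtain a c where "a \<in> positive_fixpoints \<theta>" "c \<in> positive_fixpoints \<theta>"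
    "\<And>z. z \<in> positive_fixpoints \<theta> \<Longrightarrow> a \<le> z \<and> z \<le> c"
    using compact_attains_sup[of "positive_fixpoints \<theta>"] compact_attains_inf[of "positive_fixpoints \<theta>"]
    by metis
  then show thesis using that[of a c] x y by (meson le_less_trans less_le_trans)
qed

section \<open>Convergence of the messages from the extreme boundary conditions\<close>

text \<open>A fixed point lies below the point mass at the largest spin, and message passing leaves the former
  unchanged up to a factor: all messages from the maximal boundary spins stay above every fixed point.\<close>

lemma law_fn_lr_le_msg_top:
  assumes \<theta>: "\<theta> = exp (b / 2)" and b: "b \<ge> 0" and x: "x \<in> positive_fixpoints \<theta>"
  shows "lr_le (level_spins i) (law_fn \<theta> x i) (msg b level_top l i)"
proof (induction l arbitrary: i)
  case 0
  have "law_fn \<theta> x i s \<ge> 0" for s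
    using x law_fn_pos[of \<theta> x] by (auto simp: \<theta> positive_fixpoints_def less_imp_le)
  then show ?case unfolding msg.simps(1)
    by (intro lr_le_top) (use level_top_bounds in auto)
next
  case (Suc l)
  have pos: "law_fn \<theta> x i s \<ge> 0" for i s
    using x law_fn_pos[of \<theta> x] by (auto simp: \<theta> positive_fixpoints_def less_imp_le)
  obtain c where c: "c > 0" "\<And>s. s \<in> level_spins i \<Longrightarrow>
      pass b (level_spins (Suc i)) (law_fn \<theta> x (Suc i)) s = c * law_fn \<theta> x i s"
    using pass_law_fn_fixpoint[OF \<theta> x, of i] by blast
  have "lr_le (level_spins i) (pass b (level_spins (Suc i)) (law_fn \<theta> x (Suc i)))
      (pass b (level_spins (Suc i)) (msg b level_top l (Suc i)))"
    by (rule pass_lr_mono[OF b finite_level_spins Suc.IH]) (simp add: pos msg_nonneg)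
  then show ?case using c by (auto simp: lr_le_def)
qed

lemma msg_bot_lr_le_law_fn:
  assumes \<theta>: "\<theta> = exp (b / 2)" and b: "b \<ge> 0" and x: "x \<in> positive_fixpoints \<theta>"
  shows "lr_le (level_spins i) (msg b (\<lambda>i. - level_top i) l i) (law_fn \<theta> x i)"
proof (induction l arbitrary: i)
  case 0
  have "law_fn \<theta> x i s \<ge> 0" for s
    using x law_fn_pos[of \<theta> x] by (auto simp: \<theta> positive_fixpoints_def less_imp_le)
  then show ?case unfolding msg.simps(1)
    by (intro lr_le_bot) (use level_top_bounds in auto)
next
  case (Suc l)
  have pos: "law_fn \<theta> x i s \<ge> 0" for i s
    using x law_fn_pos[of \<theta> x] by (auto simp: \<theta> positive_fixpoints_def less_imp_le)
  obtain c where c: "c > 0" "\<And>s. s \<in> level_spins i \<Longrightarrow>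
      pass b (level_spins (Suc i)) (law_fn \<theta> x (Suc i)) s = c * law_fn \<theta> x i s"
    using pass_law_fn_fixpoint[OF \<theta> x, of i] by blast
  have "lr_le (level_spins i) (pass b (level_spins (Suc i)) (msg b (\<lambda>i. - level_top i) l (Suc i)))
      (pass b (level_spins (Suc i)) (law_fn \<theta> x (Suc i)))"
    by (rule pass_lr_mono[OF b finite_level_spins Suc.IH]) (simp add: pos msg_nonneg)
  then show ?case using c by (auto simp: lr_le_def mult.left_commute)
qed

text \<open>For a boundary of period \<open>3\<close>, level \<open>0\<close> represents all levels divisible by \<open>3\<close>. The index is shifted to
  \<open>Suc l\<close> because the message at distance \<open>0\<close> is a point mass, for which the ratio is degenerate.\<close>

definition msg_ratio :: "real \<Rightarrow> (nat \<Rightarrow> real) \<Rightarrow> nat \<Rightarrow> real" where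
  "msg_ratio b z l = msg b z (Suc l) 0 (1/2) / msg b z (Suc l) 0 (-1/2)"

lemma level_spins_0: "level_spins 0 = {-1/2, 1/2}"
  by (simp add: level_spins_def)

lemma msg_ratio_pos: "(\<And>i. z i \<in> level_spins i) \<Longrightarrow> msg_ratio b z l > 0"
  unfolding msg_ratio_def by (intro divide_pos_pos msg_pos)

lemma msg_ratio_step:
  assumes \<theta>: "\<theta> = exp (b / 2)" and z: "\<And>i. z i \<in> level_spins i" and per: "\<And>i. z (i + 3) = z i"
  shows "sqrt (msg_ratio b z (l + 3)) = law_map (sqrt (msg_ratio b z l)) \<theta>"
proof -
  define r where "r = sqrt (msg_ratio b z l)"
  have r: "r > 0" "r^2 = msg_ratio b z l"
    using msg_ratio_pos[OF z, of b l] by (simp_all add: r_def)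
  let ?prop = "\<lambda>\<phi> x i. \<exists>c>0. \<forall>s\<in>level_spins i. \<phi> s = c * law_fn \<theta> x i s"
  have step: "?prop (msg b z (Suc k) i) y i"
    if 1: "?prop (msg b z k (Suc i)) x (Suc i)"
      and 2: "\<exists>c>0. \<forall>s\<in>level_spins i. pass b (level_spins (Suc i)) (law_fn \<theta> x (Suc i)) s = c * law_fn \<theta> y i s"
    for k i x y
  proof -
    obtain c where c: "c > 0" "\<And>s. s \<in> level_spins (Suc i) \<Longrightarrow> msg b z k (Suc i) s = c * law_fn \<theta> x (Suc i) s"
      using 1 by blast
    obtain c' where c': "c' > 0" "\<And>s. s \<in> level_spins i \<Longrightarrow>
        pass b (level_spins (Suc i)) (law_fn \<theta> x (Suc i)) s = c' * law_fn \<theta> y i s"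
      using 2 by blast
    have "msg b z (Suc k) i s = (c^2 * c') * law_fn \<theta> y i s" if "s \<in> level_spins i" for s
      using pass_scale[OF c(2)] c'(2)[OF that] by simp
    moreover have "c^2 * c' > 0" using c(1) c'(1) by simp
    ultimately show ?thesis by blast
  qed
  have suc: "Suc 0 = 1" "Suc 1 = 2" "Suc 2 = 3" by simp_all
  have "?prop (msg b z (Suc l) 3) r 3"
  proof (intro exI conjI)
    show pos: "msg b z (Suc l) 0 (-1/2) > 0" by (rule msg_pos[OF z])
    have "msg b z (Suc l) 3 = msg b z (Suc l) 0"
      using msg_periodic[where z = z and b = b and l = "Suc l" and i = 0, OF per] by (simp del: msg.simps)
    moreover have "msg b z (Suc l) 0 (1/2) = msg b z (Suc l) 0 (-1/2) * r^2"
      using pos by (simp add: r(2) msg_ratio_def del: msg.simps)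
    ultimately show "\<forall>s\<in>level_spins 3. msg b z (Suc l) 3 s = msg b z (Suc l) 0 (-1/2) * law_fn \<theta> r 3 s"
      by (simp add: level_spins_def law_fn_def del: msg.simps)
  qed
  then have "?prop (msg b z (Suc l) (Suc 2)) r (Suc 2)" by (simp only: suc)
  then have "?prop (msg b z (Suc (Suc l)) (Suc 1)) r (Suc 1)"
    unfolding suc by (rule step[where i = 2, unfolded suc]) (rule pass_law_fn_2[OF \<theta> r(1), of 2, unfolded suc], simp)
  then have "?prop (msg b z (Suc (Suc (Suc l))) (Suc 0)) r (Suc 0)"
    unfolding suc by (rule step[where i = 1, unfolded suc]) (rule pass_law_fn_1[OF \<theta> r(1), of 1, unfolded suc], simp)
  then have "?prop (msg b z (Suc (Suc (Suc (Suc l)))) 0) (law_map r \<theta>) 0"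
    by (rule step) (rule pass_law_fn_0[OF \<theta> r(1)], simp)
  then obtain c where "c > 0" "\<And>s. s \<in> level_spins 0 \<Longrightarrow>
      msg b z (Suc (l + 3)) 0 s = c * law_fn \<theta> (law_map r \<theta>) 0 s"
    by (auto simp: eval_nat_numeral simp del: msg.simps)
  then have "msg_ratio b z (l + 3) = (law_map r \<theta>)^2"
    by (simp add: msg_ratio_def level_spins_0 law_fn_def del: msg.simps)
  moreover have "law_map r \<theta> > 0" using law_pos(6)[of \<theta> r] r by (simp add: \<theta>)
  ultimately show ?thesis by (simp add: r_def)
qed

lemma msg_ratio_limit_fixpoint:
  assumes \<theta>: "\<theta> = exp (b / 2)" and z: "\<And>i. z i \<in> level_spins i" and per: "\<And>i. z (i + 3) = z i"
    and lim: "(\<lambda>l. msg_ratio b z l) \<longlonglongrightarrow> L" and L: "L > 0"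
  shows "sqrt L \<in> positive_fixpoints \<theta>"
proof -
  have s: "(\<lambda>l. sqrt (msg_ratio b z l)) \<longlonglongrightarrow> sqrt L" by (intro tendsto_real_sqrt lim)
  then have "(\<lambda>l. sqrt (msg_ratio b z (l + 3))) \<longlonglongrightarrow> sqrt L" by (rule LIMSEQ_ignore_initial_segment)
  moreover have "(\<lambda>l. sqrt (msg_ratio b z (l + 3))) \<longlonglongrightarrow> law_map (sqrt L) \<theta>"
    unfolding msg_ratio_step[OF \<theta> z per]
    using L by (intro isCont_tendsto_compose[where g = "\<lambda>y. law_map y \<theta>", OF law_map_isCont s]) (simp_all add: \<theta>)
  ultimately have "sqrt L = law_map (sqrt L) \<theta>" by (rule LIMSEQ_unique)
  then show ?thesis using L by (simp add: positive_fixpoints_def)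
qed

lemma lr_le_level_0:
  assumes "lr_le (level_spins 0) \<phi> \<psi>" "\<phi> (-1/2) > 0" "\<psi> (-1/2) > 0"
  shows "\<phi> (1/2) / \<phi> (-1/2) \<le> \<psi> (1/2) / \<psi> (-1/2)"
proof -
  have "\<phi> (1/2) * \<psi> (-1/2) \<le> \<phi> (-1/2) * \<psi> (1/2)"
    using assms(1) by (simp add: lr_le_def level_spins_0)
  then show ?thesis using assms(2,3) by (simp add: divide_simps mult.commute)
qed

text \<open>The ratios decrease and stay above \<open>x^2\<close>. Three steps of message passing act as \<open>law_map\<close> on their
  square roots, so the root of the limit is a fixed point not below \<open>x\<close>, hence equal to the maximal one.\<close>

lemma msg_ratio_top_tendsto:
  assumes \<theta>: "\<theta> = exp (b / 2)" and b: "b \<ge> 0" and x: "x \<in> positive_fixpoints \<theta>"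
    and max: "\<And>y. y \<in> positive_fixpoints \<theta> \<Longrightarrow> y \<le> x"
  shows "(\<lambda>l. msg_ratio b level_top l) \<longlonglongrightarrow> x^2"
proof -
  let ?a = "msg_ratio b level_top"
  have pos: "msg b level_top (Suc l) 0 s > 0" for l s by (rule msg_pos) (rule level_top_in)
  have x0: "x > 0" using x by (simp add: positive_fixpoints_def)
  have ge: "x^2 \<le> ?a l" for l
    using lr_le_level_0[OF law_fn_lr_le_msg_top[OF \<theta> b x, of 0 "Suc l"] _ pos]
    by (simp add: msg_ratio_def law_fn_def del: msg.simps)
  have "decseq ?a"
    unfolding msg_ratio_def[abs_def]
    by (intro decseq_SucI lr_le_level_0[OF msg_top_antimono[OF b]] pos)
  then obtain L where L: "?a \<longlonglongrightarrow> L" using decseq_convergent[of ?a "x^2"] ge by blast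
  have "x^2 \<le> L" by (rule LIMSEQ_le_const[OF L]) (use ge in auto)
  have "x^2 > 0" using x0 by simp
  then have "L > 0" using \<open>x^2 \<le> L\<close> by linarith
  then have "sqrt L \<in> positive_fixpoints \<theta>"
    by (intro msg_ratio_limit_fixpoint[OF \<theta> _ level_top_periodic L] level_top_in)
  then have "sqrt L \<le> x" by (rule max)
  moreover have "x \<le> sqrt L" using \<open>x^2 \<le> L\<close> by (rule real_le_rsqrt)
  ultimately have "sqrt L = x" by simp
  then have "L = x^2" using \<open>L > 0\<close> real_sqrt_pow2[of L] by simp
  then show ?thesis using L by simp
qed

lemma msg_ratio_bot_tendsto:
  assumes \<theta>: "\<theta> = exp (b / 2)" and b: "b \<ge> 0" and x: "x \<in> positive_fixpoints \<theta>"
    and min: "\<And>y. y \<in> positive_fixpoints \<theta> \<Longrightarrow> x \<le> y"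
  shows "(\<lambda>l. msg_ratio b (\<lambda>i. - level_top i) l) \<longlonglongrightarrow> x^2"
proof -
  let ?z = "\<lambda>i. - level_top i"
  let ?a = "msg_ratio b ?z"
  have pos: "msg b ?z (Suc l) 0 s > 0" for l s by (rule msg_pos) (rule level_top_in)
  have x0: "x > 0" using x by (simp add: positive_fixpoints_def)
  have le: "?a l \<le> x^2" for l
    using lr_le_level_0[OF msg_bot_lr_le_law_fn[OF \<theta> b x, of 0 "Suc l"] pos]
    by (simp add: msg_ratio_def law_fn_def del: msg.simps)
  have inc: "incseq ?a"
    unfolding msg_ratio_def[abs_def]
    by (intro incseq_SucI lr_le_level_0[OF msg_bot_mono[OF b]] pos)
  then obtain L where L: "?a \<longlonglongrightarrow> L" using incseq_convergent[of ?a "x^2"] le by blast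
  have "L \<le> x^2" by (rule LIMSEQ_le_const2[OF L]) (use le in auto)
  have "?a 0 \<le> L" by (rule incseq_le[OF inc L])
  moreover have "?a 0 > 0" by (rule msg_ratio_pos) (rule level_top_in)
  ultimately have L0: "L > 0" by simp
  then have "sqrt L \<in> positive_fixpoints \<theta>"
    by (intro msg_ratio_limit_fixpoint[OF \<theta> _ _ L] level_top_in) (simp_all add: level_top_periodic)
  then have "x \<le> sqrt L" by (rule min)
  moreover have "sqrt L \<le> x" using \<open>L \<le> x^2\<close> x0 by (simp add: real_le_lsqrt)
  ultimately have "sqrt L = x" by simp
  then have "L = x^2" using L0 real_sqrt_pow2[of L] by simp
  then show ?thesis using L by simp
qed

lemma tendsto_ball_prob:
  assumes lim: "\<And>s. s \<in> level_spins m \<Longrightarrow> (\<lambda>l. \<phi> l s) \<longlonglongrightarrow> \<psi> s"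
    and pos: "\<And>s. s \<in> level_spins m \<Longrightarrow> \<psi> s > 0" and \<sigma>: "\<sigma> \<in> ball_configs m"
  shows "(\<lambda>l. ball_prob b m (\<phi> l) \<sigma>) \<longlonglongrightarrow> ball_prob b m \<psi> \<sigma>"
proof -
  have w: "(\<lambda>l. ball_weight b m (\<phi> l) \<tau>) \<longlonglongrightarrow> ball_weight b m \<psi> \<tau>" if "\<tau> \<in> ball_configs m" for \<tau>
    unfolding ball_weight_def
    by (intro tendsto_mult tendsto_const tendsto_prod lim ball_configs_sphere_spin[OF that])
  have "(\<Sum>\<tau>\<in>ball_configs m. ball_weight b m \<psi> \<tau>) > 0"
    using pos by (rule ball_weight_total_pos)
  then show ?thesis
    unfolding ball_prob_def using \<sigma> w by (intro tendsto_divide tendsto_sum) auto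
qed

lemma bc_cyl_tendsto:
  assumes \<theta>: "\<theta> = exp (\<beta> * J / 2)" and z: "\<And>i. z i \<in> level_spins i" and per: "\<And>i. z (i + 3) = z i"
    and \<zeta>: "\<And>v. \<zeta> v = z (length v)" and x: "x > 0"
    and lim: "(\<lambda>l. msg_ratio (\<beta> * J) z l) \<longlonglongrightarrow> x^2"
    and m: "3 dvd m" and \<sigma>: "\<sigma> \<in> ball_configs m"
  shows "(\<lambda>n. measure (bc_measure_ext \<beta> J \<zeta> n) (cyl m \<sigma>)) \<longlonglongrightarrow> ball_prob (\<beta> * J) m (law_fn \<theta> x m) \<sigma>"
proof (rule LIMSEQ_offset[where k = "Suc m"])
  let ?b = "\<beta> * J"
  let ?\<psi> = "\<lambda>X s. if s = 1/2 then X else (1 :: real)"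
  have conf: "\<zeta> \<in> configs" using z by (simp add: configs_iff \<zeta> spins_eq)
  have m0: "msg ?b z l (3 * k) = msg ?b z l 0" for l k
  proof (induction k)
    case (Suc k)
    then show ?case using msg_periodic[where z = z and b = ?b and l = l and i = "3 * k", OF per] by (simp add: algebra_simps del: msg.simps)
  qed simp
  have S: "level_spins m = {-1/2, 1/2}" using m by (auto simp: level_spins_def)
  have eq: "measure (bc_measure_ext \<beta> J \<zeta> (l + Suc m)) (cyl m \<sigma>) = ball_prob ?b m (?\<psi> (msg_ratio ?b z l)) \<sigma>" for l
  proof -
    have "measure (bc_measure_ext \<beta> J \<zeta> (m + Suc l)) (cyl m \<sigma>) = ball_prob ?b m (msg ?b z (Suc l) m) \<sigma>"
      by (rule bc_measure_ext_cyl[OF \<zeta> conf \<sigma>])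
    also have "msg ?b z (Suc l) m = msg ?b z (Suc l) 0"
      using m m0[of "Suc l"] by (auto simp del: msg.simps)
    also have "ball_prob ?b m \<dots> \<sigma> = ball_prob ?b m (?\<psi> (msg_ratio ?b z l)) \<sigma>"
    proof -
      have pos: "msg ?b z (Suc l) 0 (-1/2) > 0" by (rule msg_pos[OF z])
      then have "\<forall>s\<in>level_spins m. msg ?b z (Suc l) 0 s
          = msg ?b z (Suc l) 0 (-1/2) * ?\<psi> (msg_ratio ?b z l) s"
        by (simp add: S msg_ratio_def del: msg.simps)
      then show ?thesis using pos
        by (intro ball_prob_scale[where c = "msg ?b z (Suc l) 0 (-1/2)"] \<sigma>) auto
    qed
    finally show ?thesis by (simp add: add.commute)
  qed
  have "(\<lambda>l. ball_prob ?b m (?\<psi> (msg_ratio ?b z l)) \<sigma>) \<longlonglongrightarrow> ball_prob ?b m (?\<psi> (x^2)) \<sigma>"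
    using lim x by (intro tendsto_ball_prob \<sigma>) auto
  also have "ball_prob ?b m (?\<psi> (x^2)) \<sigma> = ball_prob ?b m (law_fn \<theta> x m) \<sigma>"
    using m by (intro ball_prob_scale[where c = 1] \<sigma>) (auto simp: law_fn_def)
  finally show "(\<lambda>l. measure (bc_measure_ext \<beta> J \<zeta> (l + Suc m)) (cyl m \<sigma>))
      \<longlonglongrightarrow> ball_prob ?b m (law_fn \<theta> x m) \<sigma>"
    unfolding eq .
qed

section \<open>Measures with prescribed cylinder probabilities\<close>

lemma consistent_sum:
  assumes cons: "\<And>n \<sigma>. \<sigma> \<in> ball_configs n \<Longrightarrow>
      (\<Sum>\<xi> | \<xi> \<in> ball_configs (Suc n) \<and> restrict \<xi> (ball_V n) = \<sigma>. P (Suc n) \<xi>) = P n \<sigma>"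
    and mn: "m \<le> n"
  shows "(\<Sum>\<xi>\<in>ball_configs n. P n \<xi> * G (restrict \<xi> (ball_V m)))
    = (\<Sum>\<tau>\<in>ball_configs m. P m \<tau> * (G \<tau> :: real))"
  using mn
proof (induction n rule: dec_induct)
  case base
  then show ?case by (intro sum.cong) (simp_all add: restrict_ball_configs)
next
  case (step n)
  have sub: "restrict (restrict \<xi> (ball_V n)) (ball_V m) = restrict \<xi> (ball_V m)" for \<xi> :: "vertex \<Rightarrow> real"
    using ball_V_mono[OF step.hyps(1)] by (simp add: Int_absorb1)
  have "(\<Sum>\<xi>\<in>ball_configs (Suc n). P (Suc n) \<xi> * G (restrict \<xi> (ball_V m)))
      = (\<Sum>\<sigma>\<in>ball_configs n. \<Sum>\<xi> | \<xi> \<in> ball_configs (Suc n) \<and> restrict \<xi> (ball_V n) = \<sigma>.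
          P (Suc n) \<xi> * G (restrict \<xi> (ball_V m)))"
    by (rule sum_ball_configs_group[symmetric]) simp
  also have "\<dots> = (\<Sum>\<sigma>\<in>ball_configs n. P n \<sigma> * G (restrict \<sigma> (ball_V m)))"
  proof (rule sum.cong[OF refl])
    fix \<sigma> assume \<sigma>: "\<sigma> \<in> ball_configs n"
    have "(\<Sum>\<xi> | \<xi> \<in> ball_configs (Suc n) \<and> restrict \<xi> (ball_V n) = \<sigma>. P (Suc n) \<xi> * G (restrict \<xi> (ball_V m)))
        = (\<Sum>\<xi> | \<xi> \<in> ball_configs (Suc n) \<and> restrict \<xi> (ball_V n) = \<sigma>. P (Suc n) \<xi> * G (restrict \<sigma> (ball_V m)))"
      using sub by (intro sum.cong) auto
    then show "(\<Sum>\<xi> | \<xi> \<in> ball_configs (Suc n) \<and> restrict \<xi> (ball_V n) = \<sigma>. P (Suc n) \<xi> * G (restrict \<xi> (ball_V m)))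
        = P n \<sigma> * G (restrict \<sigma> (ball_V m))"
      by (simp only: sum_distrib_right[symmetric] cons[OF \<sigma>])
  qed
  also have "\<dots> = (\<Sum>\<tau>\<in>ball_configs m. P m \<tau> * G \<tau>)" by (rule step.IH)
  finally show ?case .
qed

text \<open>Kolmogorov's extension theorem, applied to real-valued spins; the limit is transported to the
  configuration space by replacing impossible spin values.\<close>

lemma exists_config_measure:
  assumes nonneg: "\<And>n \<sigma>. \<sigma> \<in> ball_configs n \<Longrightarrow> P n \<sigma> \<ge> 0"
    and total: "\<And>n. (\<Sum>\<sigma>\<in>ball_configs n. P n \<sigma>) = (1 :: real)"
    and cons: "\<And>n \<sigma>. \<sigma> \<in> ball_configs n \<Longrightarrow>
      (\<Sum>\<xi> | \<xi> \<in> ball_configs (Suc n) \<and> restrict \<xi> (ball_V n) = \<sigma>. P (Suc n) \<xi>) = P n \<sigma>"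
  shows "\<exists>\<mu>. config_prob \<mu> \<and> (\<forall>n. \<forall>\<xi>\<in>ball_configs n. measure \<mu> (cyl n \<xi>) = P n \<xi>)"
proof -
  define N where "N A = (SOME n. A \<subseteq> ball_V n)" for A
  have N: "A \<subseteq> ball_V (N A)" if "finite A" for A
    unfolding N_def using finite_subset_ball_V[OF that] by (rule someI_ex)
  define Q where "Q n = point_measure (ball_configs n) (\<lambda>\<xi>. ennreal (P n \<xi>))" for n
  define R where "R A = distr (Q (N A)) (Pi\<^sub>M A (\<lambda>_. borel)) (\<lambda>\<omega>. restrict \<omega> A)" for A :: "vertex set"
  have meas: "(\<lambda>\<omega>. restrict \<omega> A) \<in> measurable (Q n) (Pi\<^sub>M A (\<lambda>_. borel :: real measure))" for A n
    unfolding Q_def by (auto simp: measurable_point_measure_eq1 space_PiM)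
  have distr_Q: "emeasure (distr (Q n) (Pi\<^sub>M A (\<lambda>_. borel)) (\<lambda>\<omega>. restrict \<omega> A)) B
      = ennreal (\<Sum>\<xi>\<in>ball_configs n. P n \<xi> * indicator B (restrict \<xi> A))"
    if "B \<in> sets (Pi\<^sub>M A (\<lambda>_. borel))" for A B n
  proof -
    have "emeasure (distr (Q n) (Pi\<^sub>M A (\<lambda>_. borel)) (\<lambda>\<omega>. restrict \<omega> A)) B
        = emeasure (Q n) {\<xi> \<in> ball_configs n. restrict \<xi> A \<in> B}"
      using meas that by (subst emeasure_distr)
        (auto simp: Q_def space_point_measure intro!: arg_cong[where f = "emeasure _"])
    also have "\<dots> = (\<Sum>\<xi> | \<xi> \<in> ball_configs n \<and> restrict \<xi> A \<in> B. ennreal (P n \<xi>))"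
      unfolding Q_def by (subst emeasure_point_measure_finite) auto
    also have "\<dots> = ennreal (\<Sum>\<xi> | \<xi> \<in> ball_configs n \<and> restrict \<xi> A \<in> B. P n \<xi>)"
      using nonneg by (intro sum_ennreal) simp
    also have "(\<Sum>\<xi> | \<xi> \<in> ball_configs n \<and> restrict \<xi> A \<in> B. P n \<xi>)
        = (\<Sum>\<xi>\<in>ball_configs n. P n \<xi> * indicator B (restrict \<xi> A))"
      by (intro sum.mono_neutral_cong_left) (auto simp: indicator_def)
    finally show ?thesis .
  qed
  have R: "emeasure (R A) B = ennreal (\<Sum>\<xi>\<in>ball_configs n. P n \<xi> * indicator B (restrict \<xi> A))"
    if A: "finite A" "A \<subseteq> ball_V n" and B: "B \<in> sets (Pi\<^sub>M A (\<lambda>_. borel))" for A B n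
  proof -
    have sub: "restrict (restrict \<xi> (ball_V k)) A = restrict \<xi> A" if "A \<subseteq> ball_V k" for k and \<xi> :: "vertex \<Rightarrow> real"
      using that by (simp add: Int_absorb1)
    have "(\<Sum>\<xi>\<in>ball_configs j. P j \<xi> * indicator B (restrict \<xi> A))
        = (\<Sum>\<xi>\<in>ball_configs k. P k \<xi> * indicator B (restrict \<xi> A))"
      if "j \<le> k" "A \<subseteq> ball_V j" for j k
    proof -
      have "(\<Sum>\<xi>\<in>ball_configs k. P k \<xi> * indicator B (restrict (restrict \<xi> (ball_V j)) A))
          = (\<Sum>\<tau>\<in>ball_configs j. P j \<tau> * indicator B (restrict \<tau> A))"
        using cons that(1) by (rule consistent_sum[where G = "\<lambda>\<tau>. indicator B (restrict \<tau> A)"])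
      then show ?thesis by (simp only: sub[OF that(2)])
    qed
    note mono = this
    have "(\<Sum>\<xi>\<in>ball_configs (N A). P (N A) \<xi> * indicator B (restrict \<xi> A))
        = (\<Sum>\<xi>\<in>ball_configs n. P n \<xi> * indicator B (restrict \<xi> A))"
    proof (cases "N A \<le> n")
      case True
      then show ?thesis by (rule mono[OF _ N[OF A(1)]])
    next
      case False
      then have "n \<le> N A" by simp
      then show ?thesis by (rule mono[OF _ A(2), symmetric])
    qed
    then show ?thesis unfolding R_def distr_Q[OF B] by simp
  qed
  interpret polish_projective UNIV R
  proof (intro polish_projective.intro projective_family.intro)
    fix A H :: "vertex set" assume AH: "A \<subseteq> H" "finite H"
    show "R A = distr (R H) (Pi\<^sub>M A (\<lambda>_. borel)) (\<lambda>f. restrict f A)"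
    proof (rule measure_eqI)
      show "sets (R A) = sets (distr (R H) (Pi\<^sub>M A (\<lambda>_. borel)) (\<lambda>f. restrict f A))"
        by (simp add: R_def)
      fix B assume "B \<in> sets (R A)"
      then have B: "B \<in> sets (Pi\<^sub>M A (\<lambda>_. borel))" by (simp add: R_def)
      have m: "(\<lambda>f. restrict f A) \<in> measurable (Pi\<^sub>M H (\<lambda>_. borel :: real measure)) (Pi\<^sub>M A (\<lambda>_. borel))"
        using AH(1) by (rule measurable_restrict_subset)
      let ?B = "(\<lambda>f. restrict f A) -` B \<inter> space (Pi\<^sub>M H (\<lambda>_. borel :: real measure))"
      have "emeasure (distr (R H) (Pi\<^sub>M A (\<lambda>_. borel)) (\<lambda>f. restrict f A)) B = emeasure (R H) ?B"
        using m B by (subst emeasure_distr) (auto simp: R_def)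
      also have "\<dots> = ennreal (\<Sum>\<xi>\<in>ball_configs (N H). P (N H) \<xi> * indicator ?B (restrict \<xi> H))"
        by (rule R[OF AH(2) N[OF AH(2)] measurable_sets[OF m B]])
      also have "(\<Sum>\<xi>\<in>ball_configs (N H). P (N H) \<xi> * indicator ?B (restrict \<xi> H))
          = (\<Sum>\<xi>\<in>ball_configs (N H). P (N H) \<xi> * indicator B (restrict \<xi> A))"
        using AH(1) by (intro sum.cong) (auto simp: indicator_def space_PiM Int_absorb1)
      also have "ennreal \<dots> = emeasure (R A) B"
        using AH N[OF AH(2)] by (intro R[symmetric] B) (auto intro: finite_subset)
      finally show "emeasure (R A) B = emeasure (distr (R H) (Pi\<^sub>M A (\<lambda>_. borel)) (\<lambda>f. restrict f A)) B" ..
    qed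
  next
    fix A :: "vertex set" assume A: "finite A"
    have "emeasure (R A) (space (Pi\<^sub>M A (\<lambda>_. borel))) = 1"
      unfolding R[OF A N[OF A] sets.top] using total by (simp add: space_PiM)
    then show "prob_space (R A)" by (intro prob_spaceI) (simp add: R_def)
  qed
  define h where "h x r = (if r \<in> spins x then r else config_plus x)" for x r
  have h_meas: "h x \<in> measurable borel (count_space (spins x))" for x
  proof -
    have "h x -` {a} = (if a = config_plus x then {a} \<union> - spins x else {a})" if "a \<in> spins x" for a
      using that by (auto simp: h_def)
    then show ?thesis
      by (subst measurable_count_space_eq2) (auto simp: h_def finite_imp_closed intro!: borel_closed borel_comp)
  qed
  let ?c = "\<lambda>\<omega> x. h x (\<omega> x)"
  have c_meas: "?c \<in> measurable lim config_algebra"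
    unfolding config_algebra_def
  proof (rule measurable_PiM_single')
    fix x
    have "(\<lambda>\<omega>. \<omega> x) \<in> measurable lim (borel :: real measure)"
      unfolding measurable_cong_sets[OF sets_lim refl] by (rule measurable_component_singleton) simp
    then show "(\<lambda>\<omega>. h x (\<omega> x)) \<in> measurable lim (count_space (spins x))"
      using h_meas by (rule measurable_compose)
  qed (auto simp: h_def)
  define \<mu> where "\<mu> = distr lim config_algebra ?c"
  have "config_prob \<mu>"
    unfolding config_prob_def \<mu>_def using P.prob_space_distr[OF c_meas] by simp
  moreover have "measure \<mu> (cyl n \<xi>) = P n \<xi>" if \<xi>: "\<xi> \<in> ball_configs n" for n \<xi>
  proof -
    let ?B = "{\<tau> \<in> space (Pi\<^sub>M (ball_V n) (\<lambda>_. borel :: real measure)). \<forall>x\<in>ball_V n. h x (\<tau> x) = \<xi> x}"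
    have B: "?B \<in> sets (Pi\<^sub>M (ball_V n) (\<lambda>_. borel))"
    proof -
      have "{\<tau> \<in> space (Pi\<^sub>M (ball_V n) (\<lambda>_. borel :: real measure)). h x (\<tau> x) = \<xi> x}
          \<in> sets (Pi\<^sub>M (ball_V n) (\<lambda>_. borel))" if "x \<in> ball_V n" for x
      proof -
        have "(\<lambda>\<tau>. h x (\<tau> x)) \<in> measurable (Pi\<^sub>M (ball_V n) (\<lambda>_. borel)) (count_space (spins x))"
          using that by (intro measurable_compose[OF _ h_meas] measurable_component_singleton)
        then have "(\<lambda>\<tau>. h x (\<tau> x)) -` {\<xi> x} \<inter> space (Pi\<^sub>M (ball_V n) (\<lambda>_. borel)) \<in> sets (Pi\<^sub>M (ball_V n) (\<lambda>_. borel))"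
          by (rule measurable_sets) (use ball_configs_spin[OF \<xi> that] in simp)
        then show ?thesis by (simp add: vimage_def Int_def conj_commute)
      qed
      then show ?thesis by (intro sets.sets_Collect_finite_All) auto
    qed
    have "?c -` cyl n \<xi> \<inter> space lim = prod_emb UNIV (\<lambda>_. borel) (ball_V n) ?B"
    proof -
      have "?c \<omega> \<in> cyl n \<xi> \<longleftrightarrow> (\<forall>x\<in>ball_V n. h x (\<omega> x) = \<xi> x)" for \<omega>
      proof -
        have "?c \<omega> \<in> configs" by (simp add: configs_iff h_def)
        moreover have "\<xi> \<in> extensional (ball_V n)" using \<xi> by (simp add: ball_configs_def PiE_def)
        ultimately show ?thesis by (auto simp: cyl_iff fun_eq_iff restrict_def extensional_def)
      qed
      then show ?thesis by (auto simp: prod_emb_def space_PiM)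
    qed
    then have "measure \<mu> (cyl n \<xi>) = measure (R (ball_V n)) ?B"
      unfolding \<mu>_def using measure_lim_emb[of "ball_V n" ?B] B c_meas
      by (subst measure_distr) (auto simp: cyl_sets)
    also have "\<dots> = (\<Sum>\<tau>\<in>ball_configs n. P n \<tau> * indicator ?B (restrict \<tau> (ball_V n)))"
      unfolding measure_def R[OF finite_ball_V subset_refl B]
      using nonneg by (intro enn2real_ennreal sum_nonneg) auto
    also have "\<dots> = (\<Sum>\<tau>\<in>ball_configs n. if \<tau> = \<xi> then P n \<tau> else 0)"
    proof (rule sum.cong[OF refl])
      fix \<tau> assume \<tau>: "\<tau> \<in> ball_configs n"
      have "(\<forall>x\<in>ball_V n. h x (\<tau> x) = \<xi> x) \<longleftrightarrow> (\<forall>x\<in>ball_V n. \<tau> x = \<xi> x)"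
        using ball_configs_spin[OF \<tau>] by (simp add: h_def)
      also have "\<dots> \<longleftrightarrow> \<tau> = \<xi>"
        using \<tau> \<xi> unfolding ball_configs_def by (metis PiE_ext)
      finally have "(\<forall>x\<in>ball_V n. h x (\<tau> x) = \<xi> x) \<longleftrightarrow> \<tau> = \<xi>" .
      moreover have "\<tau> \<in> space (Pi\<^sub>M (ball_V n) (\<lambda>_. borel :: real measure))"
        using \<tau> by (auto simp: space_PiM ball_configs_def PiE_def)
      ultimately show "P n \<tau> * indicator ?B (restrict \<tau> (ball_V n)) = (if \<tau> = \<xi> then P n \<tau> else 0)"
        by (simp add: restrict_ball_configs[OF \<tau>] indicator_def)
    qed
    also have "\<dots> = P n \<xi>" using \<xi> by simp
    finally show ?thesis .
  qed
  ultimately show ?thesis by blast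
qed

section \<open>Gibbs measures from boundary laws\<close>

lemma ball_prob_consistent:
  assumes \<sigma>: "\<sigma> \<in> ball_configs n"
  shows "(\<Sum>\<xi> | \<xi> \<in> ball_configs (Suc n) \<and> restrict \<xi> (ball_V n) = \<sigma>. ball_prob b (Suc n) \<phi> \<xi>)
    = ball_prob b n (pass b (level_spins (Suc n)) \<phi>) \<sigma>"
proof -
  have "(\<Sum>\<xi>\<in>ball_configs (Suc n). ball_weight b (Suc n) \<phi> \<xi>)
      = (\<Sum>\<tau>\<in>ball_configs n. ball_weight b n (pass b (level_spins (Suc n)) \<phi>) \<tau>)"
    unfolding sum_ball_configs_group[of n "Suc n", symmetric, OF le_SucI[OF le_refl]]
    by (rule sum.cong) (simp_all add: ball_weight_integrate_sphere)
  then show ?thesis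
    unfolding ball_prob_def sum_divide_distrib[symmetric] ball_weight_integrate_sphere[OF \<sigma>] by simp
qed

text \<open>Edges that miss \<open>\<Lambda>\<close> and the boundary sphere contribute a factor \<open>r\<close> that does not depend on the spins in
  \<open>\<Lambda>\<close>.\<close>

lemma ball_weight_split:
  assumes \<Lambda>: "\<Lambda> \<subseteq> ball_V n"
  shows "\<exists>r. \<forall>\<sigma>. ball_weight (\<beta> * J) (Suc n) \<phi> (override_on \<xi> \<sigma> \<Lambda>)
    = spec_weight \<beta> J \<Lambda> (override_on \<xi> \<sigma> \<Lambda>) * r"
proof (intro exI allI)
  fix \<sigma>
  let ?o = "override_on \<xi> \<sigma> \<Lambda>"
  let ?V = "ball_V (Suc n) - {[]}"
  have sub: "edge_tops \<Lambda> \<subseteq> ?V" using \<Lambda> by (auto simp: edge_tops_def ball_V_eq)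
  have "(\<Sum>y\<in>?V. ?o (tl y) * ?o y)
      = (\<Sum>y\<in>?V - edge_tops \<Lambda>. ?o (tl y) * ?o y) + (\<Sum>y\<in>edge_tops \<Lambda>. ?o (tl y) * ?o y)"
    by (rule sum.subset_diff[OF sub]) simp
  also have "(\<Sum>y\<in>?V - edge_tops \<Lambda>. ?o (tl y) * ?o y) = (\<Sum>y\<in>?V - edge_tops \<Lambda>. \<xi> (tl y) * \<xi> y)"
    by (rule sum.cong) (auto simp: edge_tops_def override_on_def)
  finally have e: "(\<Sum>y\<in>?V. ?o (tl y) * ?o y)
      = (\<Sum>y\<in>?V - edge_tops \<Lambda>. \<xi> (tl y) * \<xi> y) + (\<Sum>y\<in>edge_tops \<Lambda>. ?o (tl y) * ?o y)" .
  have "(\<Prod>x\<in>sphere_W (Suc n). \<phi> (?o x)) = (\<Prod>x\<in>sphere_W (Suc n). \<phi> (\<xi> x))"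
    using \<Lambda> ball_sphere_disjoint[of n] by (intro prod.cong) (auto simp: override_on_def)
  then show "ball_weight (\<beta> * J) (Suc n) \<phi> ?o = spec_weight \<beta> J \<Lambda> ?o *
      (exp (\<beta> * J * (\<Sum>y\<in>?V - edge_tops \<Lambda>. \<xi> (tl y) * \<xi> y)) * (\<Prod>x\<in>sphere_W (Suc n). \<phi> (\<xi> x)))"
    unfolding ball_weight_def e spec_weight_eq by (simp add: distrib_left exp_add)
qed

text \<open>Only one spin configuration in \<open>\<Lambda>\<close> leads into the cylinder, and only if the boundary condition agrees
  with \<open>\<xi>\<close> on the rest of the ball.\<close>

lemma gibbs_spec_cyl:
  assumes fin: "finite \<Lambda>" and \<Lambda>: "\<Lambda> \<subseteq> ball_V n" and \<xi>: "\<xi> \<in> ball_configs (Suc n)" and \<eta>: "\<eta> \<in> configs"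
  shows "gibbs_spec \<beta> J \<Lambda> \<eta> (cyl (Suc n) \<xi>) =
    (if \<forall>x\<in>ball_V (Suc n) - \<Lambda>. \<eta> x = \<xi> x
     then spec_weight \<beta> J \<Lambda> \<xi> / (\<Sum>\<sigma>\<in>(\<Pi>\<^sub>E x\<in>\<Lambda>. spins x). spec_weight \<beta> J \<Lambda> (override_on \<xi> \<sigma> \<Lambda>)) else 0)"
proof -
  let ?P = "\<Pi>\<^sub>E x\<in>\<Lambda>. spins x" and ?W = "spec_weight \<beta> J \<Lambda>"
  have \<Lambda>': "\<Lambda> \<subseteq> ball_V (Suc n)" using \<Lambda> ball_V_mono[of n "Suc n"] by auto
  have edges: "y \<in> ball_V (Suc n)" "tl y \<in> ball_V (Suc n)" if "y \<in> edge_tops \<Lambda>" for y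
    using that \<Lambda> by (auto simp: edge_tops_def ball_V_eq)
  have W_cong: "?W \<zeta> = ?W \<zeta>'" if "\<And>x. x \<in> ball_V (Suc n) \<Longrightarrow> \<zeta> x = \<zeta>' x" for \<zeta> \<zeta>'
    unfolding spec_weight_eq
    by (intro arg_cong[where f = exp] arg_cong[where f = "(*) _"] sum.cong) (simp_all add: edges that)
  have ext: "\<xi> \<in> extensional (ball_V (Suc n))" using \<xi> by (simp add: ball_configs_def PiE_def)
  have cyl_o: "override_on \<eta> \<sigma> \<Lambda> \<in> cyl (Suc n) \<xi> \<longleftrightarrow> (\<forall>x\<in>ball_V (Suc n). override_on \<eta> \<sigma> \<Lambda> x = \<xi> x)"
    if "\<sigma> \<in> ?P" for \<sigma>
    using override_in_configs[OF \<eta> that] ext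
    by (auto simp: cyl_iff fun_eq_iff restrict_def extensional_def)
  show ?thesis
  proof (cases "\<forall>x\<in>ball_V (Suc n) - \<Lambda>. \<eta> x = \<xi> x")
    case True
    have r: "restrict \<xi> \<Lambda> \<in> ?P" using ball_configs_spin[OF \<xi>] \<Lambda>' by auto
    have "override_on \<eta> \<sigma> \<Lambda> \<in> cyl (Suc n) \<xi> \<longleftrightarrow> \<sigma> = restrict \<xi> \<Lambda>" if "\<sigma> \<in> ?P" for \<sigma>
    proof -
      have "(\<forall>x\<in>ball_V (Suc n). override_on \<eta> \<sigma> \<Lambda> x = \<xi> x) \<longleftrightarrow> (\<forall>x\<in>\<Lambda>. \<sigma> x = \<xi> x)"
        using True \<Lambda>' by (auto simp: override_on_def)
      also have "\<dots> \<longleftrightarrow> \<sigma> = restrict \<xi> \<Lambda>"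
        using that by (auto simp: fun_eq_iff restrict_def PiE_def extensional_def)
      finally show ?thesis using cyl_o[OF that] by simp
    qed
    then have "(\<Sum>\<sigma>\<in>?P. ?W (override_on \<eta> \<sigma> \<Lambda>) * indicator (cyl (Suc n) \<xi>) (override_on \<eta> \<sigma> \<Lambda>))
        = (\<Sum>\<sigma>\<in>?P. if \<sigma> = restrict \<xi> \<Lambda> then ?W (override_on \<eta> \<sigma> \<Lambda>) else 0)"
      by (intro sum.cong) (auto simp: indicator_def)
    also have "\<dots> = ?W (override_on \<eta> (restrict \<xi> \<Lambda>) \<Lambda>)"
      using r finite_PiE_spins[OF fin] by simp
    also have "\<dots> = ?W \<xi>"
      using True by (intro W_cong) (auto simp: override_on_def)
    finally have num: "(\<Sum>\<sigma>\<in>?P. ?W (override_on \<eta> \<sigma> \<Lambda>) * indicator (cyl (Suc n) \<xi>) (override_on \<eta> \<sigma> \<Lambda>)) = ?W \<xi>" .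
    have "?W (override_on \<eta> \<sigma> \<Lambda>) = ?W (override_on \<xi> \<sigma> \<Lambda>)" for \<sigma>
      using True by (intro W_cong) (auto simp: override_on_def)
    then show ?thesis using True unfolding gibbs_spec_def num by simp
  next
    case False
    then have "override_on \<eta> \<sigma> \<Lambda> \<notin> cyl (Suc n) \<xi>" if "\<sigma> \<in> ?P" for \<sigma>
      unfolding cyl_o[OF that] by (auto simp: override_on_def)
    then show ?thesis using False unfolding gibbs_spec_def by auto
  qed
qed

lemma gibbs_spec_nonneg: "finite \<Lambda> \<Longrightarrow> gibbs_spec \<beta> J \<Lambda> \<eta> A \<ge> 0"
  unfolding gibbs_spec_def using spec_partition_pos[of \<Lambda> \<beta> J \<eta>]
  by (intro divide_nonneg_nonneg sum_nonneg) (auto simp: less_imp_le)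

lemma gibbs_spec_measurable:
  assumes fin: "finite \<Lambda>" and A: "A \<in> sets config_algebra"
  shows "(\<lambda>\<eta>. gibbs_spec \<beta> J \<Lambda> \<eta> A) \<in> borel_measurable config_algebra"
proof -
  have o: "(\<lambda>\<eta>. override_on \<eta> \<sigma> \<Lambda>) \<in> measurable config_algebra config_algebra"
    if "\<sigma> \<in> (\<Pi>\<^sub>E x\<in>\<Lambda>. spins x)" for \<sigma>
  proof -
    have "(\<lambda>\<eta>. override_on \<eta> \<sigma> \<Lambda> x) \<in> measurable config_algebra (count_space (spins x))" for x
    proof (cases "x \<in> \<Lambda>")
      case True
      then have "\<sigma> x \<in> spins x" using that by auto
      then show ?thesis using True by (simp add: override_on_def)
    next
      case False
      then show ?thesis by (simp add: override_on_def)
    qed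
    moreover have "override_on \<eta> \<sigma> \<Lambda> \<in> configs" if "\<eta> \<in> configs" for \<eta>
      using override_in_configs[OF that \<open>\<sigma> \<in> _\<close>] .
    ultimately show ?thesis
      unfolding config_algebra_def[of]
      by (intro measurable_PiM_single') (auto simp: config_algebra_def[symmetric] configs_def)
  qed
  have W: "(\<lambda>\<xi>. spec_weight \<beta> J \<Lambda> \<xi>) \<in> borel_measurable config_algebra"
    unfolding spec_weight_eq by measurable
  show ?thesis
    unfolding gibbs_spec_def
    by (intro borel_measurable_divide borel_measurable_sum borel_measurable_times
        measurable_compose[OF o W] measurable_compose[OF o borel_measurable_indicator[OF A]])
qed

text \<open>The mixture of the specification over \<open>\<mu>\<close> is a measure, so it suffices to compare it with \<open>\<mu>\<close> on
  large cylinders. There, summing out \<open>\<Lambda>\<close> cancels all factors of the weight that do not involve \<open>\<Lambda>\<close>.\<close>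

lemma gibbs_of_boundary_law:
  assumes \<mu>: "config_prob \<mu>"
    and pos: "\<And>n s. s \<in> level_spins n \<Longrightarrow> g n s > 0"
    and marg: "\<And>n \<xi>. \<xi> \<in> ball_configs n \<Longrightarrow> measure \<mu> (cyl n \<xi>) = ball_prob (\<beta> * J) n (g n) \<xi>"
  shows "gibbs_measure \<beta> J \<mu>"
  unfolding gibbs_measure_def
proof (intro conjI \<mu> allI impI)
  fix \<Lambda> :: "vertex set" and A assume fin: "finite \<Lambda>" and A: "A \<in> sets config_algebra"
  interpret prob_space \<mu> using \<mu> by (simp add: config_prob_def)
  have sets_\<mu>: "sets \<mu> = sets config_algebra" using \<mu> by (simp add: config_prob_def)
  have sp: "space \<mu> = configs" by (rule config_prob_space[OF \<mu>])
  let ?K = "\<lambda>\<eta> A. gibbs_spec \<beta> J \<Lambda> \<eta> A"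
  have K_meas: "(\<lambda>\<eta>. ?K \<eta> A) \<in> borel_measurable \<mu>" if "A \<in> sets config_algebra" for A
    using gibbs_spec_measurable[OF fin that] sets_\<mu> by (simp cong: measurable_cong_sets)
  have K_one: "?K \<eta> configs = 1" if "\<eta> \<in> configs" for \<eta>
  proof -
    have "?K \<eta> configs = spec_expect \<beta> J \<Lambda> \<eta> (\<lambda>_. 1)"
      unfolding gibbs_spec_eq by (rule spec_expect_cong[OF that]) simp
    then show ?thesis by (simp add: spec_expect_const[OF fin])
  qed
  have K_le: "?K \<eta> A \<le> 1" if "\<eta> \<in> configs" for \<eta> A
  proof -
    have "?K \<eta> A \<le> ?K \<eta> configs"
      unfolding gibbs_spec_def using spec_partition_pos[OF fin, of \<beta> J \<eta>] override_in_configs[OF that]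
      by (intro divide_right_mono sum_mono) (auto simp: less_imp_le indicator_def)
    then show ?thesis by (simp add: K_one[OF that])
  qed
  have K_int: "integrable \<mu> (\<lambda>\<eta>. ?K \<eta> A)" if "A \<in> sets config_algebra" for A
    using K_meas[OF that] K_le gibbs_spec_nonneg[OF fin, of \<beta> J]
    by (intro integrable_const_bound[where B = 1]) (auto simp: sp)
  define N where "N = measure_of configs (sets config_algebra) (\<lambda>A. \<integral>\<^sup>+\<eta>. ennreal (?K \<eta> A) \<partial>\<mu>)"
  have N: "emeasure N A = (\<integral>\<^sup>+\<eta>. ennreal (?K \<eta> A) \<partial>\<mu>)" if "A \<in> sets config_algebra" for A
    unfolding N_def
  proof (rule emeasure_measure_of_sigma[OF _ _ _ that])
    show "sigma_algebra configs (sets config_algebra)"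
      using sets.sigma_algebra_axioms[of config_algebra] by simp
    show "positive (sets config_algebra) (\<lambda>A. \<integral>\<^sup>+\<eta>. ennreal (?K \<eta> A) \<partial>\<mu>)"
      by (simp add: positive_def gibbs_spec_def)
    show "countably_additive (sets config_algebra) (\<lambda>A. \<integral>\<^sup>+\<eta>. ennreal (?K \<eta> A) \<partial>\<mu>)"
      unfolding countably_additive_def
    proof (intro allI impI)
      fix B :: "nat \<Rightarrow> (vertex \<Rightarrow> real) set"
      assume B: "range B \<subseteq> sets config_algebra" and disj: "disjoint_family B"
      have sums: "(\<lambda>i. ?K \<eta> (B i)) sums ?K \<eta> (\<Union>i. B i)" for \<eta>
        unfolding gibbs_spec_def using disj
        by (intro sums_divide sums_sum sums_mult indicator_sums) (auto simp: disjoint_family_on_def)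
      have "(\<Sum>i. \<integral>\<^sup>+\<eta>. ennreal (?K \<eta> (B i)) \<partial>\<mu>) = (\<integral>\<^sup>+\<eta>. (\<Sum>i. ennreal (?K \<eta> (B i))) \<partial>\<mu>)"
        using B K_meas by (intro nn_integral_suminf[symmetric]) auto
      also have "\<dots> = (\<integral>\<^sup>+\<eta>. ennreal (?K \<eta> (\<Union>i. B i)) \<partial>\<mu>)"
        using sums gibbs_spec_nonneg[OF fin, of \<beta> J]
        by (intro nn_integral_cong) (simp add: suminf_ennreal_eq)
      finally show "(\<Sum>i. \<integral>\<^sup>+\<eta>. ennreal (?K \<eta> (B i)) \<partial>\<mu>) = (\<integral>\<^sup>+\<eta>. ennreal (?K \<eta> (\<Union>i. B i)) \<partial>\<mu>)" .
    qed
  qed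
  have N_real: "measure N A = (\<integral>\<eta>. ?K \<eta> A \<partial>\<mu>)" if "A \<in> sets config_algebra" for A
    unfolding measure_def N[OF that] using K_int[OF that] gibbs_spec_nonneg[OF fin, of \<beta> J]
    by (simp add: nn_integral_eq_integral)
  have sets_N: "sets N = sets config_algebra"
    using sets.sigma_sets_eq[of config_algebra] sets.space_closed[of config_algebra]
    unfolding N_def by (subst sets_measure_of) auto
  have N_prob: "config_prob N"
  proof -
    have "configs \<in> sets config_algebra" using sets.top[of config_algebra] by simp
    then have "emeasure N configs = (\<integral>\<^sup>+\<eta>. ennreal (?K \<eta> configs) \<partial>\<mu>)" by (rule N)
    also have "\<dots> = (\<integral>\<^sup>+\<eta>. 1 \<partial>\<mu>)" by (rule nn_integral_cong) (simp add: sp K_one)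
    finally have "emeasure N (space N) = 1"
      using emeasure_space_1 sets_eq_imp_space_eq[OF sets_N] by simp
    then show ?thesis using sets_N by (simp add: config_prob_def prob_spaceI)
  qed
  obtain n\<^sub>0 where n\<^sub>0: "\<Lambda> \<subseteq> ball_V n\<^sub>0" using finite_subset_ball_V[OF fin] by blast
  have "\<mu> = N"
  proof (rule config_prob_eqI_eventually[OF \<mu> N_prob])
    fix n \<xi> assume n: "Suc n\<^sub>0 \<le> n" and \<xi>: "\<xi> \<in> ball_configs n"
    obtain k where k: "n = Suc k" "n\<^sub>0 \<le> k" using n by (cases n) auto
    have \<Lambda>: "\<Lambda> \<subseteq> ball_V k" using n\<^sub>0 ball_V_mono[OF k(2)] by blast
    then have \<Lambda>': "\<Lambda> \<subseteq> ball_V n" using ball_V_mono[of k n] k by auto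
    let ?P = "\<Pi>\<^sub>E x\<in>\<Lambda>. spins x" and ?W = "spec_weight \<beta> J \<Lambda>"
    let ?Z = "\<Sum>\<sigma>\<in>?P. ?W (override_on \<xi> \<sigma> \<Lambda>)"
    let ?w = "ball_weight (\<beta> * J) n (g n)"
    let ?S = "{\<tau> \<in> ball_configs n. \<forall>x\<in>ball_V n - \<Lambda>. \<tau> x = \<xi> x}"
    let ?\<psi> = "\<lambda>\<tau>. if \<forall>x\<in>ball_V n - \<Lambda>. \<tau> x = \<xi> x then ?W \<xi> / ?Z else 0"
    have Z: "?Z > 0" by (rule spec_partition_pos[OF fin])
    obtain r where r: "\<And>\<sigma>. ?w (override_on \<xi> \<sigma> \<Lambda>) = ?W (override_on \<xi> \<sigma> \<Lambda>) * r"
      using ball_weight_split[OF \<Lambda>, of \<beta> J "g n" \<xi>] k by blast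
    have "(\<Sum>\<tau>\<in>?S. ?w \<tau>) = (\<Sum>\<sigma>\<in>?P. ?w (override_on \<xi> \<sigma> \<Lambda>))"
    proof (rule sum.reindex_bij_witness[where i = "\<lambda>\<sigma>. override_on \<xi> \<sigma> \<Lambda>" and j = "\<lambda>\<tau>. restrict \<tau> \<Lambda>"])
      fix \<tau> assume \<tau>: "\<tau> \<in> ?S"
      show eq: "override_on \<xi> (restrict \<tau> \<Lambda>) \<Lambda> = \<tau>"
      proof
        fix x show "override_on \<xi> (restrict \<tau> \<Lambda>) \<Lambda> x = \<tau> x"
          using \<tau> \<xi> by (cases "x \<in> ball_V n") (auto simp: override_on_def ball_configs_def PiE_def extensional_def)
      qed
      show "restrict \<tau> \<Lambda> \<in> ?P" using \<tau> \<Lambda>' ball_configs_spin[of \<tau> n] by auto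
      show "?w (override_on \<xi> (restrict \<tau> \<Lambda>) \<Lambda>) = ?w \<tau>" unfolding eq ..
    next
      fix \<sigma> assume \<sigma>: "\<sigma> \<in> ?P"
      show "restrict (override_on \<xi> \<sigma> \<Lambda>) \<Lambda> = \<sigma>"
        using \<sigma> by (auto simp: override_on_def fun_eq_iff restrict_def PiE_def extensional_def)
      have "override_on \<xi> \<sigma> \<Lambda> \<in> ball_configs n"
        using \<sigma> \<xi> \<Lambda>' by (auto simp: override_on_def ball_configs_def PiE_def Pi_def extensional_def)
      then show "override_on \<xi> \<sigma> \<Lambda> \<in> ?S" by (auto simp: override_on_def)
    qed
    then have sum_S: "(\<Sum>\<tau>\<in>?S. ?w \<tau>) = ?Z * r"
      unfolding r sum_distrib_right[symmetric] .
    have w\<xi>: "?w \<xi> = ?W \<xi> * r"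
      using r[of \<xi>] by (simp add: override_on_def)
    have "measure N (cyl n \<xi>) = (\<integral>\<eta>. ?K \<eta> (cyl n \<xi>) \<partial>\<mu>)" by (rule N_real[OF cyl_sets])
    also have "\<dots> = ball_expect n ?\<psi> \<mu>"
    proof (rule has_bochner_integral_integral_eq[OF has_integral_local[OF \<mu>]])
      fix \<eta> assume "\<eta> \<in> configs"
      then show "?K \<eta> (cyl n \<xi>) = ?\<psi> (restrict \<eta> (ball_V n))"
        using gibbs_spec_cyl[OF fin \<Lambda>, of \<xi> \<eta> \<beta> J] \<xi> k by auto
    qed
    also have "\<dots> = (\<Sum>\<tau>\<in>?S. ?W \<xi> / ?Z * ball_prob (\<beta> * J) n (g n) \<tau>)"
      unfolding ball_expect_def by (rule sum.mono_neutral_cong_right) (auto simp: marg)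
    also have "\<dots> = ?W \<xi> / ?Z * ((\<Sum>\<tau>\<in>?S. ?w \<tau>) / (\<Sum>\<tau>\<in>ball_configs n. ?w \<tau>))"
      unfolding ball_prob_def by (simp add: sum_distrib_left[symmetric] sum_divide_distrib[symmetric])
    also have "\<dots> = ball_prob (\<beta> * J) n (g n) \<xi>"
      unfolding sum_S ball_prob_def w\<xi> using Z by simp
    also have "\<dots> = measure \<mu> (cyl n \<xi>)" by (rule marg[OF \<xi>, symmetric])
    finally show "measure \<mu> (cyl n \<xi>) = measure N (cyl n \<xi>)" ..
  qed
  then show "measure \<mu> A = (\<integral>\<eta>. ?K \<eta> A \<partial>\<mu>)" using N_real[OF A] by simp
qed

section \<open>Translation-invariant splitting Gibbs measures\<close>

lemma law_ball_prob_consistent: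
  assumes \<theta>: "\<theta> = exp (b / 2)" and x: "x \<in> positive_fixpoints \<theta>" and \<sigma>: "\<sigma> \<in> ball_configs n"
  shows "(\<Sum>\<xi> | \<xi> \<in> ball_configs (Suc n) \<and> restrict \<xi> (ball_V n) = \<sigma>. ball_prob b (Suc n) (law_fn \<theta> x (Suc n)) \<xi>)
    = ball_prob b n (law_fn \<theta> x n) \<sigma>"
proof -
  obtain c where "c > 0" "\<And>s. s \<in> level_spins n \<Longrightarrow>
      pass b (level_spins (Suc n)) (law_fn \<theta> x (Suc n)) s = c * law_fn \<theta> x n s"
    using pass_law_fn_fixpoint[OF \<theta> x, of n] by blast
  then show ?thesis
    unfolding ball_prob_consistent[OF \<sigma>] by (intro ball_prob_scale[where c = c] \<sigma>) auto
qed

lemma exists_law_measure: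
  assumes \<theta>: "\<theta> = exp (b / 2)" and x: "x \<in> positive_fixpoints \<theta>"
  shows "\<exists>\<mu>. config_prob \<mu> \<and> (\<forall>n. \<forall>\<xi>\<in>ball_configs n. measure \<mu> (cyl n \<xi>) = ball_prob b n (law_fn \<theta> x n) \<xi>)"
proof (rule exists_config_measure)
  have pos: "law_fn \<theta> x n s > 0" for n s
    using x by (intro law_fn_pos) (auto simp: \<theta> positive_fixpoints_def)
  show "0 \<le> ball_prob b n (law_fn \<theta> x n) \<sigma>" if "\<sigma> \<in> ball_configs n" for n \<sigma>
    unfolding ball_prob_def using ball_weight_pos[OF pos that] ball_weight_total_pos[OF pos]
    by (simp add: less_imp_le)
  show "(\<Sum>\<sigma>\<in>ball_configs n. ball_prob b n (law_fn \<theta> x n) \<sigma>) = 1" for n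
  proof -
    have "(\<Sum>\<tau>\<in>ball_configs n. ball_weight b n (law_fn \<theta> x n) \<tau>) > 0"
      by (rule ball_weight_total_pos) (rule pos)
    then show ?thesis unfolding ball_prob_def sum_divide_distrib[symmetric] by simp
  qed
qed (rule law_ball_prob_consistent[OF \<theta> x])

text \<open>Fields with constant ratios differ from the logarithm of \<open>law_fn\<close> by a constant at each vertex, and such
  constants cancel in the normalisation.\<close>

lemma mu_field_const_law:
  assumes h: "const_boundary_law h (x^2) (law_p \<theta> x) (law_q \<theta> x) (law_T \<theta> x) (law_U \<theta> x) (law_N \<theta> x)"
    and \<xi>: "\<xi> \<in> ball_configs n"
  shows "mu_field \<beta> J h n \<xi> = ball_prob (\<beta> * J) n (law_fn \<theta> x n) \<xi>"
proof -
  define base where "base = (if n mod 3 = 1 then 0 else -1/2 :: real)"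
  have exp_h: "exp (h v s) = exp (h v base) * law_fn \<theta> x n s"
    if v: "v \<in> sphere_W n" and s: "s \<in> level_spins n" for v s
  proof -
    have q: "exp a = exp c * d" if "exp (a - c) = d" for a c d :: real
      using that by (auto simp: exp_diff)
    have len: "length v = n" using v by (simp add: sphere_W_eq)
    have cl: "v \<in> level_class 0 \<or> n mod 3 \<noteq> 0" "v \<in> level_class 1 \<or> n mod 3 \<noteq> 1"
      "v \<in> level_class 2 \<or> n mod 3 \<noteq> 2" by (auto simp: level_class_eq len)
    have "n mod 3 = 0 \<or> n mod 3 = 1 \<or> n mod 3 = 2" by auto
    then have "exp (h v s - h v base) = law_fn \<theta> x n s"
    proof (elim disjE)
      assume n: "n mod 3 = 0"
      then have "\<forall>s\<in>level_spins n. exp (h v s - h v base) = law_fn \<theta> x n s"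
        using h cl unfolding const_boundary_law_def by (simp add: level_spins_def law_fn_def base_def)
      then show ?thesis using s by blast
    next
      assume n: "n mod 3 = 1"
      then have "\<forall>s\<in>level_spins n. exp (h v s - h v base) = law_fn \<theta> x n s"
        using h cl unfolding const_boundary_law_def by (simp add: level_spins_def law_fn_def base_def)
      then show ?thesis using s by blast
    next
      assume n: "n mod 3 = 2"
      then have "\<forall>s\<in>level_spins n. exp (h v s - h v base) = law_fn \<theta> x n s"
        using h cl unfolding const_boundary_law_def by (simp add: level_spins_def law_fn_def base_def)
      then show ?thesis using s by blast
    qed
    then show ?thesis by (rule q)
  qed
  let ?c = "\<Prod>v\<in>sphere_W n. exp (h v base)"
  have w: "field_weight \<beta> J h n \<tau> = ?c * ball_weight (\<beta> * J) n (law_fn \<theta> x n) \<tau>" if "\<tau> \<in> ball_configs n" for \<tau>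
  proof -
    have "exp (\<Sum>v\<in>sphere_W n. h v (\<tau> v)) = (\<Prod>v\<in>sphere_W n. exp (h v base) * law_fn \<theta> x n (\<tau> v))"
      unfolding exp_sum[OF finite_sphere_W] using ball_configs_sphere_spin[OF that]
      by (intro prod.cong refl exp_h) auto
    then show ?thesis
      unfolding field_weight_def ball_weight_def ball_energy_eq by (simp add: exp_add prod.distrib)
  qed
  have "?c > 0" by (intro prod_pos) simp
  then show ?thesis
    unfolding mu_field_def ball_prob_def using \<xi> by (simp add: w sum_distrib_left[symmetric])
qed

lemma has_field_marginals_iff:
  assumes h: "const_boundary_law h (x^2) (law_p \<theta> x) (law_q \<theta> x) (law_T \<theta> x) (law_U \<theta> x) (law_N \<theta> x)"
  shows "has_field_marginals \<beta> J h \<mu> \<longleftrightarrow> config_prob \<mu> \<and>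
    (\<forall>n. \<forall>\<xi>\<in>ball_configs n. measure \<mu> (cyl n \<xi>) = ball_prob (\<beta> * J) n (law_fn \<theta> x n) \<xi>)"
  unfolding has_field_marginals_def cyl_def by (simp add: mu_field_const_law[OF h])

lemma tisgm_iff:
  assumes \<theta>: "\<theta> = exp (\<beta> * J / 2)" and x: "x \<in> positive_fixpoints \<theta>"
  shows "tisgm_of_fixpoint \<beta> J x \<mu> \<longleftrightarrow> config_prob \<mu> \<and>
    (\<forall>n. \<forall>\<xi>\<in>ball_configs n. measure \<mu> (cyl n \<xi>) = ball_prob (\<beta> * J) n (law_fn \<theta> x n) \<xi>)"
proof -
  let ?law = "\<lambda>h. const_boundary_law h (x^2) (law_p \<theta> x) (law_q \<theta> x) (law_T \<theta> x) (law_U \<theta> x) (law_N \<theta> x)"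
  have t: "tisgm_of_fixpoint \<beta> J x \<mu> \<longleftrightarrow> (\<exists>h. ?law h \<and> splitting_gibbs \<beta> J h \<mu>)"
    by (simp add: tisgm_of_fixpoint_def tisgm_with_law_def \<theta> Let_def)
  have xpos: "x > 0" "\<theta> > 0" using x by (auto simp: positive_fixpoints_def \<theta>)
  let ?h = "\<lambda>v s. ln (law_fn \<theta> x (length v) s)"
  have pos: "law_fn \<theta> x i s > 0" for i s using law_fn_pos xpos by blast
  have law: "?law ?h"
    unfolding const_boundary_law_def using pos law_pos[OF xpos(2,1)] xpos
    by (auto simp: level_class_eq law_fn_def)
  have "compatible_fields \<beta> J ?h"
    unfolding compatible_fields_def
  proof (intro allI impI ballI)
    fix n :: nat and \<xi> assume n: "1 \<le> n" and \<xi>: "\<xi> \<in> ball_configs (n - 1)"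
    obtain k where k: "n = Suc k" using n by (cases n) auto
    have \<xi>k: "\<xi> \<in> ball_configs k" using \<xi> k by simp
    have "(\<Sum>\<omega>\<in>(\<Pi>\<^sub>E x\<in>sphere_W n. spins x). mu_field \<beta> J ?h n (merge (ball_V (n - 1)) (sphere_W n) (\<xi>, \<omega>)))
        = (\<Sum>\<tau> | \<tau> \<in> ball_configs (Suc k) \<and> restrict \<tau> (ball_V k) = \<xi>. mu_field \<beta> J ?h (Suc k) \<tau>)"
      unfolding sum_extensions[OF \<xi>k] by (simp add: k)
    also have "\<dots> = (\<Sum>\<tau> | \<tau> \<in> ball_configs (Suc k) \<and> restrict \<tau> (ball_V k) = \<xi>.
        ball_prob (\<beta> * J) (Suc k) (law_fn \<theta> x (Suc k)) \<tau>)"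
      by (rule sum.cong[OF refl]) (auto intro: mu_field_const_law[OF law])
    also have "\<dots> = mu_field \<beta> J ?h (n - 1) \<xi>"
      using law_ball_prob_consistent[OF \<theta> x \<xi>k] mu_field_const_law[OF law \<xi>k, of \<beta> J] by (simp add: k)
    finally show "(\<Sum>\<omega>\<in>(\<Pi>\<^sub>E x\<in>sphere_W n. spins x).
        mu_field \<beta> J ?h n (merge (ball_V (n - 1)) (sphere_W n) (\<xi>, \<omega>))) = mu_field \<beta> J ?h (n - 1) \<xi>" .
  qed
  then show ?thesis
    unfolding t splitting_gibbs_def using law has_field_marginals_iff by blast
qed

lemma tisgm_unique:
  assumes \<theta>: "\<theta> = exp (\<beta> * J / 2)" and x: "x \<in> positive_fixpoints \<theta>"
    and "tisgm_of_fixpoint \<beta> J x \<mu>" "tisgm_of_fixpoint \<beta> J x \<nu>"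
  shows "\<mu> = \<nu>"
  using assms(3,4) unfolding tisgm_iff[OF \<theta> x] by (intro config_prob_eqI) auto

section \<open>The extreme Gibbs measures\<close>

text \<open>Once the ratio of the messages from the boundary spins \<open>z\<close> converges to \<open>x^2\<close>, the finite-volume measures
  converge to the measure of the fixed point \<open>x\<close>, on cylinders and hence weakly.\<close>

lemma boundary_measure_limit:
  assumes \<theta>: "\<theta> = exp (\<beta> * J / 2)" and z: "\<And>i. z i \<in> level_spins i" and per: "\<And>i. z (i + 3) = z i"
    and \<zeta>: "\<And>v. \<zeta> v = z (length v)" and x: "x \<in> positive_fixpoints \<theta>"
    and lim: "(\<lambda>l. msg_ratio (\<beta> * J) z l) \<longlonglongrightarrow> x^2"
  obtains \<mu> where "weak_limit (bc_measure_ext \<beta> J \<zeta>) \<mu>"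
    "(THE \<mu>. weak_limit (bc_measure_ext \<beta> J \<zeta>) \<mu>) = \<mu>"
    "tisgm_of_fixpoint \<beta> J x \<mu>" "mu_fixpoint \<beta> J x = \<mu>" "gibbs_measure \<beta> J \<mu>"
proof -
  have xpos: "x > 0" using x by (simp add: positive_fixpoints_def)
  have conf: "\<zeta> \<in> configs" using z by (simp add: configs_iff \<zeta> spins_eq)
  obtain \<mu> where \<mu>: "config_prob \<mu>" and marg: "\<And>n \<xi>. \<xi> \<in> ball_configs n \<Longrightarrow>
      measure \<mu> (cyl n \<xi>) = ball_prob (\<beta> * J) n (law_fn \<theta> x n) \<xi>"
    using exists_law_measure[OF \<theta> x] by blast
  have prob: "config_prob (bc_measure_ext \<beta> J \<zeta> n)" for n by (rule bc_measure_ext_prob(1)[OF conf])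
  have w: "weak_limit (bc_measure_ext \<beta> J \<zeta>) \<mu>"
    by (rule weak_limitI[OF prob \<mu>])
       (simp only: marg bc_cyl_tendsto[where z = z, OF \<theta> z per \<zeta> xpos lim])
  have t: "tisgm_of_fixpoint \<beta> J x \<mu>" unfolding tisgm_iff[OF \<theta> x] using \<mu> marg by blast
  have "law_fn \<theta> x n s > 0" for n s using xpos by (intro law_fn_pos) (simp_all add: \<theta>)
  then have g: "gibbs_measure \<beta> J \<mu>"
    by (intro gibbs_of_boundary_law[OF \<mu> _ marg]) auto
  show thesis
  proof (rule that[OF w _ t _ g])
    show "(THE \<mu>. weak_limit (bc_measure_ext \<beta> J \<zeta>) \<mu>) = \<mu>"
      using w weak_limit_unique[OF prob] by (intro the_equality) auto
    show "mu_fixpoint \<beta> J x = \<mu>"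
      unfolding mu_fixpoint_def using t tisgm_unique[OF \<theta> x] by (intro the_equality) auto
  qed
qed

theorem lemma13:
  fixes J \<beta> \<theta> x_minus x_plus :: real
  assumes "J > 0" and "\<beta> > 0" and "\<theta> = exp (\<beta> * J / 2)"
    and "s2 \<theta> > 0"
    and "x_minus = (LEAST x. x \<in> positive_fixpoints \<theta>)"
    and "x_plus = (GREATEST x. x \<in> positive_fixpoints \<theta>)"
  shows "(x_minus \<in> positive_fixpoints \<theta> \<and> x_plus \<in> positive_fixpoints \<theta> \<and>
           x_minus < 1 \<and> 1 < x_plus) \<and>
         (weak_limit (bc_measure_ext \<beta> J config_minus) (mu_minus \<beta> J) \<and>
           weak_limit (bc_measure_ext \<beta> J config_plus) (mu_plus \<beta> J)) \<and>
         (minimal_gibbs \<beta> J (mu_minus \<beta> J) \<and> maximal_gibbs \<beta> J (mu_plus \<beta> J)) \<and>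
         (tisgm_of_fixpoint \<beta> J x_minus (mu_minus \<beta> J) \<and>
           tisgm_of_fixpoint \<beta> J x_plus (mu_plus \<beta> J)) \<and>
         (mu_minus \<beta> J = mu_fixpoint \<beta> J x_minus \<and> mu_plus \<beta> J = mu_fixpoint \<beta> J x_plus) \<and>
         (extremal_gibbs \<beta> J (mu_minus \<beta> J) \<and> extremal_gibbs \<beta> J (mu_plus \<beta> J))"
proof -
  have b: "\<beta> * J \<ge> 0" and t: "\<theta> > 1" using assms by simp_all
  obtain x y where xy: "x \<in> positive_fixpoints \<theta>" "y \<in> positive_fixpoints \<theta>" "x < 1" "1 < y"
    and ext: "\<And>z. z \<in> positive_fixpoints \<theta> \<Longrightarrow> x \<le> z \<and> z \<le> y"
    using extreme_fixpoints[OF t assms(4)] by metis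
  have x: "x_minus = x" unfolding assms(5) using xy ext by (intro Least_equality) auto
  have y: "x_plus = y" unfolding assms(6) using xy ext by (intro Greatest_equality) auto
  have "(\<lambda>l. msg_ratio (\<beta> * J) level_top l) \<longlonglongrightarrow> y^2"
    using ext by (intro msg_ratio_top_tendsto[OF assms(3) b xy(2)]) auto
  then obtain \<mu> where \<mu>: "weak_limit (bc_measure_ext \<beta> J config_plus) \<mu>" "mu_plus \<beta> J = \<mu>"
    "tisgm_of_fixpoint \<beta> J y \<mu>" "mu_fixpoint \<beta> J y = \<mu>" "gibbs_measure \<beta> J \<mu>"
    unfolding mu_plus_def
    using boundary_measure_limit[where z = level_top and \<zeta> = config_plus, OF assms(3) level_top_in(1)
        level_top_periodic config_plus_level xy(2)] by metis
  have "(\<lambda>l. msg_ratio (\<beta> * J) (\<lambda>i. - level_top i) l) \<longlonglongrightarrow> x^2"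
    using ext by (intro msg_ratio_bot_tendsto[OF assms(3) b xy(1)]) auto
  then obtain \<nu> where \<nu>: "weak_limit (bc_measure_ext \<beta> J config_minus) \<nu>" "mu_minus \<beta> J = \<nu>"
    "tisgm_of_fixpoint \<beta> J x \<nu>" "mu_fixpoint \<beta> J x = \<nu>" "gibbs_measure \<beta> J \<nu>"
    unfolding mu_minus_def
    using boundary_measure_limit[where z = "\<lambda>i. - level_top i" and \<zeta> = config_minus, OF assms(3) level_top_in(2)
        _ config_minus_level xy(1)] level_top_periodic by metis
  have max: "maximal_gibbs \<beta> J \<mu>" and min: "minimal_gibbs \<beta> J \<nu>"
    unfolding maximal_gibbs_def minimal_gibbs_def
    using \<mu>(1,5) \<nu>(1,5) stoch_le_weak_limit[OF assms(2,1)] by blast+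
  then have "extremal_gibbs \<beta> J \<mu>" "extremal_gibbs \<beta> J \<nu>"
    unfolding maximal_gibbs_def minimal_gibbs_def using extremal_gibbs_of_stoch_extreme by blast+
  then show ?thesis
    unfolding x y \<mu>(2) \<nu>(2) using xy \<mu> \<nu> max min by simp
qed

end
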